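(* Let $M_0>0$ be big enough. For each $M\ge M_0$ there exists $\gamma_0=\gamma_0(M)>0$ such that for $0<\gamma\le\gamma_0$ the Rayleigh operator $\mathcal R_{M,\gamma}$ has an unstable eigenvalue $\lambda=\lambda_r+i\lambda_i$ with $$-CM\gamma\le\lambda_r<-\gamma,\qquad |\lambda_i|\le4\gamma\sqrt{\ln\big(\ln(\gamma^{-1})\big)}.$$ As a consequence, there exists a nonzero $\omega_{in}(x,y)\in L^2_{x,y}$ such that for all $t>0$ $$\|e^{-t\mathcal R_{M,\gamma}}\omega_{in}\|_{L^2_{x,y}}\ge C^{-1}e^{\gamma t}\|\omega_{in}\|_{L^2_{x,y}}.$$ Here the constant $C>0$ is independent of $M$ and $\gamma$.
   Context: The domain is $\mathbb T\times\mathbb R$ with $\mathbb T=\mathbb R/2\pi\mathbb Z$ and coordinates $(x,y)$. For $M,\gamma>0$ let $$b_0(y)=\int_0^y\Big(1+2\sqrt\pi M\gamma e^{-\frac{y'^2}{\gamma^2}}\Big)dy'.$$ The linearized Euler equation (vorticity form) around the shear flow $(b_0(y),0)$ is $\partial_t\omega+\mathcal R_{M,\gamma}\omega=0$, where $$\mathcal R_{M,\gamma}=b_0(y)\partial_x-b_0''(y)\partial_x\Delta^{-1}$$ is the Rayleigh operator, $\Delta=\partial_{xx}+\partial_{yy}$. An eigenvalue is a $\lambda\in\mathbb C$ with a nonzero eigenfunction in $L^2_{x,y}$; it is unstable (for the flow $e^{-t\mathcal R_{M,\gamma}}$) when $\lambda_r<0$. *)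

theory Defs
  imports "HOL-Analysis.Analysis"
begin

section \<open>Square-integrable functions on the cylinder\<close>

text \<open>
  A function on \<open>\<T> \<times> \<real>\<close>, \<open>\<T> = \<real> / 2\<pi>\<int>\<close>, is represented by its values on the fundamental domain
  \<open>[0, 2\<pi>) \<times> \<real>\<close>; values elsewhere are irrelevant. Elements of \<open>L\<^sup>2\<close> are functions
  rather than classes, so equality in \<open>L\<^sup>2\<close> is always written as equality almost everywhere.
\<close>

definition cylinder :: "(real \<times> real) measure" where
  "cylinder = restrict_space lborel {0..<2 * pi} \<Otimes>\<^sub>M lborel"

definition L2 :: "(real \<times> real \<Rightarrow> complex) set" where
  "L2 = {f \<in> borel_measurable cylinder. integrable cylinder (\<lambda>z. (cmod (f z))\<^sup>2)}"

definition L2_norm :: "(real \<times> real \<Rightarrow> complex) \<Rightarrow> real" where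
  "L2_norm f = sqrt (\<integral>z. (cmod (f z))\<^sup>2 \<partial>cylinder)"

definition pairing :: "(real \<times> real \<Rightarrow> complex) \<Rightarrow> (real \<times> real \<Rightarrow> complex) \<Rightarrow> complex" where
  "pairing f g = (\<integral>z. f z * g z \<partial>cylinder)"

definition locally_integrable :: "(real \<times> real \<Rightarrow> complex) \<Rightarrow> bool" where
  "locally_integrable f \<longleftrightarrow> (\<forall>R. set_integrable cylinder (UNIV \<times> {-R..R}) f)"


section \<open>Weak derivatives\<close>

definition partial_x :: "(real \<times> real \<Rightarrow> complex) \<Rightarrow> real \<times> real \<Rightarrow> complex" where
  "partial_x f = (\<lambda>(x, y). vector_derivative (\<lambda>s. f (s, y)) (at x))"

definition partial_y :: "(real \<times> real \<Rightarrow> complex) \<Rightarrow> real \<times> real \<Rightarrow> complex" where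
  "partial_y f = (\<lambda>(x, y). vector_derivative (\<lambda>s. f (x, s)) (at y))"

definition C1 :: "(real \<times> real \<Rightarrow> complex) \<Rightarrow> bool" where
  "C1 f \<longleftrightarrow>
     (\<forall>x y. (\<lambda>s. f (s, y)) differentiable at x \<and> (\<lambda>s. f (x, s)) differentiable at y) \<and>
     continuous_on UNIV (partial_x f) \<and> continuous_on UNIV (partial_y f)"

text \<open>
  Test functions are the compactly supported \<open>C\<^sup>2\<close> functions on the cylinder, viewed as functions
  on the plane that are \<open>2\<pi>\<close>-periodic in \<open>x\<close>. All equations below are of order at most two with
  locally integrable data, for which testing with \<open>C\<^sup>2\<close> or with \<open>C\<^sup>\<infinity>\<close> functions amounts to the
  same by mollification.
\<close>

definition test_function :: "(real \<times> real \<Rightarrow> complex) \<Rightarrow> bool" where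
  "test_function \<phi> \<longleftrightarrow>
     C1 \<phi> \<and> C1 (partial_x \<phi>) \<and> C1 (partial_y \<phi>) \<and>
     (\<forall>x y. \<phi> (x + 2 * pi, y) = \<phi> (x, y)) \<and>
     (\<exists>R. \<forall>x y. R < \<bar>y\<bar> \<longrightarrow> \<phi> (x, y) = 0)"

definition weak_partial_x :: "(real \<times> real \<Rightarrow> complex) \<Rightarrow> (real \<times> real \<Rightarrow> complex) \<Rightarrow> bool" where
  "weak_partial_x f g \<longleftrightarrow>
     locally_integrable f \<and> locally_integrable g \<and>
     (\<forall>\<phi>. test_function \<phi> \<longrightarrow> pairing f (partial_x \<phi>) = - pairing g \<phi>)"

definition weak_laplacian :: "(real \<times> real \<Rightarrow> complex) \<Rightarrow> (real \<times> real \<Rightarrow> complex) \<Rightarrow> bool" where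
  "weak_laplacian f g \<longleftrightarrow>
     locally_integrable f \<and> locally_integrable g \<and>
     (\<forall>\<phi>. test_function \<phi> \<longrightarrow>
        pairing f (\<lambda>z. partial_x (partial_x \<phi>) z + partial_y (partial_y \<phi>) z) = pairing g \<phi>)"

text \<open>
  \<open>v = \<partial>\<^sub>x \<Delta>\<^sup>-\<^sup>1 \<omega>\<close>. The stream function \<open>\<psi>\<close> is determined only up to \<open>a + b y\<close> (and need not lie in
  \<open>L\<^sup>2\<close>, because of the \<open>x\<close>-average of \<open>\<omega>\<close>), but \<open>\<partial>\<^sub>x \<psi>\<close> is uniquely determined by
  \<open>\<Delta>\<psi> = \<omega>\<close> and \<open>\<partial>\<^sub>x \<psi> \<in> L\<^sup>2\<close>, since there is no nonzero harmonic function in \<open>L\<^sup>2\<close> of the cylinder.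
\<close>

definition partial_x_inv_laplacian ::
    "(real \<times> real \<Rightarrow> complex) \<Rightarrow> (real \<times> real \<Rightarrow> complex) \<Rightarrow> bool" where
  "partial_x_inv_laplacian \<omega> v \<longleftrightarrow>
     v \<in> L2 \<and> (\<exists>\<psi>. weak_laplacian \<psi> \<omega> \<and> weak_partial_x \<psi> v)"


section \<open>The Rayleigh operator\<close>

definition b0 :: "real \<Rightarrow> real \<Rightarrow> real \<Rightarrow> real" where
  "b0 M \<gamma> y = (LBINT s=0..y. 1 + 2 * sqrt pi * M * \<gamma> * exp (- (s\<^sup>2 / \<gamma>\<^sup>2)))"

text \<open>
  Unbounded operators on \<open>L\<^sup>2\<close> are given by their graphs: \<open>rayleigh M \<gamma> \<omega> g\<close> says that \<open>\<omega>\<close> is in the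
  domain and is mapped to \<open>g\<close>. The domain is the maximal one, \<open>{\<omega> \<in> L\<^sup>2. b\<^sub>0 \<partial>\<^sub>x \<omega> \<in> L\<^sup>2}\<close>; as \<open>b\<^sub>0\<close>
  does not depend on \<open>x\<close>, the distribution \<open>b\<^sub>0 \<partial>\<^sub>x \<omega>\<close> is \<open>\<partial>\<^sub>x (b\<^sub>0 \<omega>)\<close>.
\<close>

definition rayleigh ::
    "real \<Rightarrow> real \<Rightarrow> (real \<times> real \<Rightarrow> complex) \<Rightarrow> (real \<times> real \<Rightarrow> complex) \<Rightarrow> bool" where
  "rayleigh M \<gamma> \<omega> g \<longleftrightarrow>
     \<omega> \<in> L2 \<and> g \<in> L2 \<and>
     (\<exists>h v. h \<in> L2 \<and> weak_partial_x (\<lambda>(x, y). of_real (b0 M \<gamma> y) * \<omega> (x, y)) h \<and>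
        partial_x_inv_laplacian \<omega> v \<and>
        (AE (x, y) in cylinder. g (x, y) = h (x, y) - of_real (deriv (deriv (b0 M \<gamma>)) y) * v (x, y)))"

definition eigenvalue ::
    "((real \<times> real \<Rightarrow> complex) \<Rightarrow> (real \<times> real \<Rightarrow> complex) \<Rightarrow> bool) \<Rightarrow> complex \<Rightarrow> bool" where
  "eigenvalue A l \<longleftrightarrow>
     (\<exists>\<omega>\<in>L2. \<not> (AE z in cylinder. \<omega> z = 0) \<and> A \<omega> (\<lambda>z. l * \<omega> z))"

definition unstable_eigenvalue ::
    "((real \<times> real \<Rightarrow> complex) \<Rightarrow> (real \<times> real \<Rightarrow> complex) \<Rightarrow> bool) \<Rightarrow> complex \<Rightarrow> bool" where
  "unstable_eigenvalue A l \<longleftrightarrow> eigenvalue A l \<and> Re l < 0"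


section \<open>The flow\<close>

text \<open>
  Mild solutions \<open>u \<in> C([0,\<infinity>); L\<^sup>2)\<close> of \<open>\<partial>\<^sub>t u + A u = 0\<close>, \<open>u(0) = \<omega>\<^sub>i\<^sub>n\<close>: the integral
  \<open>U = \<integral>\<^sub>0\<^sup>t u(s) ds\<close> is in the domain of \<open>A\<close> and \<open>u(t) = \<omega>\<^sub>i\<^sub>n - A U\<close>, for all \<open>t \<ge> 0\<close>.
  The \<open>L\<^sup>2\<close>-valued integral \<open>U\<close> is specified by its pairings with \<open>L\<^sup>2\<close>.
\<close>

definition mild_solution ::
    "((real \<times> real \<Rightarrow> complex) \<Rightarrow> (real \<times> real \<Rightarrow> complex) \<Rightarrow> bool) \<Rightarrow>
     (real \<times> real \<Rightarrow> complex) \<Rightarrow> (real \<Rightarrow> real \<times> real \<Rightarrow> complex) \<Rightarrow> bool" where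
  "mild_solution A \<omega>\<^sub>i\<^sub>n u \<longleftrightarrow>
     (\<forall>t\<ge>0. u t \<in> L2) \<and>
     (\<forall>t\<ge>0. ((\<lambda>s. L2_norm (\<lambda>z. u s z - u t z)) \<longlongrightarrow> 0) (at t within {0..})) \<and>
     (\<forall>t\<ge>0. \<exists>U\<in>L2.
        (\<forall>f\<in>L2. pairing U f = (LBINT s=0..t. pairing (u s) f)) \<and>
        A U (\<lambda>z. \<omega>\<^sub>i\<^sub>n z - u t z))"

text \<open>
  \<open>e\<^sup>-\<^sup>t\<^sup>R \<omega>\<^sub>i\<^sub>n\<close> for \<open>\<omega>\<^sub>i\<^sub>n \<in> L\<^sup>2\<close>. The mild solution is unique as a curve in \<open>L\<^sup>2\<close>, hence only up to null sets
  as a function; this is why a choice operator is used.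
\<close>

definition rayleigh_flow ::
    "real \<Rightarrow> real \<Rightarrow> real \<Rightarrow> (real \<times> real \<Rightarrow> complex) \<Rightarrow> real \<times> real \<Rightarrow> complex" where
  "rayleigh_flow M \<gamma> t \<omega>\<^sub>i\<^sub>n = (SOME u. mild_solution (rayleigh M \<gamma>) \<omega>\<^sub>i\<^sub>n u) t"

end

(* For the mode exp (i k x) and the eigenvalue l = i k c, the eigenvalue equation is the Rayleigh
   equation phi'' - k^2 phi = Q phi with Q = b0'' / (b0 - c). Take c = i gamma m. On the scale
   y = gamma z the potential Q tends to a multiple of a Dirac mass, so a decaying solution is
   exp (- k |y|) up to small errors, and the matching condition is
   2 k = 4 sqrt pi M (integral of z^2 exp (- z^2) / (z^2 + m^2) over the line) in the limit
   gamma -> 0. The oddness of b0 makes the exact matching condition real, and the intermediate value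
   theorem gives a root m in [1, 2] if the integer k is chosen proportional to M; then l = - k gamma m
   is real and of size M gamma.

   The adjoint eigenfunction is exp (- i k x) phi / (b0 - c). Pairing any mild solution with it gives
   a scalar equation whose solution grows like exp (k gamma m t). Since m is of order one, the angle
   between the two eigenfunctions is bounded below uniformly in M and gamma, and Cauchy-Schwarz turns
   this growth into a lower bound for the norm. *)

theory Submission
  imports Defs "HOL-Probability.Sinc_Integral"
begin

section \<open>A bound state of a weak short-range potential\<close>

text \<open>The convolution with exp(-k|y - s|) Q(s) / (2 k) is no contraction: the bound state is
  an eigenfunction of it, and its size is governed by the mass of \<open>Q\<close>, which is of
  order \<open>M\<close>, like k, and does not shrink with \<open>\<gamma>\<close>. Subtracting the
  rank-one kernel exp(-k|y|) exp(-k|s|), which is what a Dirac mass would see, leaves a kernel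
  bounded by 2 k |s|. Only the first moment of \<open>Q\<close> then counts, and it is of order
  \<open>M \<gamma>\<close>. Fixing the coefficient of the removed part at 1 gives a fixed-point
  problem; asking that this coefficient be consistent gives the scalar matching condition.

  The order of the quantifiers makes the errors affordable: \<open>\<gamma>\<close> is chosen after
  \<open>M\<close>, so an error that is bad in \<open>M\<close> but carries a factor
  \<open>\<gamma>\<close> is harmless, and only leading terms must be uniform in \<open>M\<close>.

  The flow is selected by \<open>SOME\<close>, so the growth bound has to hold for an arbitrary mild
  solution. The weak equations satisfied by such a solution admit only compactly supported tests,
  while the adjoint eigenfunction merely decays; this is why cutoffs and degrees of smoothness are
  tracked.\<close>

lemma abs_exp_minus_diff_le:
  fixes a b :: real
  assumes "0 \<le> a" "0 \<le> b"
  shows "\<bar>exp (- a) - exp (- b)\<bar> \<le> \<bar>a - b\<bar>"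
proof -
  have *: "exp (- u) - exp (- v) \<le> v - u" if "0 \<le> u" "u \<le> v" for u v :: real
  proof -
    have "exp (- u) - exp (- v) = exp (- u) * (1 - exp (- (v - u)))"
      by (simp add: algebra_simps flip: exp_add)
    also have "\<dots> \<le> 1 * (1 - exp (- (v - u)))"
      using that by (intro mult_right_mono) auto
    also have "\<dots> \<le> v - u"
      using exp_ge_add_one_self[of "- (v - u)"] unfolding mult_1 by linarith
    finally show ?thesis .
  qed
  show ?thesis
    using *[of a b] *[of b a] assms by (cases "a \<le> b") (auto simp: abs_if)
qed

lemma exp_abs_lipschitz:
  fixes k a b :: real
  assumes k: "0 \<le> k"
  shows "\<bar>exp (- (k * \<bar>a\<bar>)) - exp (- (k * \<bar>b\<bar>))\<bar> \<le> k * \<bar>a - b\<bar>"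
proof -
  have "\<bar>exp (- (k * \<bar>a\<bar>)) - exp (- (k * \<bar>b\<bar>))\<bar> \<le> \<bar>k * \<bar>a\<bar> - k * \<bar>b\<bar>\<bar>"
    by (rule abs_exp_minus_diff_le) (use k in auto)
  also have "\<dots> = k * \<bar>\<bar>a\<bar> - \<bar>b\<bar>\<bar>"
    using k by (simp add: abs_mult flip: right_diff_distrib)
  also have "\<dots> \<le> k * \<bar>a - b\<bar>" using k by (intro mult_left_mono) auto
  finally show ?thesis .
qed

text \<open>The decaying Green kernel of k^2 - d^2/dy^2 is exp(-k|y - s|) / (2 k). Removing its
  separable part leaves 2 k times the Green kernel with a Dirichlet condition at 0; it vanishes when
  \<open>y\<close> and \<open>s\<close> lie on opposite sides of 0.\<close>

definition green_defect :: "real \<Rightarrow> real \<Rightarrow> real \<Rightarrow> real" where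
  "green_defect k y s = exp (- (k * \<bar>y - s\<bar>)) - exp (- (k * (\<bar>y\<bar> + \<bar>s\<bar>)))"

text \<open>By the triangle inequality the two exponents differ by at most 2 k |s|, whatever
  \<open>y\<close> is. The factor |s| is what turns the mass of the potential into its first
  moment.\<close>

lemma green_defect_bound: "0 \<le> k \<Longrightarrow> \<bar>green_defect k y s\<bar> \<le> 2 * k * \<bar>s\<bar>"
proof -
  assume k: "0 \<le> k"
  have "\<bar>green_defect k y s\<bar> \<le> \<bar>k * \<bar>y - s\<bar> - k * (\<bar>y\<bar> + \<bar>s\<bar>)\<bar>"
    unfolding green_defect_def by (rule abs_exp_minus_diff_le) (use k in auto)
  also have "\<dots> = k * \<bar>\<bar>y - s\<bar> - (\<bar>y\<bar> + \<bar>s\<bar>)\<bar>"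
    using k by (simp add: abs_mult flip: right_diff_distrib)
  also have "\<dots> \<le> k * (2 * \<bar>s\<bar>)"
    using k by (intro mult_left_mono) auto
  finally show ?thesis by simp
qed

lemma green_defect_lipschitz: "0 \<le> k \<Longrightarrow> \<bar>green_defect k y s - green_defect k z s\<bar> \<le> 2 * k * \<bar>y - z\<bar>"
proof -
  assume k: "0 \<le> k"
  have 1: "\<bar>exp (- (k * \<bar>y - s\<bar>)) - exp (- (k * \<bar>z - s\<bar>))\<bar> \<le> k * \<bar>y - z\<bar>"
    using exp_abs_lipschitz[OF k, of "y - s" "z - s"] by simp
  have "\<bar>exp (- (k * (\<bar>y\<bar> + \<bar>s\<bar>))) - exp (- (k * (\<bar>z\<bar> + \<bar>s\<bar>)))\<bar> \<le> \<bar>k * (\<bar>y\<bar> + \<bar>s\<bar>) - k * (\<bar>z\<bar> + \<bar>s\<bar>)\<bar>"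
    by (rule abs_exp_minus_diff_le) (use k in auto)
  also have "\<dots> = \<bar>k * (\<bar>y\<bar> - \<bar>z\<bar>)\<bar>" by (simp add: algebra_simps)
  also have "\<dots> = k * \<bar>\<bar>y\<bar> - \<bar>z\<bar>\<bar>" using k by (simp only: abs_mult abs_of_nonneg)
  also have "\<dots> \<le> k * \<bar>y - z\<bar>" using k by (intro mult_left_mono) auto
  finally show ?thesis using 1 unfolding green_defect_def by linarith
qed

lemma cmod_of_real_minus_one: "cmod (complex_of_real x - 1) = \<bar>x - 1\<bar>"
  by (metis norm_of_real of_real_1 of_real_diff)

lemma continuous_green_defect [continuous_intros]: "continuous_on A (\<lambda>s. green_defect k y s)"
  unfolding green_defect_def by (intro continuous_intros)

text \<open>\<open>q\<close> is one majorant for a whole family of complex potentials. Its mass may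
  be large; only its first moment is small. The bound 1/2 on \<open>\<delta>\<close> makes the map
  \<open>T\<close> below a contraction and is the source of the bound 2 for its fixed point.\<close>

locale short_range =
  fixes k \<delta> :: real and q :: "real \<Rightarrow> real"
  assumes k_pos: "0 < k"
    and q_int: "integrable lborel q"
    and yq_int: "integrable lborel (\<lambda>y. \<bar>y\<bar> * q y)"
    and yq_le: "(LBINT y. \<bar>y\<bar> * q y) \<le> \<delta>"
    and \<delta>_le: "\<delta> \<le> 1 / 2"
    and q_nonneg: "0 \<le> q y"
begin

definition potential :: "(real \<Rightarrow> complex) \<Rightarrow> bool" where
  "potential Q \<longleftrightarrow> continuous_on UNIV Q \<and> (\<forall>y. cmod (Q y) \<le> q y)"

lemma \<delta>_nonneg: "0 \<le> \<delta>"
proof -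
  have "0 \<le> (LBINT y. \<bar>y\<bar> * q y)" by (simp add: q_nonneg)
  then show ?thesis using yq_le by simp
qed

section \<open>The defect operator on bounded continuous functions\<close>

lemma integrable_weighted:
  fixes c :: "real \<Rightarrow> complex"
  assumes "potential Q" "continuous_on UNIV c" "continuous_on UNIV u"
    and "\<And>s. cmod (c s) \<le> C" "\<And>s. cmod (u s) \<le> B"
  shows "integrable lborel (\<lambda>s. c s * Q s * u s)"
proof (rule Bochner_Integration.integrable_bound)
  show "integrable lborel (\<lambda>s. C * B * q s)" using q_int by simp
  show "(\<lambda>s. c s * Q s * u s) \<in> borel_measurable lborel"
    using assms unfolding potential_def
    by (auto intro!: borel_measurable_continuous_onI continuous_intros)
  have "cmod (c s * Q s * u s) \<le> C * q s * B" for s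
    unfolding norm_mult using assms q_nonneg
    by (intro mult_mono) (auto simp: potential_def intro: order_trans[OF norm_ge_zero] mult_nonneg_nonneg)
  then show "AE s in lborel. norm (c s * Q s * u s) \<le> norm (C * B * q s)"
    by (auto intro!: AE_I2 simp: mult_ac intro: order_trans[OF _ abs_ge_self])
qed

abbreviation green :: "(real \<Rightarrow> complex) \<Rightarrow> (real \<Rightarrow> complex) \<Rightarrow> real \<Rightarrow> complex" where
  "green Q u y \<equiv> (LBINT s. complex_of_real (green_defect k y s) * Q s * u s)"

lemma integrable_green_defect:
  assumes "potential Q" "continuous_on UNIV u" "\<And>s. cmod (u s) \<le> B"
  shows "integrable lborel (\<lambda>s. complex_of_real (green_defect k y s) * Q s * u s)"
proof (rule integrable_weighted[OF assms(1) _ assms(2) _ assms(3), where C = 1])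
  show "continuous_on UNIV (\<lambda>s. complex_of_real (green_defect k y s))" by (intro continuous_intros)
  fix s
  have "exp (- (k * \<bar>y - s\<bar>)) \<le> 1" "exp (- (k * (\<bar>y\<bar> + \<bar>s\<bar>))) \<le> 1"
    using k_pos by simp_all
  moreover have "0 < exp (- (k * \<bar>y - s\<bar>))" "0 < exp (- (k * (\<bar>y\<bar> + \<bar>s\<bar>)))" by simp_all
  ultimately have "\<bar>green_defect k y s\<bar> \<le> 1" unfolding green_defect_def abs_le_iff by linarith
  then show "cmod (complex_of_real (green_defect k y s)) \<le> 1" by simp
qed

text \<open>The weight \<open>w\<close> is either 1 or |s|, so that one estimate yields both the
  mass and the first moment of \<open>q\<close>; this explains the products \<open>1 * q s\<close>
  further on.\<close>

lemma norm_integral_le: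
  fixes f :: "real \<Rightarrow> complex"
  assumes "integrable lborel f" "\<And>s. cmod (f s) \<le> C * (w s * q s)" "integrable lborel (\<lambda>s. w s * q s)"
  shows "cmod (LBINT s. f s) \<le> C * (LBINT s. w s * q s)"
proof -
  have "cmod (LBINT s. f s) \<le> (LBINT s. cmod (f s))"
    using integral_norm_bound by blast
  also have "\<dots> \<le> (LBINT s. C * (w s * q s))"
    by (rule integral_mono) (use assms in auto)
  finally show ?thesis by simp
qed

lemma green_defect_integral_bound:
  assumes "potential Q" "continuous_on UNIV u" "\<And>s. cmod (u s) \<le> B"
  shows "cmod (green Q u y) \<le> 2 * k * (\<delta> * B)"
proof -
  have B: "0 \<le> B" using assms(3)[of 0] norm_ge_zero order_trans by blast
  have "cmod (green Q u y) \<le> (2 * k * B) * (LBINT s. \<bar>s\<bar> * q s)"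
  proof (rule norm_integral_le)
    show "integrable lborel (\<lambda>s. complex_of_real (green_defect k y s) * Q s * u s)"
      by (rule integrable_green_defect[OF assms])
    fix s
    have "\<bar>green_defect k y s\<bar> * cmod (Q s) * cmod (u s) \<le> (2 * k * \<bar>s\<bar>) * q s * B"
      using assms green_defect_bound[of k y s] k_pos q_nonneg B
      by (intro mult_mono) (auto simp: potential_def)
    then show "cmod (complex_of_real (green_defect k y s) * Q s * u s) \<le> 2 * k * B * (\<bar>s\<bar> * q s)"
      by (simp add: norm_mult mult_ac)
  qed (rule yq_int)
  also have "\<dots> \<le> (2 * k * B) * \<delta>"
    using yq_le k_pos B by (intro mult_left_mono) auto
  finally show ?thesis by (simp add: mult_ac)
qed

text \<open>The equation u = - K u, with K the full convolution, after the coefficient of exp(-k|y|)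
  contributed by the rank-one part of K has been replaced by 1. As the defect kernel vanishes at y =
  0, a fixed point satisfies u(0) = 1.\<close>

definition T :: "(real \<Rightarrow> complex) \<Rightarrow> (real \<Rightarrow> complex) \<Rightarrow> real \<Rightarrow> complex" where
  "T Q u y = complex_of_real (exp (- (k * \<bar>y\<bar>))) -
     (green Q u y) / complex_of_real (2 * k)"

text \<open>The factor 2 k in the kernel bound cancels the prefactor 1 / (2 k), so the contraction
  ratio is the first moment and does not depend on k.\<close>

lemma T_diff_bound:
  assumes "potential Q" "continuous_on UNIV u" "\<And>s. cmod (u s) \<le> B"
    and "continuous_on UNIV v" "\<And>s. cmod (v s) \<le> B'" "\<And>s. cmod (u s - v s) \<le> E"
  shows "cmod (T Q u y - T Q v y) \<le> \<delta> * E"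
proof -
  have "T Q u y - T Q v y =
    - (LBINT s. complex_of_real (green_defect k y s) * Q s * (u s - v s)) / complex_of_real (2 * k)"
    unfolding T_def right_diff_distrib
    by (subst Bochner_Integration.integral_diff)
      (use assms integrable_green_defect in \<open>auto simp: diff_divide_distrib intro: integrable_green_defect\<close>)
  also have "cmod \<dots> \<le> (2 * k * (\<delta> * E)) / (2 * k)"
    unfolding norm_divide norm_minus_cancel using k_pos assms
    by (intro frac_le green_defect_integral_bound) (auto intro!: continuous_intros mult_nonneg_nonneg \<delta>_nonneg
        order_trans[OF norm_ge_zero assms(6)])
  finally show ?thesis using k_pos by simp
qed

lemma T_minus_exp:
  assumes "potential Q" "continuous_on UNIV u" "\<And>s. cmod (u s) \<le> B"
  shows "cmod (T Q u y - complex_of_real (exp (- (k * \<bar>y\<bar>)))) \<le> \<delta> * B"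
  using T_diff_bound[OF assms, of "\<lambda>_. 0" 0 B y] assms by (simp add: T_def)

lemma T_lipschitz:
  assumes "potential Q" "continuous_on UNIV u" "\<And>s. cmod (u s) \<le> B"
  shows "cmod (T Q u y - T Q u z) \<le> (k + B * (LBINT s. 1 * q s)) * \<bar>y - z\<bar>"
proof -
  have B: "0 \<le> B" using assms(3)[of 0] norm_ge_zero order_trans by blast
  have "cmod ((green Q u y) - (green Q u z))
     = cmod (LBINT s. complex_of_real (green_defect k y s - green_defect k z s) * Q s * u s)"
    by (subst Bochner_Integration.integral_diff[symmetric])
      (use integrable_green_defect[OF assms] in \<open>auto simp: algebra_simps\<close>)
  also have "\<dots> \<le> 2 * k * \<bar>y - z\<bar> * B * (LBINT s. 1 * q s)"
  proof (rule norm_integral_le)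
    show "integrable lborel (\<lambda>s. complex_of_real (green_defect k y s - green_defect k z s) * Q s * u s)"
      using Bochner_Integration.integrable_diff[OF integrable_green_defect[OF assms] integrable_green_defect[OF assms], of y z]
      by (simp add: algebra_simps)
    fix s
    have "\<bar>green_defect k y s - green_defect k z s\<bar> * cmod (Q s) * cmod (u s) \<le> (2 * k * \<bar>y - z\<bar>) * q s * B"
      using assms green_defect_lipschitz[of k y s z] k_pos q_nonneg B
      by (intro mult_mono) (auto simp: potential_def)
    then show "cmod (complex_of_real (green_defect k y s - green_defect k z s) * Q s * u s) \<le> 2 * k * \<bar>y - z\<bar> * B * (1 * q s)"
      unfolding norm_mult norm_of_real by (simp add: mult_ac)
  qed (use q_int in simp)
  finally have "cmod ((green Q u y) - (green Q u z)) / (2 * k)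
     \<le> B * (LBINT s. 1 * q s) * \<bar>y - z\<bar>"
    using k_pos by (simp add: field_simps)
  moreover have "\<bar>exp (- (k * \<bar>y\<bar>)) - exp (- (k * \<bar>z\<bar>))\<bar> \<le> k * \<bar>y - z\<bar>"
    using k_pos by (intro exp_abs_lipschitz) simp
  moreover have "T Q u y - T Q u z = complex_of_real (exp (- (k * \<bar>y\<bar>)) - exp (- (k * \<bar>z\<bar>))) -
     ((green Q u y) - (green Q u z)) / complex_of_real (2 * k)"
    unfolding T_def by (simp add: diff_divide_distrib)
  then have "cmod (T Q u y - T Q u z) \<le> \<bar>exp (- (k * \<bar>y\<bar>)) - exp (- (k * \<bar>z\<bar>))\<bar> +
     cmod ((green Q u y) - (green Q u z)) / (2 * k)"
    using k_pos by (metis (no_types, lifting) norm_divide norm_of_real norm_triangle_ineq4 abs_of_pos mult_pos_pos zero_less_numeral)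
  ultimately show ?thesis by (simp add: algebra_simps)
qed

lemma lipschitz_continuous:
  fixes f :: "real \<Rightarrow> complex"
  assumes "\<And>y z. cmod (f y - f z) \<le> L * \<bar>y - z\<bar>"
  shows "continuous_on UNIV f"
proof -
  have "0 \<le> L" using order_trans[OF norm_ge_zero assms[of 1 0]] by simp
  then have "L-lipschitz_on UNIV f"
    by (intro lipschitz_onI) (auto simp: dist_norm assms)
  then show ?thesis by (rule lipschitz_on_continuous_on)
qed

section \<open>The fixed point in the space of bounded continuous functions\<close>

lemma T_bcontfun:
  assumes "potential Q"
  shows "T Q (apply_bcontfun u) \<in> bcontfun"
proof (rule bcontfun_normI)
  let ?f = "apply_bcontfun u"
  have b: "\<And>s. cmod (?f s) \<le> norm u" by (rule norm_bounded)
  have c: "continuous_on UNIV ?f" by simp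
  show "continuous_on UNIV (T Q ?f)"
    by (rule lipschitz_continuous) (rule T_lipschitz[OF assms c b])
  fix y
  have "cmod (complex_of_real (exp (- (k * \<bar>y\<bar>)))) \<le> 1" using k_pos by simp
  then show "cmod (T Q ?f y) \<le> \<delta> * norm u + 1"
    using T_minus_exp[OF assms c b, of y] norm_triangle_sub[of "T Q ?f y" "complex_of_real (exp (- (k * \<bar>y\<bar>)))"]
    by linarith
qed

text \<open>\<open>T Q\<close> contracts the sup norm by \<open>\<delta>\<close>. Uniqueness matters
  as much as existence: it transfers the symmetry of \<open>Q\<close> to the solution.\<close>

lemma fixed_point_ex1:
  assumes "potential Q"
  shows "\<exists>!u::real \<Rightarrow>\<^sub>C complex. \<forall>y. u y = T Q u y"
proof -
  define F where "F = (\<lambda>u::real \<Rightarrow>\<^sub>C complex. Bcontfun (T Q (apply_bcontfun u)))"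
  have F: "apply_bcontfun (F u) = T Q (apply_bcontfun u)" for u
    unfolding F_def by (rule Bcontfun_inverse[OF T_bcontfun[OF assms]])
  have "\<exists>!u. F u = u"
  proof (rule banach_fix_type[of \<delta>])
    show "\<forall>x y. dist (F x) (F y) \<le> \<delta> * dist x y"
    proof (intro allI)
      fix x y
      show "dist (F x) (F y) \<le> \<delta> * dist x y"
      proof (rule dist_bound)
        fix s
        have "cmod (T Q (apply_bcontfun x) s - T Q (apply_bcontfun y) s) \<le> \<delta> * dist x y"
        proof (rule T_diff_bound[OF assms])
          fix s
          show "cmod (apply_bcontfun x s) \<le> norm x" "cmod (apply_bcontfun y s) \<le> norm y"
            by (rule norm_bounded)+
          show "cmod (apply_bcontfun x s - apply_bcontfun y s) \<le> dist x y"
            by (metis dist_bounded dist_norm)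
        qed simp_all
        then show "dist (apply_bcontfun (F x) s) (apply_bcontfun (F y) s) \<le> \<delta> * dist x y"
          by (simp only: F dist_norm[of "T Q (apply_bcontfun x) s"])
      qed
    qed
  qed (use \<delta>_nonneg \<delta>_le in auto)
  moreover have "F u = u \<longleftrightarrow> (\<forall>y. u y = T Q u y)" for u
    by (metis F bcontfun_eqI)
  ultimately show ?thesis by simp
qed

definition sol :: "(real \<Rightarrow> complex) \<Rightarrow> real \<Rightarrow> complex" where
  "sol Q = apply_bcontfun (THE u::real \<Rightarrow>\<^sub>C complex. \<forall>y. u y = T Q u y)"

lemma sol_eq: "potential Q \<Longrightarrow> sol Q y = T Q (sol Q) y"
  using theI'[OF fixed_point_ex1] unfolding sol_def by blast

lemma sol_unique:
  assumes "potential Q" "continuous_on UNIV v" "\<And>s. cmod (v s) \<le> B" "\<And>y. v y = T Q v y"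
  shows "v = sol Q"
proof -
  have "v \<in> bcontfun" using assms by (intro bcontfun_normI)
  then have *: "apply_bcontfun (Bcontfun v) = v" by (rule Bcontfun_inverse)
  have "(THE u::real \<Rightarrow>\<^sub>C complex. \<forall>y. u y = T Q u y) = Bcontfun v"
    by (rule the1_equality[OF fixed_point_ex1[OF assms(1)]]) (use * assms(4) in simp)
  then show ?thesis unfolding sol_def using * by simp
qed

lemma continuous_sol: "continuous_on A (sol Q)"
  unfolding sol_def by simp

lemma sol_bound:
  assumes "potential Q"
  shows "cmod (sol Q y) \<le> 2"
proof -
  obtain u :: "real \<Rightarrow>\<^sub>C complex" where u: "sol Q = apply_bcontfun u" unfolding sol_def by blast
  \<comment> \<open>The unknown norm also stands on the right, where \<open>\<delta>\<close> at most
    1/2 lets it be absorbed.\<close>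
  have "norm u \<le> \<delta> * norm u + 1"
  proof (rule norm_bound)
    fix y
    have "cmod (complex_of_real (exp (- (k * \<bar>y\<bar>)))) \<le> 1" using k_pos by simp
    moreover have "cmod (sol Q y - complex_of_real (exp (- (k * \<bar>y\<bar>)))) \<le> \<delta> * norm u"
      by (subst sol_eq[OF assms], rule T_minus_exp[OF assms continuous_sol]) (simp add: u norm_bounded)
    ultimately show "cmod (apply_bcontfun u y) \<le> \<delta> * norm u + 1"
      using norm_triangle_sub[of "sol Q y" "complex_of_real (exp (- (k * \<bar>y\<bar>)))"]
      unfolding u by linarith
  qed
  moreover have "\<delta> * norm u \<le> 1 / 2 * norm u"
    using \<delta>_le by (intro mult_right_mono) auto
  ultimately have "norm u \<le> 2" by simp
  then show ?thesis using norm_bounded[of u y] u by simp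
qed

lemma sol_minus_exp:
  assumes "potential Q"
  shows "cmod (sol Q y - complex_of_real (exp (- (k * \<bar>y\<bar>)))) \<le> 2 * \<delta>"
  by (subst sol_eq[OF assms], subst mult.commute[of 2]) (rule T_minus_exp[OF assms continuous_sol sol_bound[OF assms]])

lemma sol_minus_one:
  assumes "potential Q"
  shows "cmod (sol Q y - 1) \<le> k * \<bar>y\<bar> + 2 * \<delta>"
proof -
  have "cmod (complex_of_real (exp (- (k * \<bar>y\<bar>))) - 1) \<le> k * \<bar>y\<bar>"
    using exp_abs_lipschitz[of k y 0] k_pos by (simp add: cmod_of_real_minus_one)
  then show ?thesis
    using sol_minus_exp[OF assms, of y]
      norm_triangle_ineq[of "sol Q y - complex_of_real (exp (- (k * \<bar>y\<bar>)))" "complex_of_real (exp (- (k * \<bar>y\<bar>))) - 1"]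
    by simp
qed

lemma cmod_divide_2k_le:
  "w = - I / complex_of_real (2 * k) \<Longrightarrow> cmod I \<le> r \<Longrightarrow> cmod w \<le> r / (2 * k)"
  using k_pos by (simp add: norm_divide divide_right_mono)

text \<open>Two fixed points are compared by inserting \<open>T Q (sol Q')\<close>. The first
  difference is absorbed by the contraction; the second is at most 2
  \<open>\<delta> \<epsilon>\<close> because \<open>sol Q'\<close> is bounded by 2, and the
  absorption doubles it. This is the source of continuity in the spectral parameter.\<close>

lemma sol_perturb:
  assumes "potential Q" "potential Q'" "\<And>y. cmod (Q y - Q' y) \<le> \<epsilon> * q y" "0 \<le> \<epsilon>"
  shows "cmod (sol Q y - sol Q' y) \<le> 4 * \<delta> * \<epsilon>"
proof -
  obtain u :: "real \<Rightarrow>\<^sub>C complex" where u: "sol Q = apply_bcontfun u" unfolding sol_def by blast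
  obtain v :: "real \<Rightarrow>\<^sub>C complex" where v: "sol Q' = apply_bcontfun v" unfolding sol_def by blast
  let ?E = "norm (u - v)"
  have E: "cmod (sol Q s - sol Q' s) \<le> ?E" for s
    using norm_bounded[of "u - v" s] by (simp add: u v)
  have *: "cmod (sol Q y - sol Q' y) \<le> \<delta> * ?E + 2 * \<delta> * \<epsilon>" for y
  proof -
    have 1: "cmod (T Q (sol Q) y - T Q (sol Q') y) \<le> \<delta> * ?E"
      by (rule T_diff_bound[OF assms(1) continuous_sol sol_bound[OF assms(1)] continuous_sol sol_bound[OF assms(2)] E])
    have "T Q (sol Q') y - T Q' (sol Q') y =
      - (LBINT s. complex_of_real (green_defect k y s) * (Q s - Q' s) * sol Q' s) / complex_of_real (2 * k)"
      unfolding T_def right_diff_distrib left_diff_distrib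
      by (subst Bochner_Integration.integral_diff)
        (use integrable_green_defect[OF assms(1) continuous_sol sol_bound[OF assms(2)]]
          integrable_green_defect[OF assms(2) continuous_sol sol_bound[OF assms(2)]] in \<open>auto simp: diff_divide_distrib\<close>)
    note eq = this
    have "cmod (LBINT s. complex_of_real (green_defect k y s) * (Q s - Q' s) * sol Q' s) \<le> (2 * k * \<epsilon> * 2) * (LBINT s. \<bar>s\<bar> * q s)"
    proof (rule norm_integral_le)
      show "integrable lborel (\<lambda>s. complex_of_real (green_defect k y s) * (Q s - Q' s) * sol Q' s)"
        using Bochner_Integration.integrable_diff[OF integrable_green_defect[OF assms(1) continuous_sol sol_bound[OF assms(2)]]
          integrable_green_defect[OF assms(2) continuous_sol sol_bound[OF assms(2)]], of y y]
        by (simp add: algebra_simps)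
      fix s
      have "\<bar>green_defect k y s\<bar> * cmod (Q s - Q' s) * cmod (sol Q' s) \<le> (2 * k * \<bar>s\<bar>) * (\<epsilon> * q s) * 2"
        using assms green_defect_bound[of k y s] k_pos q_nonneg sol_bound[OF assms(2)]
        by (intro mult_mono) auto
      then show "cmod (complex_of_real (green_defect k y s) * (Q s - Q' s) * sol Q' s) \<le> 2 * k * \<epsilon> * 2 * (\<bar>s\<bar> * q s)"
        unfolding norm_mult norm_of_real by (simp add: mult_ac)
    qed (rule yq_int)
    also have "\<dots> \<le> 2 * k * \<epsilon> * 2 * \<delta>"
      using yq_le k_pos assms(4) by (intro mult_left_mono) auto
    finally have "cmod (T Q (sol Q') y - T Q' (sol Q') y) \<le> 2 * k * \<epsilon> * 2 * \<delta> / (2 * k)"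
      using eq by (rule cmod_divide_2k_le[rotated])
    then have 2: "cmod (T Q (sol Q') y - T Q' (sol Q') y) \<le> 2 * \<delta> * \<epsilon>"
      using k_pos by (simp add: mult_ac)
    show ?thesis
      using norm_triangle_ineq[of "T Q (sol Q) y - T Q (sol Q') y" "T Q (sol Q') y - T Q' (sol Q') y"] 1 2
      by (simp add: sol_eq[OF assms(1), symmetric] sol_eq[OF assms(2), symmetric])
  qed
  have "?E \<le> \<delta> * ?E + 2 * \<delta> * \<epsilon>"
    by (rule norm_bound) (use * in \<open>simp add: u v\<close>)
  moreover have "\<delta> * ?E \<le> 1 / 2 * ?E"
    using \<delta>_le by (intro mult_right_mono) auto
  ultimately have "?E \<le> 4 * \<delta> * \<epsilon>" by simp
  then show ?thesis using E[of y] by simp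
qed

lemma integral_reflect_cnj:
  fixes f :: "real \<Rightarrow> complex"
  shows "cnj (LBINT s. f s) = (LBINT s. cnj (f (- s)))"
  using lborel_integral_real_affine[of "-1" "\<lambda>s. cnj (f s)" 0] by simp

text \<open>Reflection combined with conjugation maps fixed points of \<open>T Q\<close> to fixed
  points, and there is only one.\<close>

lemma sol_symmetric:
  assumes "potential Q" "\<And>y. Q (- y) = cnj (Q y)"
  shows "sol Q (- y) = cnj (sol Q y)"
proof -
  define v where "v = (\<lambda>y. cnj (sol Q (- y)))"
  have "v = sol Q"
  proof (rule sol_unique[OF assms(1)])
    show "continuous_on UNIV v" unfolding v_def
      by (intro continuous_intros continuous_on_compose2[OF continuous_sol[of UNIV]]) auto
    show "cmod (v s) \<le> 2" for s unfolding v_def using sol_bound[OF assms(1)] by simp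
    fix y
    have "v y = cnj (T Q (sol Q) (- y))" unfolding v_def by (subst sol_eq[OF assms(1)]) simp
    also have "\<dots> = T Q v y"
      unfolding T_def complex_cnj_diff complex_cnj_divide integral_reflect_cnj
      by (simp add: assms(2) v_def green_defect_def abs_minus_commute)
    finally show "v y = T Q v y" .
  qed
  then show ?thesis by (metis v_def complex_cnj_cnj)
qed

text \<open>The coefficient of exp(-k|y|) that the rank-one part of the kernel produces from
  \<open>sol Q\<close>. Hence \<open>sol Q\<close> solves the full convolution equation exactly when
  \<open>D Q = 1\<close>.\<close>

definition D :: "(real \<Rightarrow> complex) \<Rightarrow> complex" where
  "D Q = - (LBINT s. complex_of_real (exp (- (k * \<bar>s\<bar>))) * Q s * sol Q s) / complex_of_real (2 * k)"

lemma integrable_exp: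
  assumes "potential Q" "continuous_on UNIV u" "\<And>s. cmod (u s) \<le> B"
  shows "integrable lborel (\<lambda>s. complex_of_real (exp (- (k * \<bar>y - s\<bar>))) * Q s * u s)"
  by (rule integrable_weighted[OF assms(1) _ assms(2) _ assms(3), where C = 1])
    (use k_pos in \<open>auto intro!: continuous_intros\<close>)

text \<open>The integrand takes conjugate values at s and -s. A complex equation in one real unknown
  thereby becomes a real one, which the intermediate value theorem can solve.\<close>

lemma D_real:
  assumes "potential Q" "\<And>y. Q (- y) = cnj (Q y)"
  shows "cnj (D Q) = D Q"
  unfolding D_def complex_cnj_minus complex_cnj_divide integral_reflect_cnj
  by (simp add: assms(2) sol_symmetric[OF assms])

lemma D_perturb:
  assumes "potential Q" "potential Q'" "\<And>y. cmod (Q y - Q' y) \<le> \<epsilon> * q y" "0 \<le> \<epsilon>"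
  shows "cmod (D Q - D Q') \<le> (2 + 4 * \<delta>) * (LBINT s. 1 * q s) / (2 * k) * \<epsilon>"
proof -
  note i = integrable_exp[OF assms(1) continuous_sol sol_bound[OF assms(1)], of 0]
    integrable_exp[OF assms(2) continuous_sol sol_bound[OF assms(2)], of 0]
  let ?f = "\<lambda>s. complex_of_real (exp (- (k * \<bar>s\<bar>))) * Q s * sol Q s - complex_of_real (exp (- (k * \<bar>s\<bar>))) * Q' s * sol Q' s"
  have "D Q - D Q' = - (LBINT s. ?f s) / complex_of_real (2 * k)"
    unfolding D_def using i by (subst Bochner_Integration.integral_diff) (auto simp: diff_divide_distrib)
  then have "cmod (D Q - D Q') \<le> (2 + 4 * \<delta>) * \<epsilon> * (LBINT s. 1 * q s) / (2 * k)"
  proof (rule cmod_divide_2k_le)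
    show "cmod (LBINT s. ?f s) \<le> (2 + 4 * \<delta>) * \<epsilon> * (LBINT s. 1 * q s)"
    proof (rule norm_integral_le)
      show "integrable lborel ?f" using i by auto
      fix s
      have "?f s = complex_of_real (exp (- (k * \<bar>s\<bar>))) * ((Q s - Q' s) * sol Q s + Q' s * (sol Q s - sol Q' s))"
        by (simp add: algebra_simps)
      also have "cmod \<dots> \<le> 1 * (cmod (Q s - Q' s) * cmod (sol Q s) + cmod (Q' s) * cmod (sol Q s - sol Q' s))"
        unfolding norm_mult using k_pos by (intro mult_mono order_trans[OF norm_triangle_ineq]) (auto simp: norm_mult)
      also have "\<dots> \<le> 1 * ((\<epsilon> * q s) * 2 + q s * (4 * \<delta> * \<epsilon>))"
        using assms q_nonneg sol_bound[OF assms(1)] sol_perturb[OF assms]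
        by (intro mult_left_mono add_mono mult_mono) (auto simp: potential_def)
      finally show "cmod (?f s) \<le> (2 + 4 * \<delta>) * \<epsilon> * (1 * q s)" by (simp add: algebra_simps)
    qed (use q_int in simp)
  qed
  then show ?thesis by (simp add: mult_ac)
qed

text \<open>On the scale where \<open>q\<close> lives, exp(-k|s|) and \<open>sol Q\<close> are both
  close to 1: the first replacement costs k|s| times the bound 2, the second k|s| + 2
  \<open>\<delta>\<close>. Integrated against \<open>q\<close> this gives 3 k
  \<open>\<delta>\<close> plus 2 \<open>\<delta>\<close> times the mass of \<open>q\<close>.\<close>

lemma D_approx:
  assumes "potential Q"
  shows "cmod (D Q + (LBINT s. Q s) / complex_of_real (2 * k)) \<le>
    \<delta> * (3 * k + 2 * (LBINT s. q s)) / (2 * k)"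
proof -
  have i1: "integrable lborel (\<lambda>s. complex_of_real (exp (- (k * \<bar>s\<bar>))) * Q s * sol Q s)"
    using integrable_exp[OF assms continuous_sol sol_bound[OF assms], of 0] by simp
  have i2: "integrable lborel Q"
    using integrable_weighted[OF assms, of "\<lambda>_. 1" "\<lambda>_. 1" 1 1] by simp
  let ?f = "\<lambda>s. complex_of_real (exp (- (k * \<bar>s\<bar>))) * Q s * sol Q s - Q s"
  have "D Q + (LBINT s. Q s) / complex_of_real (2 * k) = - (LBINT s. ?f s) / complex_of_real (2 * k)"
    unfolding D_def using i1 i2 by (simp add: diff_divide_distrib)
  note eq = this
  have "cmod (LBINT s. ?f s) \<le> (LBINT s. 2 * k * (\<bar>s\<bar> * q s) + (k * (\<bar>s\<bar> * q s) + 2 * \<delta> * q s))"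
  proof (rule order_trans[OF integral_norm_bound integral_mono])
    fix s
    have e: "cmod (complex_of_real (exp (- (k * \<bar>s\<bar>))) - 1) \<le> k * \<bar>s\<bar>"
      using exp_abs_lipschitz[of k s 0] k_pos by (simp add: cmod_of_real_minus_one)
    have "?f s = Q s * ((complex_of_real (exp (- (k * \<bar>s\<bar>))) - 1) * sol Q s + (sol Q s - 1))"
      by (simp add: algebra_simps)
    also have "cmod \<dots> \<le> q s * ((k * \<bar>s\<bar>) * 2 + (k * \<bar>s\<bar> + 2 * \<delta>))"
      unfolding norm_mult using assms e q_nonneg sol_bound[OF assms] sol_minus_one[OF assms] k_pos \<delta>_nonneg
      by (intro mult_mono order_trans[OF norm_triangle_ineq] add_mono) (auto simp: potential_def norm_mult intro!: mult_mono)
    finally show "norm (?f s) \<le> 2 * k * (\<bar>s\<bar> * q s) + (k * (\<bar>s\<bar> * q s) + 2 * \<delta> * q s)" by (simp add: algebra_simps)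
  qed (use i1 i2 yq_int q_int in auto)
  also have "\<dots> = 3 * k * (LBINT s. \<bar>s\<bar> * q s) + 2 * \<delta> * (LBINT s. q s)"
    using yq_int q_int by simp
  also have "\<dots> \<le> 3 * k * \<delta> + 2 * \<delta> * (LBINT s. q s)"
    using yq_le k_pos by (intro add_right_mono mult_left_mono) auto
  finally have "cmod (D Q + (LBINT s. Q s) / complex_of_real (2 * k)) \<le>
    (3 * k * \<delta> + 2 * \<delta> * (LBINT s. q s)) / (2 * k)"
    using eq by (rule cmod_divide_2k_le[rotated])
  then show ?thesis by (simp add: algebra_simps)
qed

text \<open>By \<open>lo\<close> and \<open>hi\<close> the approximate matching value, minus the
  real part of the integral of the potential, lies above 2 k at \<open>a\<close> and below it at
  \<open>b\<close>, each time by at least the error in \<open>D_approx\<close>. So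
  \<open>Re (D (Q m))\<close> crosses 1 in between.\<close>

lemma bound_state:
  fixes Q :: "real \<Rightarrow> real \<Rightarrow> complex"
  assumes Q: "\<And>m. m \<in> {a..b} \<Longrightarrow> potential (Q m)" and ab: "a \<le> b"
    and lip: "\<And>m n y. m \<in> {a..b} \<Longrightarrow> n \<in> {a..b} \<Longrightarrow> cmod (Q m y - Q n y) \<le> \<bar>m - n\<bar> * q y"
    and sym: "\<And>m y. Q m (- y) = cnj (Q m y)"
    and lo: "2 * k + \<delta> * (3 * k + 2 * (LBINT s. q s)) \<le> - Re (LBINT s. Q a s)"
    and hi: "- Re (LBINT s. Q b s) \<le> 2 * k - \<delta> * (3 * k + 2 * (LBINT s. q s))"
  shows "\<exists>m\<in>{a..b}. \<exists>u. continuous_on UNIV u \<and> (\<forall>y. cmod (u y) \<le> 2) \<and>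
    (\<forall>y. cmod (u y - 1) \<le> k * \<bar>y\<bar> + 2 * \<delta>) \<and>
    (\<forall>y. u y = - (LBINT s. complex_of_real (exp (- (k * \<bar>y - s\<bar>))) * Q m s * u s) / complex_of_real (2 * k))"
proof -
  let ?err = "\<delta> * (3 * k + 2 * (LBINT s. q s))"
  have ap: "\<bar>2 * k * Re (D (Q m)) + Re (LBINT s. Q m s)\<bar> \<le> ?err" if "m \<in> {a..b}" for m
  proof -
    have "\<bar>Re (D (Q m) + (LBINT s. Q m s) / complex_of_real (2 * k))\<bar> \<le> ?err / (2 * k)"
      using order_trans[OF abs_Re_le_cmod D_approx[OF Q[OF that]]] .
    then have "\<bar>Re (D (Q m)) + Re (LBINT s. Q m s) / (2 * k)\<bar> \<le> ?err / (2 * k)"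
      by (simp add: Re_divide_of_real del: of_real_mult)
    then have "2 * k * \<bar>Re (D (Q m)) + Re (LBINT s. Q m s) / (2 * k)\<bar> \<le> ?err"
      using k_pos by (simp add: pos_le_divide_eq mult.commute)
    moreover have "2 * k * \<bar>Re (D (Q m)) + Re (LBINT s. Q m s) / (2 * k)\<bar> = \<bar>2 * k * (Re (D (Q m)) + Re (LBINT s. Q m s) / (2 * k))\<bar>"
      using k_pos by (simp add: abs_mult)
    ultimately show ?thesis using k_pos by (simp add: distrib_left)
  qed
  have a: "1 \<le> Re (D (Q a))"
  proof -
    have "2 * k * 1 \<le> 2 * k * Re (D (Q a))" using ap[of a] lo ab by (auto simp: abs_le_iff)
    then show ?thesis using k_pos by simp
  qed
  have b: "Re (D (Q b)) \<le> 1"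
  proof -
    have "2 * k * Re (D (Q b)) \<le> 2 * k * 1" using ap[of b] hi ab by (auto simp: abs_le_iff)
    then show ?thesis using k_pos by simp
  qed
  have cont: "continuous_on {a..b} (\<lambda>m. Re (D (Q m)))"
  proof -
    let ?L = "(2 + 4 * \<delta>) * (LBINT s. 1 * q s) / (2 * k)"
    have "0 \<le> ?L" using k_pos \<delta>_nonneg q_nonneg by simp
    then have "?L-lipschitz_on {a..b} (\<lambda>m. Re (D (Q m)))"
    proof (intro lipschitz_onI)
      fix m n assume mn: "m \<in> {a..b}" "n \<in> {a..b}"
      have "\<bar>Re (D (Q m) - D (Q n))\<bar> \<le> ?L * \<bar>m - n\<bar>"
        by (rule order_trans[OF abs_Re_le_cmod D_perturb[OF Q[OF mn(1)] Q[OF mn(2)] lip[OF mn]]]) simp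
      then show "dist (Re (D (Q m))) (Re (D (Q n))) \<le> ?L * dist m n" by (simp add: dist_real_def)
    qed
    then show ?thesis by (rule lipschitz_on_continuous_on)
  qed
  obtain m where m: "a \<le> m" "m \<le> b" "Re (D (Q m)) = 1"
    using IVT2'[OF b a ab cont] by blast
  then have pm: "potential (Q m)" using Q by simp
  have "D (Q m) = 1"
    using D_real[OF pm sym] m(3) by (simp add: complex_eq_iff)
  moreover have "complex_of_real (2 * k) \<noteq> 0" using k_pos by simp
  ultimately have "- (LBINT s. complex_of_real (exp (- (k * \<bar>s\<bar>))) * Q m s * sol (Q m) s) = 1 * complex_of_real (2 * k)"
    unfolding D_def using nonzero_divide_eq_eq by blast
  then have *: "(LBINT s. complex_of_real (exp (- (k * \<bar>s\<bar>))) * Q m s * sol (Q m) s) = - complex_of_real (2 * k)"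
    by (metis minus_minus mult_1)
  have "sol (Q m) y = - (LBINT s. complex_of_real (exp (- (k * \<bar>y - s\<bar>))) * Q m s * sol (Q m) s) / complex_of_real (2 * k)" for y
  proof -
    \<comment> \<open>The subtracted rank-one part is put back; since D = 1, its contribution is
      exactly the inhomogeneous term of \<open>T\<close>.\<close>
    have e: "exp (- (k * \<bar>y - s\<bar>)) = green_defect k y s + exp (- (k * \<bar>y\<bar>)) * exp (- (k * \<bar>s\<bar>))" for s
      by (simp add: green_defect_def algebra_simps flip: exp_add)
    have "(LBINT s. complex_of_real (exp (- (k * \<bar>y - s\<bar>))) * Q m s * sol (Q m) s)
       = (LBINT s. complex_of_real (green_defect k y s) * Q m s * sol (Q m) s +
            complex_of_real (exp (- (k * \<bar>y\<bar>))) * (complex_of_real (exp (- (k * \<bar>s\<bar>))) * Q m s * sol (Q m) s))"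
      unfolding e by (simp add: algebra_simps)
    also have "\<dots> = (green (Q m) (sol (Q m)) y) -
        complex_of_real (exp (- (k * \<bar>y\<bar>))) * complex_of_real (2 * k)"
      using integrable_green_defect[OF pm continuous_sol sol_bound[OF pm], of y]
        integrable_exp[OF pm continuous_sol sol_bound[OF pm], of 0]
      by (subst Bochner_Integration.integral_add) (auto simp: *)
    finally have I: "(LBINT s. complex_of_real (exp (- (k * \<bar>y - s\<bar>))) * Q m s * sol (Q m) s) =
      (green (Q m) (sol (Q m)) y) -
        complex_of_real (exp (- (k * \<bar>y\<bar>))) * complex_of_real (2 * k)" .
    have "- (A - E * c) / c = E - A / c" if "c \<noteq> 0" for A E c :: complex
      using that by (simp add: field_simps)
    moreover have "complex_of_real (2 * k) \<noteq> 0" using k_pos by simp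
    ultimately show ?thesis
      unfolding I using sol_eq[OF pm, of y] unfolding T_def by presburger
  qed
  note sol_int = this
  have "m \<in> {a..b}" using m by simp
  moreover have "continuous_on UNIV (sol (Q m))" by (rule continuous_sol)
  ultimately show ?thesis
    using sol_bound[OF pm] sol_minus_one[OF pm] sol_int by blast
qed

end

section \<open>The differential equation of the bound state\<close>

lemma has_vector_derivative_integral_atMost:
  fixes f :: "real \<Rightarrow> complex"
  assumes cont: "continuous_on UNIV f" and int: "integrable lborel f"
  shows "((\<lambda>y. LBINT s. indicator {..y} s *\<^sub>R f s) has_vector_derivative f y) (at y)"
proof -
  let ?a = "\<lambda>y. LBINT s. indicator {..y} s *\<^sub>R f s"
  have i: "integrable lborel (\<lambda>s. indicator A s *\<^sub>R f s)" if "A \<in> sets borel" for A :: "real set"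
    using that int by (intro integrable_mult_indicator) auto
  \<comment> \<open>Near y only the integral over the compact piece from y - 1 to z varies, so the
    fundamental theorem on compact intervals applies.\<close>
  have split: "?a z = ?a (y - 1) + integral {y - 1..z} f" if "z \<in> {y - 1<..<y + 1}" for z
  proof -
    have "AE s in lborel. s \<noteq> y - 1" by (rule AE_lborel_singleton)
    moreover have "f \<in> borel_measurable borel" by (rule borel_measurable_continuous_onI[OF cont])
    ultimately have "?a z = (LBINT s. indicator {..y - 1} s *\<^sub>R f s + indicator {y - 1..z} s *\<^sub>R f s)"
      using that by (intro integral_cong_AE) (auto elim!: eventually_mono split: split_indicator)
    also have "\<dots> = ?a (y - 1) + (LBINT s. indicator {y - 1..z} s *\<^sub>R f s)"
      by (rule Bochner_Integration.integral_add) (auto intro: i)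
    also have "(LBINT s. indicator {y - 1..z} s *\<^sub>R f s) = integral {y - 1..z} f"
      using set_borel_integral_eq_integral(2)[of "{y - 1..z}" f] i[of "{y - 1..z}"]
      by (simp add: set_lebesgue_integral_def set_integrable_def)
    finally show ?thesis .
  qed
  have "((\<lambda>z. integral {y - 1..z} f) has_vector_derivative f y) (at y within {y - 1..y + 1})"
    by (rule integral_has_vector_derivative) (auto intro: continuous_on_subset[OF cont])
  then have "((\<lambda>z. integral {y - 1..z} f) has_vector_derivative f y) (at y)"
    by (subst (asm) at_within_Icc_at) auto
  then have "((\<lambda>z. ?a (y - 1) + integral {y - 1..z} f) has_vector_derivative 0 + f y) (at y)"
    by (intro has_vector_derivative_add has_vector_derivative_const)
  then have "(?a has_vector_derivative 0 + f y) (at y)"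
    by (rule has_vector_derivative_transform_within_open[where S = "{y - 1<..<y + 1}"]) (simp_all add: split[symmetric])
  then show ?thesis by simp
qed

text \<open>The two sides of the kernel \<open>exp (- k \<bar>y - s\<bar>)\<close> factor, which turns the convolution into
  two primitives.\<close>

lemma screened_poisson:
  fixes w :: "real \<Rightarrow> complex"
  assumes k: "0 < k" and cont: "continuous_on UNIV w"
    and int: "integrable lborel (\<lambda>s. exp (k * \<bar>s\<bar>) * cmod (w s))"
    and u: "\<And>y. u y = - (LBINT s. complex_of_real (exp (- (k * \<bar>y - s\<bar>))) * w s) / complex_of_real (2 * k)"
  obtains u' C where
    "\<And>y. (u has_vector_derivative u' y) (at y)"
    "\<And>y. (u' has_vector_derivative complex_of_real (k\<^sup>2) * u y + w y) (at y)"
    "\<And>y. cmod (u y) \<le> C * exp (- (k * \<bar>y\<bar>))"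
    "\<And>y. cmod (u' y) \<le> C * exp (- (k * \<bar>y\<bar>))"
proof -
  define f where "f = (\<lambda>s. complex_of_real (exp (k * s)) * w s)"
  define g where "g = (\<lambda>s. complex_of_real (exp (- (k * s))) * w s)"
  have fg_cont: "continuous_on UNIV f" "continuous_on UNIV g"
    unfolding f_def g_def by (auto intro!: continuous_intros cont)
  have dom: "integrable lborel h"
    if "h \<in> borel_measurable lborel" "\<And>s. cmod (h s) \<le> c * (exp (k * \<bar>s\<bar>) * cmod (w s))"
    for h :: "real \<Rightarrow> complex" and c
    by (rule Bochner_Integration.integrable_bound[where f = "\<lambda>s. c * (exp (k * \<bar>s\<bar>) * cmod (w s))"])
      (use int that in \<open>auto intro!: AE_I2 intro: order_trans[OF _ abs_ge_self]\<close>)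
  have f_int: "integrable lborel f"
    by (rule dom[where c = 1])
      (use k in \<open>auto simp: f_def norm_mult intro!: borel_measurable_continuous_onI continuous_intros cont mult_right_mono\<close>)
  have g_int: "integrable lborel g"
    by (rule dom[where c = 1])
      (use k in \<open>auto simp: g_def norm_mult abs_if intro!: borel_measurable_continuous_onI continuous_intros cont mult_right_mono\<close>)
  define F where "F = (\<lambda>y. LBINT s. indicator {..y} s *\<^sub>R f s)"
  define G where "G = (\<lambda>y. LBINT s. indicator {y<..} s *\<^sub>R g s)"
  have F': "(F has_vector_derivative f y) (at y)" for y
    unfolding F_def by (rule has_vector_derivative_integral_atMost[OF fg_cont(1) f_int])
  have G': "(G has_vector_derivative - g y) (at y)" for y
  proof -
    have eq: "G y = (LBINT s. g s) - (LBINT s. indicator {..y} s *\<^sub>R g s)" for y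
    proof -
      have "G y = (LBINT s. g s - indicator {..y} s *\<^sub>R g s)"
        unfolding G_def by (intro Bochner_Integration.integral_cong) (auto split: split_indicator)
      then show ?thesis
        using g_int by (subst (asm) Bochner_Integration.integral_diff) (auto intro!: integrable_mult_indicator)
    qed
    have "((\<lambda>y. (LBINT s. g s) - (LBINT s. indicator {..y} s *\<^sub>R g s)) has_vector_derivative 0 - g y) (at y)"
      by (intro has_vector_derivative_diff has_vector_derivative_const has_vector_derivative_integral_atMost fg_cont g_int)
    then show ?thesis unfolding eq[abs_def] by simp
  qed
  \<comment> \<open>The value 1 of \<open>\<sigma>\<close> gives the convolution and thus u; the
    value -1 gives the kernel multiplied by the sign of y - s, which is what differentiation
    produces. One identity and one bound then serve both u and u'.\<close>
  let ?I = "\<lambda>y \<sigma>. LBINT s. (if s \<le> y then 1 else \<sigma>) * (complex_of_real (exp (- (k * \<bar>y - s\<bar>))) * w s)"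
  have comb: "complex_of_real (exp (- (k * y))) * F y + \<sigma> * (complex_of_real (exp (k * y)) * G y)
      = (?I y \<sigma>)" for y \<sigma>
  proof -
    have "complex_of_real (exp (- (k * y))) * F y + \<sigma> * (complex_of_real (exp (k * y)) * G y) =
      (LBINT s. complex_of_real (exp (- (k * y))) * (indicator {..y} s *\<^sub>R f s) +
         \<sigma> * (complex_of_real (exp (k * y)) * (indicator {y<..} s *\<^sub>R g s)))"
    proof -
      have i: "integrable lborel (\<lambda>s. indicator {..y} s *\<^sub>R f s)" "integrable lborel (\<lambda>s. indicator {y<..} s *\<^sub>R g s)"
        using f_int g_int by (auto intro!: integrable_mult_indicator)
      show ?thesis
        unfolding F_def G_def
          Bochner_Integration.integral_add[OF integrable_mult_right[OF i(1)] integrable_mult_right[OF integrable_mult_right[OF i(2)]]]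
        by (simp only: integral_mult_right_zero)
    qed
    also have "\<dots> = (?I y \<sigma>)"
    proof (intro Bochner_Integration.integral_cong refl)
      fix s
      show "complex_of_real (exp (- (k * y))) * (indicator {..y} s *\<^sub>R f s) +
         \<sigma> * (complex_of_real (exp (k * y)) * (indicator {y<..} s *\<^sub>R g s)) =
         (if s \<le> y then 1 else \<sigma>) * (complex_of_real (exp (- (k * \<bar>y - s\<bar>))) * w s)"
      proof (cases "s \<le> y")
        case True
        have "exp (- (k * \<bar>y - s\<bar>)) = exp (- (k * y)) * exp (k * s)"
          using True by (simp add: algebra_simps flip: exp_add)
        then show ?thesis using True by (simp add: f_def mult_ac del: of_real_exp)
      next
        case False
        have "exp (- (k * \<bar>y - s\<bar>)) = exp (k * y) * exp (- (k * s))"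
          using False by (simp add: algebra_simps flip: exp_add)
        then show ?thesis using False by (simp add: g_def mult_ac)
      qed
    qed
    finally show ?thesis .
  qed
  \<comment> \<open>Large enough for both prefactors that occur, 1 / (2 k) for u and 1/2 for
    u'.\<close>
  define C where "C = (1 + 1 / (2 * k)) * (LBINT s. exp (k * \<bar>s\<bar>) * cmod (w s))"
  have bound: "cmod (?I y \<sigma>)
      \<le> exp (- (k * \<bar>y\<bar>)) * (LBINT s. exp (k * \<bar>s\<bar>) * cmod (w s))" if "cmod \<sigma> = 1" for y \<sigma>
  proof -
    have le: "cmod ((if s \<le> y then 1 else \<sigma>) * (complex_of_real (exp (- (k * \<bar>y - s\<bar>))) * w s))
        \<le> exp (- (k * \<bar>y\<bar>)) * (exp (k * \<bar>s\<bar>) * cmod (w s))" for s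
    proof -
      \<comment> \<open>Decay of the kernel centred at s becomes decay centred at 0 at the cost of
        exp(k|s|) on the source. This is why the source is required to be integrable with that
        weight.\<close>
      have "k * \<bar>y\<bar> \<le> k * (\<bar>y - s\<bar> + \<bar>s\<bar>)" using k by (intro mult_left_mono) auto
      then have "exp (- (k * \<bar>y - s\<bar>)) \<le> exp (- (k * \<bar>y\<bar>)) * exp (k * \<bar>s\<bar>)"
        unfolding exp_add[symmetric] by (simp add: distrib_left)
      then have "exp (- (k * \<bar>y - s\<bar>)) * cmod (w s) \<le> exp (- (k * \<bar>y\<bar>)) * exp (k * \<bar>s\<bar>) * cmod (w s)"
        by (rule mult_right_mono) simp
      then show ?thesis using that by (cases "s \<le> y") (simp_all add: norm_mult mult.assoc)
    qed
    have "cmod (?I y \<sigma>)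
       \<le> (LBINT s. exp (- (k * \<bar>y\<bar>)) * (exp (k * \<bar>s\<bar>) * cmod (w s)))"
    proof (rule order_trans[OF integral_norm_bound integral_mono])
      have "w \<in> borel_measurable borel" by (rule borel_measurable_continuous_onI[OF cont])
      then show "integrable lborel (\<lambda>s. cmod ((if s \<le> y then 1 else \<sigma>) * (complex_of_real (exp (- (k * \<bar>y - s\<bar>))) * w s)))"
        by (intro integrable_norm dom[OF _ le]) measurable
    qed (use int le in auto)
    then show ?thesis by simp
  qed
  have I0: "0 \<le> (LBINT s. exp (k * \<bar>s\<bar>) * cmod (w s))" by simp
  have u_eq: "u y = - (complex_of_real (exp (- (k * y))) * F y + complex_of_real (exp (k * y)) * G y) / complex_of_real (2 * k)" for y
    using comb[of y 1] u[of y] by simp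
  define u' where "u' = (\<lambda>y. (complex_of_real (exp (- (k * y))) * F y - complex_of_real (exp (k * y)) * G y) / 2)"
  have E: "((\<lambda>y. complex_of_real (exp (c * y))) has_vector_derivative complex_of_real (c * exp (c * y))) (at y)" for c y
    by (rule has_vector_derivative_of_real) (auto intro!: derivative_eq_intros simp flip: has_real_derivative_iff_has_vector_derivative)
  have inv: "complex_of_real (exp (- (k * y))) * complex_of_real (exp (k * y)) = 1" for y
    by (metis exp_minus_inverse mult.commute of_real_1 of_real_mult)
  have FE: "((\<lambda>y. complex_of_real (exp (- (k * y))) * F y) has_vector_derivative
      w y - complex_of_real k * (complex_of_real (exp (- (k * y))) * F y)) (at y)" for y
  proof -
    have "complex_of_real (exp (- (k * y))) * f y = w y"
      unfolding f_def by (simp only: mult.assoc[symmetric] inv mult_1)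
    then show ?thesis
      using has_vector_derivative_mult[OF E[of "- k" y] F'[of y]]
      by (simp only: mult_minus_left of_real_minus of_real_mult mult.assoc) simp
  qed
  have GE: "((\<lambda>y. complex_of_real (exp (k * y)) * G y) has_vector_derivative
      complex_of_real k * (complex_of_real (exp (k * y)) * G y) - w y) (at y)" for y
  proof -
    have "complex_of_real (exp (k * y)) * g y = w y"
      unfolding g_def by (simp only: mult.assoc[symmetric] inv mult.commute[of "complex_of_real (exp (k * y))"] mult_1)
    then show ?thesis
      using has_vector_derivative_mult[OF E[of k y] G'[of y]]
      by (simp only: mult_minus_right of_real_mult mult.assoc) simp
  qed
  show thesis
  proof (rule that)
    fix y
    have alg: "- (W - c * A + (c * B - W)) / (2 * c) = (A - B) / 2"
      "((W - c * A) - (c * B - W)) / 2 = c\<^sup>2 * (- (A + B) / (2 * c)) + W" if "c \<noteq> 0" for A B W c :: complex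
      using that by (simp_all add: field_simps power2_eq_square)
    have kc: "complex_of_real k \<noteq> 0" using k by simp
    have "((\<lambda>y. - (complex_of_real (exp (- (k * y))) * F y + complex_of_real (exp (k * y)) * G y) / (2 * complex_of_real k))
        has_vector_derivative u' y) (at y)"
      unfolding u'_def
      by (rule has_vector_derivative_eq_rhs[OF has_vector_derivative_divide[OF
              has_vector_derivative_minus[OF has_vector_derivative_add[OF FE GE]]] alg(1)[OF kc]])
    moreover have "u = (\<lambda>y. - (complex_of_real (exp (- (k * y))) * F y + complex_of_real (exp (k * y)) * G y) / (2 * complex_of_real k))"
      by (rule ext, subst u_eq) simp
    ultimately show "(u has_vector_derivative u' y) (at y)" by (simp only:)
    have "(u' has_vector_derivative ((w y - complex_of_real k * (complex_of_real (exp (- (k * y))) * F y)) -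
        (complex_of_real k * (complex_of_real (exp (k * y)) * G y) - w y)) / 2) (at y)"
      unfolding u'_def by (intro has_vector_derivative_divide has_vector_derivative_diff FE GE)
    then show "(u' has_vector_derivative complex_of_real (k\<^sup>2) * u y + w y) (at y)"
      unfolding alg(2)[OF kc] u_eq[of y] of_real_power of_real_mult of_real_numeral .
    have "cmod (u y) \<le> exp (- (k * \<bar>y\<bar>)) * (LBINT s. exp (k * \<bar>s\<bar>) * cmod (w s)) / (2 * k)"
      using bound[of 1 y] k unfolding u
      by (simp add: norm_divide divide_right_mono)
    also have "\<dots> \<le> C * exp (- (k * \<bar>y\<bar>))"
      using I0 k unfolding C_def by (simp add: field_simps)
    finally show "cmod (u y) \<le> C * exp (- (k * \<bar>y\<bar>))" .
    have "cmod (u' y) \<le> exp (- (k * \<bar>y\<bar>)) * (LBINT s. exp (k * \<bar>s\<bar>) * cmod (w s)) / 2"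
      using bound[of "-1" y] comb[of y "-1"] unfolding u'_def
      by (simp add: norm_divide)
    also have "\<dots> \<le> C * exp (- (k * \<bar>y\<bar>))"
      using I0 k unfolding C_def by (simp add: field_simps)
    finally show "cmod (u' y) \<le> C * exp (- (k * \<bar>y\<bar>))" .
  qed
qed

section \<open>Calculus on the cylinder\<close>

abbreviation circle :: "real measure" where
  "circle \<equiv> restrict_space lborel {0..<2 * pi}"

interpretation circle: sigma_finite_measure circle
  by (rule sigma_finite_measure_restrict_space) (auto intro: lborel.sigma_finite_measure_axioms)

interpretation cyl: pair_sigma_finite circle lborel ..

text \<open>The sigma-algebra of \<open>cylinder\<close> is a product with a trace sigma-algebra, so
  Borel functions of the plane are transferred through measurability of the identity map.\<close>

lemma borel_measurable_cylinder:
  fixes f :: "real \<times> real \<Rightarrow> 'a::topological_space"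
  assumes "f \<in> borel_measurable borel"
  shows "f \<in> borel_measurable cylinder"
proof -
  have "fst \<in> measurable cylinder circle" unfolding cylinder_def by (rule measurable_fst)
  moreover have "(\<lambda>x. x) \<in> measurable circle (borel :: real measure)"
    by (rule measurable_restrict_space1) simp
  ultimately have 1: "fst \<in> measurable cylinder (borel :: real measure)"
    by (rule measurable_compose[of fst cylinder circle "\<lambda>x. x"])
  have 2: "snd \<in> measurable cylinder (borel :: real measure)"
    unfolding cylinder_def by simp
  have "(\<lambda>z. (fst z, snd z)) \<in> measurable cylinder (borel \<Otimes>\<^sub>M borel :: (real \<times> real) measure)"
    by (rule measurable_Pair[OF 1 2])
  then have "(\<lambda>z. z) \<in> measurable cylinder (borel :: (real \<times> real) measure)"
    by (simp only: borel_prod prod.collapse)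
  from measurable_compose[OF this assms] show ?thesis .
qed

lemma continuous_cylinder_measurable:
  fixes f :: "real \<times> real \<Rightarrow> complex"
  shows "continuous_on UNIV f \<Longrightarrow> f \<in> borel_measurable cylinder"
  by (intro borel_measurable_cylinder borel_measurable_continuous_onI)

lemma measure_circle: "measure circle {0..<2 * pi} = 2 * pi"
  by (simp add: measure_def emeasure_restrict_space)

lemma
  fixes c :: "real \<Rightarrow> 'a::{banach, second_countable_topology}"
  assumes "integrable lborel c"
  shows integrable_cylinder_snd: "integrable cylinder (\<lambda>z. c (snd z))"
    and integral_cylinder_snd: "(\<integral>z. c (snd z) \<partial>cylinder) = (2 * pi) *\<^sub>R (LBINT y. c y)"
proof -
  have fin: "emeasure circle (space circle) \<noteq> \<infinity>"
    by (simp add: emeasure_restrict_space space_restrict_space)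
  then interpret fc: finite_measure circle by (rule finite_measureI)
  have [measurable]: "c \<in> borel_measurable borel" using assms by auto
  show i: "integrable cylinder (\<lambda>z. c (snd z))"
    unfolding cylinder_def
    by (rule cyl.Fubini_integrable) (use assms in auto)
  have "(\<integral>z. c (snd z) \<partial>cylinder) = (\<integral>x. (LBINT y. c (snd (x, y))) \<partial>circle)"
    unfolding cylinder_def by (rule cyl.integral_fst'[symmetric]) (use i in \<open>simp add: cylinder_def\<close>)
  then show "(\<integral>z. c (snd z) \<partial>cylinder) = (2 * pi) *\<^sub>R (LBINT y. c y)"
    by (simp add: measure_circle)
qed

lemma space_cylinder: "space cylinder = {0..<2 * pi} \<times> UNIV"
  by (simp add: cylinder_def space_pair_measure space_restrict_space)

lemma strip_bounded:
  fixes f :: "real \<times> real \<Rightarrow> complex"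
  assumes "continuous_on UNIV f"
  obtains B where "\<And>x y. x \<in> {0..<2 * pi} \<Longrightarrow> y \<in> {-R..R} \<Longrightarrow> cmod (f (x, y)) \<le> B"
proof -
  have "compact (f ` ({0..2 * pi} \<times> {-R..R}))"
    by (intro compact_continuous_image continuous_on_subset[OF assms] compact_Times compact_Icc subset_UNIV)
  then obtain B where "\<And>w. w \<in> f ` ({0..2 * pi} \<times> {-R..R}) \<Longrightarrow> cmod w \<le> B"
    by (meson bounded_iff compact_imp_bounded)
  then show thesis by (intro that[of B]) auto
qed

lemma integrable_strip:
  fixes f :: "real \<times> real \<Rightarrow> complex"
  assumes "f \<in> borel_measurable cylinder"
    and "\<And>x y. x \<in> {0..<2 * pi} \<Longrightarrow> y \<in> {-R..R} \<Longrightarrow> cmod (f (x, y)) \<le> B"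
    and "\<And>x y. x \<in> {0..<2 * pi} \<Longrightarrow> R < \<bar>y\<bar> \<Longrightarrow> f (x, y) = 0"
  shows "integrable cylinder f"
proof (rule Bochner_Integration.integrable_bound)
  have "integrable lborel (\<lambda>y. indicator {-R..R} y * B)"
    by (intro integrable_mult_left integrable_real_indicator) (auto simp: emeasure_lborel_Icc_eq)
  from integrable_cylinder_snd[OF this]
  show "integrable cylinder (\<lambda>z. indicator {-R..R} (snd z) * B)" .
  show "AE z in cylinder. norm (f z) \<le> norm (indicator {-R..R} (snd z) * B)"
  proof (rule AE_I2)
    fix z assume "z \<in> space cylinder"
    then obtain x y where z: "z = (x, y)" "x \<in> {0..<2 * pi}" by (auto simp: space_cylinder)
    show "norm (f z) \<le> norm (indicator {-R..R} (snd z) * B)"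
      using assms(2)[OF z(2), of y] assms(3)[OF z(2), of y]
      by (cases "y \<in> {-R..R}") (auto simp: z(1))
  qed
qed (rule assms(1))

lemma integrable_continuous_compact:
  fixes f :: "real \<times> real \<Rightarrow> complex"
  assumes "continuous_on UNIV f" and "\<And>x y. R < \<bar>y\<bar> \<Longrightarrow> f (x, y) = 0"
  shows "integrable cylinder f"
proof -
  obtain B where "\<And>x y. x \<in> {0..<2 * pi} \<Longrightarrow> y \<in> {-R..R} \<Longrightarrow> cmod (f (x, y)) \<le> B"
    using strip_bounded[OF assms(1), of R] by blast
  then show ?thesis
    by (intro integrable_strip[OF continuous_cylinder_measurable[OF assms(1)], of R B] assms(2))
qed

lemma locally_integrable_continuous:
  assumes "continuous_on UNIV f"
  shows "locally_integrable f"
  unfolding locally_integrable_def set_integrable_def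
proof
  fix R
  obtain B where B: "\<And>x y. x \<in> {0..<2 * pi} \<Longrightarrow> y \<in> {-R..R} \<Longrightarrow> cmod (f (x, y)) \<le> B"
    using strip_bounded[OF assms(1), of R] by blast
  have "f \<in> borel_measurable cylinder" by (rule continuous_cylinder_measurable[OF assms])
  moreover have "(\<lambda>z. indicator (UNIV \<times> {-R..R}) z :: real) \<in> borel_measurable cylinder"
    by (intro borel_measurable_cylinder borel_measurable_indicator borel_closed closed_Times) auto
  ultimately have "(\<lambda>z. indicator (UNIV \<times> {-R..R}) z *\<^sub>R f z) \<in> borel_measurable cylinder"
    by (intro borel_measurable_scaleR)
  then show "integrable cylinder (\<lambda>z. indicator (UNIV \<times> {-R..R}) z *\<^sub>R f z)"
    by (rule integrable_strip[where R = R and B = B]) (use B in \<open>auto simp: indicator_def\<close>)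
qed

text \<open>Integration by parts on the cylinder in divergence form: \<open>F\<close> will be a
  product with a test function, and the boundary terms cancel by periodicity.\<close>

lemma integral_total_derivative_x:
  fixes F :: "real \<times> real \<Rightarrow> complex"
  assumes cont: "continuous_on UNIV F'" and supp: "\<And>x y. R < \<bar>y\<bar> \<Longrightarrow> F' (x, y) = 0"
    and deriv: "\<And>x y. ((\<lambda>s. F (s, y)) has_vector_derivative F' (x, y)) (at x)"
    and periodic: "\<And>y. F (2 * pi, y) = F (0, y)"
  shows "(\<integral>z. F' z \<partial>cylinder) = 0"
proof -
  have "(\<integral>z. F' z \<partial>cylinder) = (\<integral>y. (\<integral>x. F' (x, y) \<partial>circle) \<partial>lborel)"
    using cyl.integral_snd[of "\<lambda>x y. F' (x, y)"] integrable_continuous_compact[OF cont supp]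
    by (simp add: cylinder_def)
  moreover have "(\<integral>x. F' (x, y) \<partial>circle) = 0" for y
  proof -
    have m: "(\<lambda>x. F' (x, y)) \<in> borel_measurable borel"
      by (intro borel_measurable_continuous_onI continuous_on_compose2[OF cont] continuous_intros) auto
    have "(\<integral>x. F' (x, y) \<partial>circle) = (LBINT x. indicator {0..<2 * pi} x *\<^sub>R F' (x, y))"
      by (subst integral_restrict_space) auto
    \<comment> \<open>The fundamental domain is half open; adding its right endpoint changes a null
      set and allows the fundamental theorem on a closed interval.\<close>
    also have "\<dots> = (LBINT x. indicator {0..2 * pi} x *\<^sub>R F' (x, y))"
    proof (rule integral_cong_AE)
      show "AE x in lborel. indicator {0..<2 * pi} x *\<^sub>R F' (x, y) = indicator {0..2 * pi} x *\<^sub>R F' (x, y)"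
        using AE_lborel_singleton[of "2 * pi"] by eventually_elim (auto split: split_indicator)
    qed (use m in auto)
    also have "\<dots> = F (2 * pi, y) - F (0, y)"
      by (rule integral_FTC_atLeastAtMost)
        (auto intro!: has_vector_derivative_at_within deriv continuous_on_compose2[OF cont] continuous_intros)
    finally show ?thesis using periodic by simp
  qed
  ultimately show ?thesis by simp
qed

lemma integral_total_derivative_y:
  fixes F :: "real \<times> real \<Rightarrow> complex"
  assumes cont: "continuous_on UNIV F'" and supp: "\<And>x y. R < \<bar>y\<bar> \<Longrightarrow> F' (x, y) = 0"
    and deriv: "\<And>x y. ((\<lambda>s. F (x, s)) has_vector_derivative F' (x, y)) (at y)"
    and F_supp: "\<And>x y. R < \<bar>y\<bar> \<Longrightarrow> F (x, y) = 0"
  shows "(\<integral>z. F' z \<partial>cylinder) = 0"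
proof -
  have "(\<integral>z. F' z \<partial>cylinder) = (\<integral>x. (LBINT y. F' (x, y)) \<partial>circle)"
    using cyl.integral_fst'[of F'] integrable_continuous_compact[OF cont supp]
    by (simp add: cylinder_def)
  moreover have "(LBINT y. F' (x, y)) = 0" for x
  proof -
    let ?S = "\<bar>R\<bar> + 1"
    have "(LBINT y. F' (x, y)) = (LBINT y. indicator {- ?S..?S} y *\<^sub>R F' (x, y))"
      by (intro Bochner_Integration.integral_cong refl) (auto split: split_indicator intro!: supp)
    also have "\<dots> = F (x, ?S) - F (x, - ?S)"
      by (rule integral_FTC_atLeastAtMost)
        (auto intro!: has_vector_derivative_at_within deriv continuous_on_compose2[OF cont] continuous_intros)
    finally show ?thesis using F_supp by simp
  qed
  ultimately show ?thesis by simp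
qed

section \<open>Functions of class \<open>C1\<close>: joint continuity, support, periodicity\<close>

lemma C1_has_derivatives:
  assumes "C1 f"
  shows "((\<lambda>s. f (s, y)) has_vector_derivative partial_x f (x, y)) (at x)"
    and "((\<lambda>s. f (x, s)) has_vector_derivative partial_y f (x, y)) (at y)"
  using assms unfolding C1_def partial_x_def partial_y_def prod.case
  by (blast intro: vector_derivative_works[THEN iffD1])+

text \<open>\<open>C1\<close> asks only for partial derivatives and for their continuity. Joint
  continuity of f itself comes from total differentiability, which continuous partial derivatives
  imply.\<close>

lemma C1_continuous:
  assumes "C1 f"
  shows "continuous_on UNIV f"
proof -
  have cont: "continuous_on UNIV (partial_y f)" using assms by (simp add: C1_def)
  have "isCont f (x, y)" for x y
  proof -
    have "((\<lambda>(x, y). f (x, y)) has_derivative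
      (\<lambda>(tx, ty). tx *\<^sub>R partial_x f (x, y) + blinfun_apply (blinfun_scaleR_left (partial_y f (x, y))) ty)) (at (x, y) within UNIV \<times> UNIV)"
    proof (rule has_derivative_partialsI)
      show "((\<lambda>x. f (x, y)) has_derivative (\<lambda>h. h *\<^sub>R partial_x f (x, y))) (at x within UNIV)"
        using C1_has_derivatives(1)[OF assms] by (simp add: has_vector_derivative_def)
      show "((\<lambda>y. f (x, y)) has_derivative blinfun_apply (blinfun_scaleR_left (partial_y f (x, y)))) (at y within UNIV)" for x y
        using C1_has_derivatives(2)[OF assms] by (simp add: has_vector_derivative_def)
      have "continuous_on UNIV (\<lambda>z. blinfun_scaleR_left (partial_y f z))"
        by (intro continuous_intros cont)
      then show "continuous (at (x, y) within UNIV \<times> UNIV) (\<lambda>(x, y). blinfun_scaleR_left (partial_y f (x, y)))"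
        by (simp add: continuous_on_eq_continuous_at case_prod_unfold)
    qed auto
    from has_derivative_continuous[OF this] show ?thesis
      by (simp add: case_prod_eta)
  qed
  then show ?thesis by (auto simp: continuous_on_eq_continuous_at)
qed

lemma C1_support:
  assumes "C1 f" "\<And>x y. R < \<bar>y\<bar> \<Longrightarrow> f (x, y) = 0" "R < \<bar>y\<bar>"
  shows "partial_x f (x, y) = 0" "partial_y f (x, y) = 0"
proof -
  have "((\<lambda>s. f (s, y)) has_vector_derivative 0) (at x)"
    using assms(2,3) by simp
  then show "partial_x f (x, y) = 0"
    using C1_has_derivatives(1)[OF assms(1)] vector_derivative_unique_at by blast
  have o: "open {y::real. R < \<bar>y\<bar>}" by (intro open_Collect_less continuous_intros)
  have "((\<lambda>s. f (x, s)) has_vector_derivative 0) (at y)"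
    by (rule has_vector_derivative_transform_within_open[OF has_vector_derivative_const o])
      (use assms(2,3) in auto)
  then show "partial_y f (x, y) = 0"
    using C1_has_derivatives(2)[OF assms(1)] vector_derivative_unique_at by blast
qed

lemma C1_periodic:
  assumes "C1 f" "\<And>x y. f (x + 2 * pi, y) = f (x, y)"
  shows "partial_x f (x + 2 * pi, y) = partial_x f (x, y)"
proof -
  have "((\<lambda>s. f (s + 2 * pi, y)) has_vector_derivative partial_x f (x + 2 * pi, y)) (at x)"
    using vector_diff_chain_at[of "\<lambda>s. s + 2 * pi" 1 x "\<lambda>s. f (s, y)" "partial_x f (x + 2 * pi, y)"]
      C1_has_derivatives(1)[OF assms(1)] by (simp add: o_def has_vector_derivative_add_const)
  then have "((\<lambda>s. f (s, y)) has_vector_derivative partial_x f (x + 2 * pi, y)) (at x)"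
    by (simp only: assms(2))
  then show ?thesis
    using C1_has_derivatives(1)[OF assms(1)] vector_derivative_unique_at by blast
qed

section \<open>Fourier modes and test functions\<close>

text \<open>Degrees of smoothness have to be counted: the Laplacian of a truncated stream function
  must itself be a test function of class C^2, which costs four derivatives of the stream
  function.\<close>

fun cdiff :: "nat \<Rightarrow> (real \<Rightarrow> complex) \<Rightarrow> bool" where
  "cdiff 0 f \<longleftrightarrow> continuous_on UNIV f"
| "cdiff (Suc n) f \<longleftrightarrow> (\<exists>f'. (\<forall>y. (f has_vector_derivative f' y) (at y)) \<and> cdiff n f')"

lemma cdiff_SucI: "(\<And>y. (f has_vector_derivative f' y) (at y)) \<Longrightarrow> cdiff n f' \<Longrightarrow> cdiff (Suc n) f"
  by auto

lemma has_vector_derivative_continuous_on: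
  fixes f :: "real \<Rightarrow> 'a::real_normed_vector"
  assumes "\<And>y. (f has_vector_derivative f' y) (at y)"
  shows "continuous_on A f"
  using assms by (meson continuous_at_imp_continuous_on has_vector_derivative_continuous)

lemma cdiff_continuous: "cdiff n f \<Longrightarrow> continuous_on A f"
proof (cases n)
  case (Suc m)
  moreover assume "cdiff n f"
  ultimately obtain f' where "\<And>y. (f has_vector_derivative f' y) (at y)" by auto
  then show ?thesis by (rule has_vector_derivative_continuous_on)
qed (auto intro: continuous_on_subset)

lemma cdiff_Suc_D: "cdiff (Suc n) f \<Longrightarrow> cdiff n f"
proof (induction n arbitrary: f)
  case 0
  then show ?case using cdiff_continuous[of "Suc 0" f UNIV] by simp
next
  case (Suc n)
  then obtain f' where "\<forall>y. (f has_vector_derivative f' y) (at y)" "cdiff (Suc n) f'" by auto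
  then show ?case using Suc.IH[of f'] by auto
qed

lemma cdiff_const: "cdiff n (\<lambda>_. c)"
proof (induction n arbitrary: c)
  case (Suc n)
  show ?case by (rule cdiff_SucI[of _ "\<lambda>_. 0"]) (auto intro: Suc)
qed simp

lemma cdiff_of_real: "cdiff n (\<lambda>y. complex_of_real y)"
proof (cases n)
  case (Suc m)
  have "((\<lambda>y. complex_of_real y) has_vector_derivative 1) (at y)" for y
    by (auto intro!: derivative_eq_intros simp: has_vector_derivative_def fun_eq_iff scaleR_conv_of_real)
  then show ?thesis unfolding Suc by (rule cdiff_SucI[of _ "\<lambda>_. 1"]) (rule cdiff_const)
qed (auto intro!: continuous_intros)

lemma cdiff_add: "cdiff n f \<Longrightarrow> cdiff n g \<Longrightarrow> cdiff n (\<lambda>y. f y + g y)"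
proof (induction n arbitrary: f g)
  case (Suc n)
  then obtain f' g' where "\<And>y. (f has_vector_derivative f' y) (at y)" "cdiff n f'"
    "\<And>y. (g has_vector_derivative g' y) (at y)" "cdiff n g'" by auto
  then show ?case by (intro cdiff_SucI[of _ "\<lambda>y. f' y + g' y"] has_vector_derivative_add Suc.IH)
qed (auto intro: continuous_intros)

lemma cdiff_mult: "cdiff n f \<Longrightarrow> cdiff n g \<Longrightarrow> cdiff n (\<lambda>y. f y * g y)"
proof (induction n arbitrary: f g)
  case (Suc n)
  then obtain f' g' where "\<And>y. (f has_vector_derivative f' y) (at y)" "cdiff n f'"
    "\<And>y. (g has_vector_derivative g' y) (at y)" "cdiff n g'" by auto
  moreover have "cdiff n f" "cdiff n g" by (rule Suc.prems[THEN cdiff_Suc_D])+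
  ultimately show ?case
    by (intro cdiff_SucI[of _ "\<lambda>y. f y * g' y + f' y * g y"] has_vector_derivative_mult cdiff_add Suc.IH)
qed (auto intro: continuous_intros)

lemma cdiff_minus: "cdiff n f \<Longrightarrow> cdiff n (\<lambda>y. - f y)"
  using cdiff_mult[OF cdiff_const[of n "-1"]] by simp

lemma cdiff_inverse:
  assumes "cdiff n f" "\<And>y. f y \<noteq> 0"
  shows "cdiff n (\<lambda>y. inverse (f y))"
  using assms(1)
proof (induction n)
  case 0
  then show ?case using assms(2) by (auto intro!: continuous_intros)
next
  case (Suc n)
  then obtain f' where f': "\<And>y. (f has_vector_derivative f' y) (at y)" "cdiff n f'" by auto
  have "cdiff n (\<lambda>y. inverse (f y))" by (rule Suc.IH[OF cdiff_Suc_D[OF Suc.prems]])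
  moreover have "((\<lambda>y. inverse (f y)) has_vector_derivative - (inverse (f y) * f' y * inverse (f y))) (at y)" for y
    using f'(1)[of y] assms(2)[of y] unfolding has_vector_derivative_def
    by (auto intro!: derivative_eq_intros)
  ultimately show ?case
    by (intro cdiff_SucI[of _ "\<lambda>y. - (inverse (f y) * f' y * inverse (f y))"] cdiff_minus cdiff_mult f'(2))
qed

lemma cdiff_gaussian: "cdiff n (\<lambda>y. complex_of_real (exp (c * y\<^sup>2)))"
proof (induction n)
  case 0
  then show ?case by (auto intro!: continuous_intros)
next
  case (Suc n)
  have "((\<lambda>y. complex_of_real (exp (c * y\<^sup>2))) has_vector_derivative
     complex_of_real (2 * c) * complex_of_real y * complex_of_real (exp (c * y\<^sup>2))) (at y)" for y
  proof -
    have "((\<lambda>y. exp (c * y\<^sup>2)) has_real_derivative 2 * c * y * exp (c * y\<^sup>2)) (at y)"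
      by (auto intro!: derivative_eq_intros)
    from has_vector_derivative_of_real[OF this] show ?thesis by simp
  qed
  then show ?case
    by (rule cdiff_SucI) (intro cdiff_mult cdiff_const cdiff_of_real Suc.IH)
qed

section \<open>Compactly supported cutoffs of finite smoothness\<close>

lemma has_real_derivative_max_power:
  "((\<lambda>u::real. max 0 u ^ Suc (Suc n)) has_real_derivative real (n + 2) * max 0 u ^ Suc n) (at u)"
proof -
  consider "u < 0" | "u = 0" | "0 < u" by linarith
  then show ?thesis
  proof cases
    case 1
    have "((\<lambda>_::real. 0) has_real_derivative 0) (at u)" by simp
    then have "((\<lambda>u::real. max 0 u ^ Suc (Suc n)) has_real_derivative 0) (at u)"
      by (rule has_field_derivative_transform_within_open[where S = "{..<0}"]) (use 1 in auto)
    then show ?thesis using 1 by simp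
  next
    case 2
    \<comment> \<open>At the corner the difference quotient equals the next lower power of the
      positive part; it tends to 0 because at least one power is left.\<close>
    have "((\<lambda>h::real. max 0 h ^ Suc n) \<longlongrightarrow> max 0 0 ^ Suc n) (at 0)"
      by (intro tendsto_intros)
    moreover have "\<forall>\<^sub>F h::real in at 0. max 0 h ^ Suc n = (max 0 (0 + h) ^ Suc (Suc n) - max 0 0 ^ Suc (Suc n)) / h"
      by (rule eventually_at_ball'[THEN eventually_mono, of 1]) (auto simp: max_def)
    ultimately show ?thesis
      unfolding 2 DERIV_def by (simp add: tendsto_cong)
  next
    case 3
    have "((\<lambda>u::real. u ^ Suc (Suc n)) has_real_derivative real (n + 2) * u ^ Suc n) (at u)"
      using DERIV_pow[of "Suc (Suc n)" u] by simp
    then have "((\<lambda>u::real. max 0 u ^ Suc (Suc n)) has_real_derivative real (n + 2) * u ^ Suc n) (at u)"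
      by (rule has_field_derivative_transform_within_open[where S = "{0<..}"]) (use 3 in auto)
    then show ?thesis using 3 by simp
  qed
qed

text \<open>A polynomial cutoff: of class C^(n-1), zero beyond R, and with derivatives of the same
  shape, so that bounds uniform in R stay explicit.\<close>

definition bump :: "nat \<Rightarrow> real \<Rightarrow> real \<Rightarrow> real" where
  "bump n R y = max 0 (1 - (y / R)\<^sup>2) ^ n"

lemma bump_derivative:
  "(bump (Suc (Suc n)) R has_real_derivative real (n + 2) * bump (Suc n) R y * (- 2 * y / R\<^sup>2)) (at y)"
proof -
  have "((\<lambda>y. 1 - (y / R)\<^sup>2) has_real_derivative - 2 * y / R\<^sup>2) (at y)"
    by (cases "R = 0") (auto intro!: derivative_eq_intros simp: field_simps power2_eq_square)
  from DERIV_chain2[OF has_real_derivative_max_power this] show ?thesis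
    unfolding bump_def[abs_def] .
qed

lemma bump_bounds: "0 \<le> bump n R y" "bump n R y \<le> 1"
  unfolding bump_def by (auto intro!: power_le_one)

lemma bump_support: "0 < n \<Longrightarrow> 0 < R \<Longrightarrow> R < \<bar>y\<bar> \<Longrightarrow> bump n R y = 0"
proof -
  assume "0 < n" "0 < R" "R < \<bar>y\<bar>"
  then have "1 \<le> \<bar>y / R\<bar>" by (simp add: field_simps)
  then have "1 \<le> (y / R)\<^sup>2" by (metis one_le_power power2_abs)
  with \<open>0 < n\<close> show ?thesis by (simp add: bump_def)
qed

lemma cdiff_bump: "cdiff n (\<lambda>y. complex_of_real (bump (Suc n) R y))"
proof (induction n)
  case 0
  then show ?case by (auto intro!: continuous_intros simp: bump_def divide_inverse)
next
  case (Suc n)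
  have "((\<lambda>y. complex_of_real (bump (Suc (Suc n)) R y)) has_vector_derivative
     complex_of_real (real (n + 2)) * complex_of_real (bump (Suc n) R y) * (complex_of_real (- 2 / R\<^sup>2) * complex_of_real y)) (at y)" for y
    by (rule has_vector_derivative_eq_rhs[OF has_vector_derivative_of_real[OF bump_derivative]]) simp
  then show ?case
    by (rule cdiff_SucI) (intro cdiff_mult cdiff_const cdiff_of_real Suc.IH)
qed

section \<open>Fourier modes on the cylinder\<close>

definition mode :: "int \<Rightarrow> (real \<Rightarrow> complex) \<Rightarrow> real \<times> real \<Rightarrow> complex" where
  "mode k a = (\<lambda>(x, y). cis (of_int k * x) * a y)"

lemma mode_apply: "mode k a (x, y) = cis (of_int k * x) * a y"
  by (simp add: mode_def)

lemma cmod_mode: "cmod (mode k a z) = cmod (a (snd z))"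
  by (cases z) (simp add: mode_apply norm_mult)

lemma mode_cmult: "c * mode k a z = mode k (\<lambda>y. c * a y) z"
  by (cases z) (simp add: mode_apply)

lemma mode_mult: "mode k a z * mode l b z = mode (k + l) (\<lambda>y. a y * b y) z"
  by (cases z) (simp add: mode_apply distrib_right flip: cis_mult)

lemma mode_0: "mode 0 a z = a (snd z)"
  by (cases z) (simp add: mode_apply)

lemma continuous_mode:
  assumes "continuous_on UNIV a"
  shows "continuous_on UNIV (mode k a)"
  unfolding mode_def case_prod_unfold cis_conv_exp
  by (intro continuous_intros continuous_on_compose2[OF assms]) auto

lemma cis_periodic: "cis (of_int k * (x + 2 * pi)) = cis (of_int k * x)"
proof -
  have "cis (of_int k * (2 * pi)) = 1" using cis_multiple_2pi[of "of_int k"] by (simp add: mult_ac)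
  then show ?thesis by (simp add: distrib_left flip: cis_mult)
qed

lemma has_vector_derivative_cis:
  "((\<lambda>x. cis (c * x)) has_vector_derivative \<i> * of_real c * cis (c * x)) (at x)"
  unfolding has_vector_derivative_def
  by (auto intro!: derivative_eq_intros simp: scaleR_conv_of_real)

lemma mode_derivatives:
  shows "((\<lambda>s. mode k a (s, y)) has_vector_derivative mode k (\<lambda>y. \<i> * of_int k * a y) (x, y)) (at x)"
    and "(a has_vector_derivative a' y) (at y) \<Longrightarrow>
      ((\<lambda>s. mode k a (x, s)) has_vector_derivative mode k a' (x, y)) (at y)"
proof -
  show "((\<lambda>s. mode k a (s, y)) has_vector_derivative mode k (\<lambda>y. \<i> * of_int k * a y) (x, y)) (at x)"
    unfolding mode_apply
    by (rule has_vector_derivative_eq_rhs[OF has_vector_derivative_mult_left[OF has_vector_derivative_cis]]) simp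
  show "((\<lambda>s. mode k a (x, s)) has_vector_derivative mode k a' (x, y)) (at y)"
    if "(a has_vector_derivative a' y) (at y)"
    unfolding mode_apply by (rule has_vector_derivative_mult_right[OF that])
qed

lemma partial_x_mode: "partial_x (mode k a) = mode k (\<lambda>y. \<i> * of_int k * a y)"
  unfolding partial_x_def by (auto intro!: ext vector_derivative_at mode_derivatives)

lemma partial_y_mode:
  assumes "\<And>y. (a has_vector_derivative a' y) (at y)"
  shows "partial_y (mode k a) = mode k a'"
  unfolding partial_y_def by (auto intro!: ext vector_derivative_at mode_derivatives assms)

lemma C1_mode:
  assumes "cdiff (Suc 0) a"
  shows "C1 (mode k a)"
proof -
  obtain a' where a': "\<And>y. (a has_vector_derivative a' y) (at y)" "continuous_on UNIV a'" using assms by auto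
  have "continuous_on UNIV a" using assms by (rule cdiff_continuous)
  then show ?thesis
    unfolding C1_def partial_x_mode partial_y_mode[OF a'(1)]
    by (auto intro!: continuous_mode continuous_intros a' differentiableI_vector[OF mode_derivatives(1)]
        differentiableI_vector[OF mode_derivatives(2)[OF a'(1)]])
qed

lemma test_function_mode:
  assumes "cdiff 2 a" "\<And>y. R < \<bar>y\<bar> \<Longrightarrow> a y = 0"
  shows "test_function (mode k a)"
proof -
  obtain a' where a': "\<And>y. (a has_vector_derivative a' y) (at y)" "cdiff (Suc 0) a'"
    using assms(1) by (auto simp: numeral_2_eq_2)
  have "cdiff (Suc 0) a" using assms(1) cdiff_Suc_D[of "Suc 0" a] by (simp add: numeral_2_eq_2)
  then show ?thesis
    unfolding test_function_def partial_x_mode partial_y_mode[OF a'(1)]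
    using a'(2) assms(2)
    by (auto simp: mode_apply cis_periodic simp del: cdiff.simps intro!: C1_mode cdiff_mult cdiff_const exI[of _ R])
qed

lemma weak_partial_x_mode:
  assumes cont: "continuous_on UNIV a"
  shows "weak_partial_x (mode k a) (mode k (\<lambda>y. \<i> * of_int k * a y))"
  unfolding weak_partial_x_def
proof (intro conjI allI impI)
  let ?m = "mode k a" and ?m' = "mode k (\<lambda>y. \<i> * of_int k * a y)"
  have c: "continuous_on UNIV ?m" "continuous_on UNIV ?m'"
    by (auto intro!: continuous_mode continuous_intros cont)
  then show "locally_integrable ?m" "locally_integrable ?m'"
    by (auto intro: locally_integrable_continuous)
  fix \<theta> assume \<theta>: "test_function \<theta>"
  then obtain R where R: "\<And>x y. R < \<bar>y\<bar> \<Longrightarrow> \<theta> (x, y) = 0" unfolding test_function_def by blast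
  have C1: "C1 \<theta>" using \<theta> by (simp add: test_function_def)
  have \<theta>c: "continuous_on UNIV \<theta>" "continuous_on UNIV (partial_x \<theta>)"
    using C1_continuous[OF C1] C1 by (auto simp: C1_def)
  have s: "partial_x \<theta> (x, y) = 0" "partial_y \<theta> (x, y) = 0" if "R < \<bar>y\<bar>" for x y
    by (rule C1_support[where f = \<theta> and R = R, OF C1 _ that]; fact R)+
  have "(\<integral>z. ?m z * partial_x \<theta> z + ?m' z * \<theta> z \<partial>cylinder) = 0"
  proof (rule integral_total_derivative_x[where R = R and F = "\<lambda>z. ?m z * \<theta> z"])
    show "continuous_on UNIV (\<lambda>z. ?m z * partial_x \<theta> z + ?m' z * \<theta> z)"
      by (intro continuous_intros c \<theta>c)
    show "((\<lambda>s. ?m (s, y) * \<theta> (s, y)) has_vector_derivative ?m (x, y) * partial_x \<theta> (x, y) + ?m' (x, y) * \<theta> (x, y)) (at x)" for x y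
      by (intro has_vector_derivative_mult mode_derivatives C1_has_derivatives C1)
    have per: "\<theta> (x + 2 * pi, y) = \<theta> (x, y)" for x y using \<theta> by (simp add: test_function_def)
    show "?m (2 * pi, y) * \<theta> (2 * pi, y) = ?m (0, y) * \<theta> (0, y)" for y
      using per[of 0 y] cis_periodic[of k 0] by (simp add: mode_apply)
  qed (use s R in auto)
  moreover have "integrable cylinder (\<lambda>z. ?m z * partial_x \<theta> z)" "integrable cylinder (\<lambda>z. ?m' z * \<theta> z)"
    by (auto intro!: integrable_continuous_compact[where R = R] continuous_intros c \<theta>c simp: s R)
  ultimately show "pairing ?m (partial_x \<theta>) = - pairing ?m' \<theta>"
    unfolding pairing_def by (simp add: eq_neg_iff_add_eq_0)
qed

text \<open>Green's identity in two pieces: a total x-derivative, which integrates to 0 by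
  periodicity, and a total y-derivative, which integrates to 0 by the compact support of the test
  function.\<close>

lemma weak_laplacian_mode:
  assumes d1: "\<And>y. (a has_vector_derivative a' y) (at y)" and d2: "\<And>y. (a' has_vector_derivative a'' y) (at y)"
    and cont: "continuous_on UNIV a''"
  shows "weak_laplacian (mode k a) (mode k (\<lambda>y. a'' y - of_int k ^ 2 * a y))"
  unfolding weak_laplacian_def
proof (intro conjI allI impI)
  let ?m = "mode k a" and ?n = "mode k (\<lambda>y. a'' y - of_int k ^ 2 * a y)"
  have ac: "continuous_on UNIV a" "continuous_on UNIV a'"
    by (rule has_vector_derivative_continuous_on[OF d1], rule has_vector_derivative_continuous_on[OF d2])
  have c: "continuous_on UNIV ?m" "continuous_on UNIV ?n" "continuous_on UNIV (mode k a')" "continuous_on UNIV (mode k a'')"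
    by (auto intro!: continuous_mode continuous_intros cont ac)
  then show "locally_integrable ?m" "locally_integrable ?n"
    by (auto intro: locally_integrable_continuous)
  fix \<theta> assume \<theta>: "test_function \<theta>"
  then obtain R where R: "\<And>x y. R < \<bar>y\<bar> \<Longrightarrow> \<theta> (x, y) = 0" unfolding test_function_def by blast
  have C1: "C1 \<theta>" "C1 (partial_x \<theta>)" "C1 (partial_y \<theta>)" using \<theta> by (simp_all add: test_function_def)
  have per: "\<theta> (x + 2 * pi, y) = \<theta> (x, y)" for x y using \<theta> by (simp add: test_function_def)
  note per' = C1_periodic[where f = \<theta>, OF C1(1) per]
  have \<theta>c: "continuous_on UNIV \<theta>" "continuous_on UNIV (partial_x \<theta>)" "continuous_on UNIV (partial_y \<theta>)"
    "continuous_on UNIV (partial_x (partial_x \<theta>))" "continuous_on UNIV (partial_y (partial_y \<theta>))"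
    using C1_continuous[OF C1(1)] C1(2,3) C1(1) by (auto simp: C1_def)
  have s: "partial_x \<theta> (x, y) = 0" "partial_y \<theta> (x, y) = 0" if "R < \<bar>y\<bar>" for x y
    by (rule C1_support[where f = \<theta> and R = R, OF C1(1) _ that]; fact R)+
  have s2: "partial_x (partial_x \<theta>) (x, y) = 0" "partial_y (partial_y \<theta>) (x, y) = 0" if "R < \<bar>y\<bar>" for x y
    by (rule C1_support(1)[where f = "partial_x \<theta>" and R = R, OF C1(2) _ that] C1_support(2)[where f = "partial_y \<theta>" and R = R, OF C1(3) _ that]; fact s)+
  let ?ik = "\<i> * of_int k"
  have cis0: "cis (of_int k * (2 * pi)) = 1" using cis_periodic[of k 0] by simp
  have 1: "(\<integral>z. ?m z * partial_x (partial_x \<theta>) z + of_int k ^ 2 * (?m z * \<theta> z) \<partial>cylinder) = 0"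
  \<comment> \<open>This primitive is the Wronskian in x of the mode and the test function, factored
    by means of the fact that the x-derivative of the mode is i k times the mode.\<close>
  proof (rule integral_total_derivative_x[where R = R and F = "\<lambda>z. ?m z * (partial_x \<theta> z - ?ik * \<theta> z)"])
    show "continuous_on UNIV (\<lambda>z. ?m z * partial_x (partial_x \<theta>) z + of_int k ^ 2 * (?m z * \<theta> z))"
      by (intro continuous_intros c \<theta>c)
    show "((\<lambda>s. ?m (s, y) * (partial_x \<theta> (s, y) - ?ik * \<theta> (s, y))) has_vector_derivative
        ?m (x, y) * partial_x (partial_x \<theta>) (x, y) + of_int k ^ 2 * (?m (x, y) * \<theta> (x, y))) (at x)" for x y
    proof -
      have "?m (x, y) * (partial_x (partial_x \<theta>) (x, y) - ?ik * partial_x \<theta> (x, y)) +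
          mode k (\<lambda>y. ?ik * a y) (x, y) * (partial_x \<theta> (x, y) - ?ik * \<theta> (x, y)) =
        ?m (x, y) * partial_x (partial_x \<theta>) (x, y) + of_int k ^ 2 * (?m (x, y) * \<theta> (x, y))"
        by (simp add: mode_apply algebra_simps power2_eq_square)
      then show ?thesis
        by (intro has_vector_derivative_eq_rhs[OF has_vector_derivative_mult[OF mode_derivatives(1)
            has_vector_derivative_diff[OF C1_has_derivatives(1)[OF C1(2)]
              has_vector_derivative_mult_right[OF C1_has_derivatives(1)[OF C1(1)]]]]])
    qed
    show "?m (2 * pi, y) * (partial_x \<theta> (2 * pi, y) - ?ik * \<theta> (2 * pi, y)) = ?m (0, y) * (partial_x \<theta> (0, y) - ?ik * \<theta> (0, y))" for y
      using per[of 0 y] per'[of 0 y] cis0 by (simp add: mode_apply)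
  qed (use s s2 R in auto)
  have 2: "(\<integral>z. ?m z * partial_y (partial_y \<theta>) z - mode k a'' z * \<theta> z \<partial>cylinder) = 0"
  proof (rule integral_total_derivative_y[where R = R and F = "\<lambda>z. ?m z * partial_y \<theta> z - mode k a' z * \<theta> z"])
    show "continuous_on UNIV (\<lambda>z. ?m z * partial_y (partial_y \<theta>) z - mode k a'' z * \<theta> z)"
      by (intro continuous_intros c \<theta>c)
    show "((\<lambda>s. ?m (x, s) * partial_y \<theta> (x, s) - mode k a' (x, s) * \<theta> (x, s)) has_vector_derivative
        ?m (x, y) * partial_y (partial_y \<theta>) (x, y) - mode k a'' (x, y) * \<theta> (x, y)) (at y)" for x y
      by (rule has_vector_derivative_eq_rhs[OF has_vector_derivative_diff[OF
          has_vector_derivative_mult[OF mode_derivatives(2)[OF d1] C1_has_derivatives(2)[OF C1(3)]]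
          has_vector_derivative_mult[OF mode_derivatives(2)[OF d2] C1_has_derivatives(2)[OF C1(1)]]]]) simp
  qed (use s s2 R in auto)
  have i: "integrable cylinder (\<lambda>z. ?m z * partial_x (partial_x \<theta>) z + of_int k ^ 2 * (?m z * \<theta> z))"
    "integrable cylinder (\<lambda>z. ?m z * partial_y (partial_y \<theta>) z - mode k a'' z * \<theta> z)"
    "integrable cylinder (\<lambda>z. ?n z * \<theta> z)"
    by (rule integrable_continuous_compact[where R = R]; auto intro!: continuous_intros c \<theta>c simp: s s2 R)+
  have "pairing ?m (\<lambda>z. partial_x (partial_x \<theta>) z + partial_y (partial_y \<theta>) z) =
    (\<integral>z. (?m z * partial_x (partial_x \<theta>) z + of_int k ^ 2 * (?m z * \<theta> z)) +
          (?m z * partial_y (partial_y \<theta>) z - mode k a'' z * \<theta> z) + ?n z * \<theta> z \<partial>cylinder)"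
    unfolding pairing_def
  proof (intro Bochner_Integration.integral_cong refl)
    fix z :: "real \<times> real"
    have eq: "?n z = mode k a'' z - of_int k ^ 2 * ?m z"
      by (cases z) (simp add: mode_apply algebra_simps)
    show "?m z * (partial_x (partial_x \<theta>) z + partial_y (partial_y \<theta>) z) =
      (?m z * partial_x (partial_x \<theta>) z + of_int k ^ 2 * (?m z * \<theta> z)) +
          (?m z * partial_y (partial_y \<theta>) z - mode k a'' z * \<theta> z) + ?n z * \<theta> z"
      unfolding eq by (simp add: algebra_simps)
  qed
  also have "\<dots> = pairing ?n \<theta>"
    unfolding pairing_def
      Bochner_Integration.integral_add[OF Bochner_Integration.integrable_add[OF i(1,2)] i(3)]
      Bochner_Integration.integral_add[OF i(1,2)] 1 2 by simp
  finally show "pairing ?m (\<lambda>z. partial_x (partial_x \<theta>) z + partial_y (partial_y \<theta>) z) = pairing ?n \<theta>" .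
qed

section \<open>Square-integrable functions and the adjoint eigenfunction\<close>

lemma L2_measurable: "f \<in> L2 \<Longrightarrow> f \<in> borel_measurable cylinder"
  and L2_integrable: "f \<in> L2 \<Longrightarrow> integrable cylinder (\<lambda>z. (cmod (f z))\<^sup>2)"
  by (simp_all add: L2_def)

lemma L2_dominated:
  assumes "f \<in> borel_measurable cylinder" "integrable cylinder b" "\<And>z. (cmod (f z))\<^sup>2 \<le> b z"
  shows "f \<in> L2"
proof -
  have "integrable cylinder (\<lambda>z. (cmod (f z))\<^sup>2)"
    by (rule Bochner_Integration.integrable_bound[OF assms(2)])
      (use assms(1) order_trans[OF assms(3) abs_ge_self] in \<open>auto intro!: AE_I2 simp del: split_paired_All\<close>)
  then show ?thesis using assms(1) by (simp add: L2_def)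
qed

lemma L2_cmult: "f \<in> L2 \<Longrightarrow> (\<lambda>z. c * f z) \<in> L2"
  by (auto simp: L2_def norm_mult power_mult_distrib)

lemma L2_diff:
  assumes "f \<in> L2" "g \<in> L2"
  shows "(\<lambda>z. f z - g z) \<in> L2"
proof (rule L2_dominated)
  show "integrable cylinder (\<lambda>z. 2 * (cmod (f z))\<^sup>2 + 2 * (cmod (g z))\<^sup>2)"
    using assms[THEN L2_integrable] by auto
  fix z
  have "(cmod (f z - g z))\<^sup>2 \<le> (cmod (f z) + cmod (g z))\<^sup>2"
    by (intro power_mono norm_triangle_ineq4) simp
  also have "\<dots> \<le> 2 * (cmod (f z))\<^sup>2 + 2 * (cmod (g z))\<^sup>2"
    using sum_squares_bound[of "cmod (f z)" "cmod (g z)"] by (simp add: power2_sum)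
  finally show "(cmod (f z - g z))\<^sup>2 \<le> 2 * (cmod (f z))\<^sup>2 + 2 * (cmod (g z))\<^sup>2" .
qed (use assms[THEN L2_measurable] in measurable)

lemma integrable_pairing_norm:
  assumes "f \<in> L2" "g \<in> L2"
  shows "integrable cylinder (\<lambda>z. cmod (f z) * cmod (g z))"
proof (rule Bochner_Integration.integrable_bound)
  show "integrable cylinder (\<lambda>z. (cmod (f z))\<^sup>2 + (cmod (g z))\<^sup>2)"
    using assms[THEN L2_integrable] by auto
  have "cmod (f z) * cmod (g z) \<le> (cmod (f z))\<^sup>2 + (cmod (g z))\<^sup>2" for z
    using sum_squares_bound[of "cmod (f z)" "cmod (g z)"] norm_ge_zero[of "f z"] norm_ge_zero[of "g z"]
      mult_nonneg_nonneg[of "cmod (f z)" "cmod (g z)"] by linarith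
  then show "AE z in cylinder. norm (cmod (f z) * cmod (g z)) \<le> norm ((cmod (f z))\<^sup>2 + (cmod (g z))\<^sup>2)"
    by simp
qed (use assms[THEN L2_measurable] in measurable)

lemma integrable_pairing:
  assumes "f \<in> L2" "g \<in> L2"
  shows "integrable cylinder (\<lambda>z. f z * g z)"
  by (rule Bochner_Integration.integrable_bound[OF integrable_pairing_norm[OF assms]])
    (use assms[THEN L2_measurable] in \<open>auto simp: norm_mult\<close>)

lemma L2_norm_nonneg: "0 \<le> L2_norm f"
  by (simp add: L2_norm_def)

lemma L2_norm_cmult: "L2_norm (\<lambda>z. c * f z) = cmod c * L2_norm f"
  by (simp add: L2_norm_def norm_mult power_mult_distrib real_sqrt_mult)

lemma pairing_cmult: "pairing f (\<lambda>z. c * g z) = c * pairing f g" "pairing (\<lambda>z. c * f z) g = c * pairing f g"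
  by (simp_all add: pairing_def mult.left_commute mult.assoc)

lemma pairing_diff:
  assumes "f \<in> L2" "g \<in> L2" "h \<in> L2"
  shows "pairing (\<lambda>z. f z - g z) h = pairing f h - pairing g h"
  unfolding pairing_def left_diff_distrib using assms by (simp add: integrable_pairing)

lemma pairing_diff_right:
  assumes "f \<in> L2" "g \<in> L2" "h \<in> L2"
  shows "pairing h (\<lambda>z. f z - g z) = pairing h f - pairing h g"
  unfolding pairing_def right_diff_distrib using assms by (simp add: integrable_pairing)

text \<open>The pairing carries no conjugate, so the estimate is made for the moduli: the integral
  of (t|f| - |g|)^2 is a nonnegative quadratic polynomial in t.\<close>

lemma pairing_Cauchy_Schwarz:
  assumes "f \<in> L2" "g \<in> L2"
  shows "cmod (pairing f g) \<le> L2_norm f * L2_norm g"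
proof -
  define F where "F = (\<integral>z. (cmod (f z))\<^sup>2 \<partial>cylinder)"
  define G where "G = (\<integral>z. (cmod (g z))\<^sup>2 \<partial>cylinder)"
  define P where "P = (\<integral>z. cmod (f z) * cmod (g z) \<partial>cylinder)"
  have nn: "0 \<le> F" "0 \<le> G" "0 \<le> P" by (simp_all add: F_def G_def P_def)
  have quad: "0 \<le> F * t\<^sup>2 - 2 * P * t + G" for t
  proof -
    have "0 \<le> (\<integral>z. (t * cmod (f z) - cmod (g z))\<^sup>2 \<partial>cylinder)" by simp
    also have "\<dots> = (\<integral>z. t\<^sup>2 * (cmod (f z))\<^sup>2 - 2 * t * (cmod (f z) * cmod (g z)) + (cmod (g z))\<^sup>2 \<partial>cylinder)"
      by (intro Bochner_Integration.integral_cong refl) (simp add: power2_diff power_mult_distrib mult_ac)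
    also have "\<dots> = t\<^sup>2 * F - 2 * t * P + G"
      using assms[THEN L2_integrable] integrable_pairing_norm[OF assms]
      by (simp add: F_def G_def P_def)
    finally show ?thesis by (simp add: mult_ac)
  qed
  have "P\<^sup>2 \<le> F * G"
  proof (cases "F = 0")
    case True
    have "P = 0"
    proof (rule ccontr)
      assume "P \<noteq> 0"
      then have "0 < P" using nn by simp
      \<comment> \<open>For F = 0 the quadratic polynomial is affine, and at this t its value is -G
        - 2.\<close>
      then show False using quad[of "(G + 1) / P"] True nn by simp
    qed
    then show ?thesis using True by simp
  next
    case False
    then have "0 \<le> F * (P / F)\<^sup>2 - 2 * P * (P / F) + G" by (intro quad)
    also have "\<dots> = G - P\<^sup>2 / F" using False by (simp add: power2_eq_square field_simps)
    finally show ?thesis using False nn by (simp add: pos_divide_le_eq mult.commute)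
  qed
  then have "P \<le> sqrt (F * G)" using nn by (simp add: real_le_rsqrt)
  moreover have "cmod (pairing f g) \<le> P"
    unfolding pairing_def P_def norm_mult[symmetric] by (rule integral_norm_bound)
  ultimately show ?thesis by (simp add: L2_norm_def F_def G_def real_sqrt_mult)
qed

section \<open>Modes inside \<open>L2\<close>\<close>

lemma
  assumes "continuous_on UNIV a" "integrable lborel (\<lambda>y. (cmod (a y))\<^sup>2)"
  shows mode_L2: "mode k a \<in> L2"
    and L2_norm_mode: "L2_norm (mode k a) = sqrt (2 * pi * (LBINT y. (cmod (a y))\<^sup>2))"
proof -
  show "mode k a \<in> L2"
    by (rule L2_dominated[OF continuous_cylinder_measurable[OF continuous_mode[OF assms(1)]] integrable_cylinder_snd[OF assms(2)]])
      (simp add: cmod_mode)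
  show "L2_norm (mode k a) = sqrt (2 * pi * (LBINT y. (cmod (a y))\<^sup>2))"
    unfolding L2_norm_def cmod_mode integral_cylinder_snd[OF assms(2)] by simp
qed

lemma mode_L2_dominated:
  assumes "continuous_on UNIV a" "continuous_on UNIV d" "integrable lborel (\<lambda>y. (d y)\<^sup>2)"
    "\<And>y. cmod (a y) \<le> d y"
  shows "integrable lborel (\<lambda>y. (cmod (a y))\<^sup>2)" "mode k a \<in> L2"
proof -
  have "(cmod (a y))\<^sup>2 \<le> (d y)\<^sup>2" for y by (intro power_mono assms) simp
  then show "integrable lborel (\<lambda>y. (cmod (a y))\<^sup>2)"
    by (intro Bochner_Integration.integrable_bound[OF assms(3)])
      (auto intro!: borel_measurable_continuous_onI continuous_intros assms)
  then show "mode k a \<in> L2" by (rule mode_L2[OF assms(1)])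
qed

lemma pairing_mode:
  fixes a b :: "real \<Rightarrow> complex"
  assumes "integrable lborel (\<lambda>y. a y * b y)"
  shows "pairing (mode k a) (mode (- k) b) = 2 * pi * (LBINT y. a y * b y)"
  unfolding pairing_def mode_mult using integral_cylinder_snd[OF assms]
  by (simp add: mode_0 scaleR_conv_of_real)

text \<open>Dominated convergence with an integrable product as majorant. It lets cutoffs tend to 1
  in identities that are available only for test functions.\<close>

lemma pairing_mode_tendsto:
  assumes U: "U \<in> L2" and d: "continuous_on UNIV d" "integrable lborel (\<lambda>y. (d y)\<^sup>2)"
    and cont: "\<And>n. continuous_on UNIV (a n)" "continuous_on UNIV b"
    and bound: "\<And>n y. cmod (a n y) \<le> d y" and lim: "\<And>y. (\<lambda>n. a n y) \<longlonglongrightarrow> b y"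
  shows "(\<lambda>n. pairing U (mode k (a n))) \<longlonglongrightarrow> pairing U (mode k b)"
  unfolding pairing_def
proof (rule integral_dominated_convergence[where w = "\<lambda>z. cmod (U z) * cmod (mode k (\<lambda>y. complex_of_real (d y)) z)"])
  have d0: "0 \<le> d y" for y using bound[of 0 y] norm_ge_zero order_trans by blast
  have dL2: "mode k (\<lambda>y. complex_of_real (d y)) \<in> L2"
    by (rule mode_L2_dominated(2)[OF _ d]) (use d0 in \<open>auto intro!: continuous_intros d\<close>)
  show "integrable cylinder (\<lambda>z. cmod (U z) * cmod (mode k (\<lambda>y. complex_of_real (d y)) z))"
    by (rule integrable_pairing_norm[OF U dL2])
  show "(\<lambda>z. U z * mode k b z) \<in> borel_measurable cylinder" "(\<lambda>z. U z * mode k (a n) z) \<in> borel_measurable cylinder" for n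
    by (intro borel_measurable_times L2_measurable U continuous_cylinder_measurable continuous_mode cont)+
  show "AE z in cylinder. (\<lambda>n. U z * mode k (a n) z) \<longlonglongrightarrow> U z * mode k b z"
  proof (rule AE_I2)
    fix z :: "real \<times> real"
    obtain x y where z: "z = (x, y)" by (cases z)
    show "(\<lambda>n. U z * mode k (a n) z) \<longlonglongrightarrow> U z * mode k b z"
      unfolding z mode_apply by (intro tendsto_intros lim)
  qed
  show "AE z in cylinder. norm (U z * mode k (a n) z) \<le> cmod (U z) * cmod (mode k (\<lambda>y. complex_of_real (d y)) z)" for n
    using bound d0 by (auto simp: norm_mult cmod_mode intro!: mult_left_mono)
qed

lemma laplacian_mode:
  assumes "\<And>y. (a has_vector_derivative a' y) (at y)" "\<And>y. (a' has_vector_derivative a'' y) (at y)"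
  shows "partial_x (partial_x (mode k a)) z + partial_y (partial_y (mode k a)) z = mode k (\<lambda>y. a'' y - of_int k ^ 2 * a y) z"
  unfolding partial_x_mode partial_y_mode[OF assms(1)] partial_y_mode[OF assms(2)]
  by (cases z) (simp add: mode_apply algebra_simps power2_eq_square)

lemma integrable_inverse_quadratic: "integrable lborel (\<lambda>x::real. 1 / (1 + x\<^sup>2))"
  using integrable_inverse_1_plus_square by (simp add: set_integrable_def inverse_eq_divide)

text \<open>Since exp t is at least 1 + t + t^2/2 for t >= 0, the function is dominated by a
  rescaled Lorentzian.\<close>

lemma integrable_exp_minus_abs:
  assumes "0 < (k::real)"
  shows "integrable lborel (\<lambda>y. exp (- (k * \<bar>y\<bar>)))"
proof (rule Bochner_Integration.integrable_bound)
  show "integrable lborel (\<lambda>y. 2 * (1 / (1 + (0 + k * y)\<^sup>2)))"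
    by (intro integrable_mult_right lborel_integrable_real_affine[OF integrable_inverse_quadratic]) (use assms in auto)
  have "exp (- (k * \<bar>y\<bar>)) \<le> 2 * (1 / (1 + (0 + k * y)\<^sup>2))" for y
  proof -
    have "(1 + (k * y)\<^sup>2) / 2 \<le> 1 + k * \<bar>y\<bar> + (k * \<bar>y\<bar>)\<^sup>2 / 2"
      using assms by (simp add: power_mult_distrib)
    also have "\<dots> \<le> exp (k * \<bar>y\<bar>)"
      using assms by (intro exp_lower_Taylor_quadratic) auto
    finally have "1 / exp (k * \<bar>y\<bar>) \<le> 1 / ((1 + (k * y)\<^sup>2) / 2)"
      by (rule divide_left_mono) (auto intro!: mult_pos_pos add_pos_nonneg)
    then show ?thesis by (simp add: exp_minus inverse_eq_divide)
  qed
  then show "AE y in lborel. norm (exp (- (k * \<bar>y\<bar>))) \<le> norm (2 * (1 / (1 + (0 + k * y)\<^sup>2)))"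
    by (auto intro!: AE_I2 order_trans[OF _ abs_ge_self])
qed measurable

lemma cdiff_derivative:
  assumes "cdiff (Suc n) f" "\<And>y. (f has_vector_derivative f' y) (at y)"
  shows "cdiff n f'"
proof -
  obtain f'' where f'': "\<forall>y. (f has_vector_derivative f'' y) (at y)" "cdiff n f''"
    using assms(1) unfolding cdiff.simps by blast
  then have "f'' = f'" by (intro ext vector_derivative_unique_at[OF _ assms(2)]) simp
  then show ?thesis using f''(2) by simp
qed

text \<open>Formally, transposing the operator and applying it to exp(-i k x) g gives i k times b0 g
  minus the inverse Laplacian of b0'' g. The equation for \<open>\<phi>\<close> identifies the
  latter with \<open>\<phi>\<close>, and b0 g - \<open>\<phi>\<close> = c g. Elements of the domain
  satisfy their weak equations only against compactly supported tests, so all of this is first done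
  with cutoffs.\<close>

lemma adjoint_eigenfunction:
  fixes \<phi> g :: "real \<Rightarrow> complex" and c :: complex
  assumes ray: "rayleigh M \<gamma> \<omega> g0"
    and B: "continuous_on UNIV (b0 M \<gamma>)" "continuous_on UNIV (deriv (deriv (b0 M \<gamma>)))"
    and \<phi>4: "cdiff 4 \<phi>" and g2: "cdiff 2 g"
    and \<phi>: "\<And>y. (\<phi> has_vector_derivative \<phi>' y) (at y)"
      "\<And>y. (\<phi>' has_vector_derivative of_int k ^ 2 * \<phi> y + of_real (deriv (deriv (b0 M \<gamma>)) y) * g y) (at y)"
    and g: "\<And>y. (of_real (b0 M \<gamma> y) - c) * g y = \<phi> y"
    and d: "continuous_on UNIV d" "integrable lborel (\<lambda>y. (d y)\<^sup>2)"
    and le: "\<And>y. cmod (\<phi> y) \<le> d y" "\<And>y. cmod (\<phi>' y) \<le> d y" "\<And>y. cmod (g y) \<le> d y"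
      "\<And>y. cmod (of_real (b0 M \<gamma> y) * g y) \<le> d y"
      "\<And>y. cmod (of_real (deriv (deriv (b0 M \<gamma>)) y) * g y) \<le> d y"
  shows "pairing g0 (mode (- k) g) = \<i> * of_int k * c * pairing \<omega> (mode (- k) g)"
proof -
  define B where "B = (\<lambda>y. complex_of_real (b0 M \<gamma> y))"
  define B2 where "B2 = (\<lambda>y. complex_of_real (deriv (deriv (b0 M \<gamma>)) y))"
  have Bc: "continuous_on UNIV B" "continuous_on UNIV B2"
    unfolding B_def B2_def by (intro continuous_intros B)+
  have gc: "continuous_on UNIV g" by (rule cdiff_continuous[OF g2])
  have \<phi>c: "continuous_on UNIV \<phi>" "continuous_on UNIV \<phi>'"
    by (rule has_vector_derivative_continuous_on[OF \<phi>(1)], rule has_vector_derivative_continuous_on[OF \<phi>(2)])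
  obtain h v where \<omega>: "\<omega> \<in> L2" and h: "h \<in> L2" "weak_partial_x (\<lambda>(x, y). B y * \<omega> (x, y)) h"
    and v: "partial_x_inv_laplacian \<omega> v"
    and g0: "AE (x, y) in cylinder. g0 (x, y) = h (x, y) - B2 y * v (x, y)"
    using ray unfolding rayleigh_def B_def B2_def by blast
  obtain \<psi> where vL2: "v \<in> L2" and \<psi>: "weak_laplacian \<psi> \<omega>" "weak_partial_x \<psi> v"
    using v unfolding partial_x_inv_laplacian_def by blast
  have g0L2: "g0 \<in> L2" using ray by (simp add: rayleigh_def)
  let ?R = "\<lambda>n. real (Suc n)"
  \<comment> \<open>The exponent 5 makes the cutoff C^4; \<open>\<eta>1\<close> and
    \<open>\<eta>2\<close> are its first two derivatives. The radius n + 1 is at least 1, which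
    gives bounds uniform in n.\<close>
  define \<eta> where "\<eta> = (\<lambda>n y. complex_of_real (bump 5 (?R n) y))"
  define \<eta>1 where "\<eta>1 = (\<lambda>n y. complex_of_real (5 * bump 4 (?R n) y * (- 2 * y / (?R n)\<^sup>2)))"
  define \<eta>2 where "\<eta>2 = (\<lambda>n y. complex_of_real (5 * (4 * bump 3 (?R n) y * (- 2 * y / (?R n)\<^sup>2) * (- 2 * y / (?R n)\<^sup>2) + bump 4 (?R n) y * (- 2 / (?R n)\<^sup>2))))"
  have \<eta>d: "(\<eta> n has_vector_derivative \<eta>1 n y) (at y)" for n y
    unfolding \<eta>_def \<eta>1_def
    using has_vector_derivative_of_real[OF bump_derivative[of 3 "?R n" y], where 'a = complex]
    by (simp add: numeral_eq_Suc)
  have \<eta>1d: "(\<eta>1 n has_vector_derivative \<eta>2 n y) (at y)" for n y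
    unfolding \<eta>1_def \<eta>2_def
  proof (rule has_vector_derivative_of_real)
    have "(bump 4 (?R n) has_real_derivative 4 * bump 3 (?R n) y * (- 2 * y / (?R n)\<^sup>2)) (at y)"
      using bump_derivative[of 2 "?R n" y] by (simp add: numeral_eq_Suc)
    moreover have "((\<lambda>y. - 2 * y / (?R n)\<^sup>2) has_real_derivative - 2 / (?R n)\<^sup>2) (at y)"
      by (rule DERIV_cdivide) (auto intro!: derivative_eq_intros)
    ultimately show "((\<lambda>y. 5 * bump 4 (?R n) y * (- 2 * y / (?R n)\<^sup>2)) has_real_derivative
       5 * (4 * bump 3 (?R n) y * (- 2 * y / (?R n)\<^sup>2) * (- 2 * y / (?R n)\<^sup>2) + bump 4 (?R n) y * (- 2 / (?R n)\<^sup>2))) (at y)"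
      by (rule DERIV_cong[OF DERIV_mult[OF DERIV_cmult]]) (simp only: distrib_left mult_ac)
  qed
  have R1: "1 \<le> (?R n)\<^sup>2" for n by (intro one_le_power) simp
  have slope: "\<bar>2 * y / (?R n)\<^sup>2\<bar> \<le> 2" if "\<bar>y\<bar> \<le> ?R n" for n y
  proof -
    have "\<bar>y\<bar> \<le> (?R n)\<^sup>2" using that by (simp add: power2_eq_square order_trans[OF that])
    then show ?thesis using R1[of n] by (simp add: abs_mult divide_le_eq)
  qed
  have \<eta>0: "cmod (\<eta> n y) \<le> 1" for n y unfolding \<eta>_def using bump_bounds[of 5 "?R n" y] by simp
  have supp: "\<eta> n y = 0" "\<eta>1 n y = 0" "\<eta>2 n y = 0" if "?R n < \<bar>y\<bar>" for n y
    unfolding \<eta>_def \<eta>1_def \<eta>2_def using bump_support[OF _ _ that] by simp_all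
  have \<eta>1_le: "cmod (\<eta>1 n y) \<le> 10" for n y
  proof (cases "\<bar>y\<bar> \<le> ?R n")
    case True
    have "5 * bump 4 (?R n) y * \<bar>2 * y / (?R n)\<^sup>2\<bar> \<le> 5 * 1 * 2"
      by (intro mult_mono bump_bounds slope[OF True]) (auto simp: bump_bounds)
    then show ?thesis unfolding \<eta>1_def norm_of_real using bump_bounds(1)[of 4 "?R n" y]
      by (simp add: abs_mult)
  qed (use supp in auto)
  \<comment> \<open>The crude bound 90 is 5 times 4 * 4 + 2, from |s| <= 2, t <= 2 and bumps between
    0 and 1.\<close>
  have \<eta>2_le: "cmod (\<eta>2 n y) \<le> 90" for n y
  proof (cases "\<bar>y\<bar> \<le> ?R n")
    case True
    define s where "s = 2 * y / (?R n)\<^sup>2"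
    define t where "t = 2 / (?R n)\<^sup>2"
    have "\<bar>s\<bar> * \<bar>s\<bar> \<le> 2 * 2" using slope[OF True] unfolding s_def by (intro mult_mono) auto
    then have "s * s \<le> 4" by simp
    then have "bump 3 (?R n) y * (s * s) \<le> 1 * 4"
      by (rule mult_mono[OF bump_bounds(2)]) auto
    moreover have "0 \<le> bump 3 (?R n) y * (s * s)" by (rule mult_nonneg_nonneg[OF bump_bounds(1) zero_le_square])
    moreover have t: "0 \<le> t" "t \<le> 2" using R1[of n] unfolding t_def by (simp_all add: divide_le_eq)
    moreover have "bump 4 (?R n) y * t \<le> 1 * 2" "0 \<le> bump 4 (?R n) y * t"
      by (rule mult_mono[OF bump_bounds(2) t(2)], simp, rule t(1), rule mult_nonneg_nonneg[OF bump_bounds(1) t(1)])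
    moreover have "\<eta>2 n y = complex_of_real (5 * (4 * (bump 3 (?R n) y * (s * s)) - bump 4 (?R n) y * t))"
      unfolding \<eta>2_def s_def t_def by (simp add: mult.assoc)
    moreover have "\<bar>5 * (4 * P - W)\<bar> \<le> 90" if "P \<le> 1 * 4" "0 \<le> P" "W \<le> 1 * 2" "0 \<le> W" for P W :: real
      using that by (simp add: abs_le_iff)
    ultimately show ?thesis by (simp only: norm_of_real)
  qed (use supp in auto)
  have inv_lim: "(\<lambda>n. c / ?R n) \<longlonglongrightarrow> 0" for c :: real
    by (rule lim_const_over_n[THEN LIMSEQ_Suc])
  have bump_lim: "(\<lambda>n. bump m (?R n) y) \<longlonglongrightarrow> 1" for m y
  proof -
    have "(\<lambda>n. max 0 (1 - (y / ?R n)\<^sup>2) ^ m) \<longlonglongrightarrow> max 0 (1 - 0\<^sup>2) ^ m"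
      by (intro tendsto_intros inv_lim)
    then show ?thesis by (simp add: bump_def)
  qed
  have sl_lim: "(\<lambda>n. - (c / (?R n)\<^sup>2)) \<longlonglongrightarrow> 0" for c :: real
    using tendsto_minus[OF tendsto_mult[OF inv_lim[of c] inv_lim[of 1]]] by (simp add: power2_eq_square)
  have lims: "(\<lambda>n. \<eta> n y) \<longlonglongrightarrow> 1" "(\<lambda>n. \<eta>1 n y) \<longlonglongrightarrow> 0" "(\<lambda>n. \<eta>2 n y) \<longlonglongrightarrow> 0" for y
  proof -
    show "(\<lambda>n. \<eta> n y) \<longlonglongrightarrow> 1" unfolding \<eta>_def using tendsto_of_real[OF bump_lim[of 5 y]] by simp
    have "(\<lambda>n. 5 * bump 4 (?R n) y * (- (2 * y / (?R n)\<^sup>2))) \<longlonglongrightarrow> 5 * 1 * 0"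
      by (intro tendsto_intros bump_lim sl_lim)
    from tendsto_of_real[OF this, where 'a = complex] show "(\<lambda>n. \<eta>1 n y) \<longlonglongrightarrow> 0"
      unfolding \<eta>1_def by simp
    have "(\<lambda>n. 5 * (4 * bump 3 (?R n) y * (- (2 * y / (?R n)\<^sup>2)) * (- (2 * y / (?R n)\<^sup>2)) + bump 4 (?R n) y * (- (2 / (?R n)\<^sup>2)))) \<longlonglongrightarrow> 5 * (4 * 1 * 0 * 0 + 1 * 0)"
      by (intro tendsto_intros bump_lim sl_lim)
    from tendsto_of_real[OF this, where 'a = complex] show "(\<lambda>n. \<eta>2 n y) \<longlonglongrightarrow> 0"
      unfolding \<eta>2_def by simp
  qed
  have \<eta>c: "continuous_on UNIV (\<eta> n)" "continuous_on UNIV (\<eta>1 n)" "continuous_on UNIV (\<eta>2 n)" for n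
    unfolding \<eta>_def \<eta>1_def \<eta>2_def bump_def by (intro continuous_intros; simp)+
  \<comment> \<open>The operator d^2/dy^2 - k^2 applied to \<open>\<phi> \<eta>\<close>: the term
    with k^2 cancels, and every summand but the first contains a derivative of the cutoff and
    disappears in the limit.\<close>
  define q where "q = (\<lambda>n y. B2 y * g y * \<eta> n y + 2 * \<phi>' y * \<eta>1 n y + \<phi> y * \<eta>2 n y)"
  have \<theta>: "((\<lambda>y. \<phi> y * \<eta> n y) has_vector_derivative \<phi> y * \<eta>1 n y + \<phi>' y * \<eta> n y) (at y)"
    "((\<lambda>y. \<phi> y * \<eta>1 n y + \<phi>' y * \<eta> n y) has_vector_derivative q n y + of_int k ^ 2 * (\<phi> y * \<eta> n y)) (at y)" for n y
  proof -
    show "((\<lambda>y. \<phi> y * \<eta> n y) has_vector_derivative \<phi> y * \<eta>1 n y + \<phi>' y * \<eta> n y) (at y)"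
      by (intro has_vector_derivative_mult \<phi> \<eta>d)
    show "((\<lambda>y. \<phi> y * \<eta>1 n y + \<phi>' y * \<eta> n y) has_vector_derivative q n y + of_int k ^ 2 * (\<phi> y * \<eta> n y)) (at y)"
      by (rule has_vector_derivative_eq_rhs[OF has_vector_derivative_add[OF
            has_vector_derivative_mult[OF \<phi>(1) \<eta>1d] has_vector_derivative_mult[OF \<phi>(2) \<eta>d]]])
        (simp add: q_def B2_def algebra_simps)
  qed
  have \<eta>4: "cdiff 4 (\<eta> n)" for n unfolding \<eta>_def using cdiff_bump[of 4] by (simp add: numeral_eq_Suc del: cdiff.simps)
  have \<theta>4: "cdiff 4 (\<lambda>y. \<phi> y * \<eta> n y)" for n by (intro cdiff_mult \<phi>4 \<eta>4)
  have down: "cdiff 2 f" if "cdiff 4 f" for f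
    using cdiff_Suc_D[of 2 f] cdiff_Suc_D[of 3 f] that by (simp add: numeral_eq_Suc del: cdiff.simps)
  have q2: "cdiff 2 (q n)" for n
  proof -
    have "cdiff (Suc (Suc 2)) (\<lambda>y. \<phi> y * \<eta> n y)" using \<theta>4 by (simp add: numeral_eq_Suc del: cdiff.simps)
    from cdiff_derivative[OF cdiff_derivative[OF this \<theta>(1)] \<theta>(2)]
    have "cdiff 2 (\<lambda>y. q n y + of_int k ^ 2 * (\<phi> y * \<eta> n y))" .
    from cdiff_add[OF this cdiff_minus[OF cdiff_mult[OF cdiff_const down[OF \<theta>4]]], of "of_int k ^ 2" n]
    show ?thesis by simp
  qed
  have \<theta>_test: "test_function (mode (- k) (\<lambda>y. c * (\<phi> y * \<eta> n y)))" for n c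
    by (rule test_function_mode[OF cdiff_mult[OF cdiff_const down[OF \<theta>4]], where R = "?R n"]) (simp add: supp)
  have q_test: "test_function (mode (- k) (q n))" for n
    by (rule test_function_mode[OF q2, where R = "?R n"]) (auto simp: q_def supp)
  have g_test: "test_function (mode (- k) (\<lambda>y. g y * \<eta> n y))" for n
    by (rule test_function_mode[OF cdiff_mult[OF g2 down[OF \<eta>4]], where R = "?R n"]) (simp add: supp)
  \<comment> \<open>\<open>\<psi>\<close> is only locally integrable, so it is eliminated while the
    tests have compact support: the mode with coefficient -i k q is both the Laplacian of one test
    function and the x-derivative of another.\<close>
  have v_n: "pairing v (mode (- k) (q n)) = \<i> * of_int k * pairing \<omega> (mode (- k) (\<lambda>y. \<phi> y * \<eta> n y))" for n
  proof -
    let ?c = "\<i> * of_int (- k)"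
    have "((\<lambda>y. ?c * (\<phi> y * \<eta> n y)) has_vector_derivative ?c * (\<phi> y * \<eta>1 n y + \<phi>' y * \<eta> n y)) (at y)"
      "((\<lambda>y. ?c * (\<phi> y * \<eta>1 n y + \<phi>' y * \<eta> n y)) has_vector_derivative ?c * (q n y + of_int k ^ 2 * (\<phi> y * \<eta> n y))) (at y)" for y
      by (intro has_vector_derivative_mult_right \<theta>)+
    note lap = laplacian_mode[OF this, of "- k"]
    have "pairing \<psi> (\<lambda>z. partial_x (partial_x (mode (- k) (\<lambda>y. ?c * (\<phi> y * \<eta> n y)))) z +
        partial_y (partial_y (mode (- k) (\<lambda>y. ?c * (\<phi> y * \<eta> n y)))) z) = pairing \<omega> (mode (- k) (\<lambda>y. ?c * (\<phi> y * \<eta> n y)))"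
      using \<psi>(1) \<theta>_test unfolding weak_laplacian_def by blast
    moreover have "(\<lambda>z. partial_x (partial_x (mode (- k) (\<lambda>y. ?c * (\<phi> y * \<eta> n y)))) z +
        partial_y (partial_y (mode (- k) (\<lambda>y. ?c * (\<phi> y * \<eta> n y)))) z) = mode (- k) (\<lambda>y. ?c * q n y)"
      unfolding lap by (simp add: algebra_simps)
    moreover have "pairing \<psi> (partial_x (mode (- k) (q n))) = - pairing v (mode (- k) (q n))"
      using \<psi>(2) q_test unfolding weak_partial_x_def by blast
    ultimately have "- pairing v (mode (- k) (q n)) = pairing \<omega> (mode (- k) (\<lambda>y. ?c * (\<phi> y * \<eta> n y)))"
      by (simp add: partial_x_mode)
    also have "\<dots> = ?c * pairing \<omega> (mode (- k) (\<lambda>y. \<phi> y * \<eta> n y))"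
      unfolding mode_cmult[symmetric, abs_def] pairing_cmult ..
    finally show ?thesis by (simp add: minus_equation_iff)
  qed
  have h_n: "pairing h (mode (- k) (\<lambda>y. g y * \<eta> n y)) = \<i> * of_int k * pairing \<omega> (mode (- k) (\<lambda>y. B y * (g y * \<eta> n y)))" for n
  proof -
    let ?c = "\<i> * of_int (- k)"
    have "- pairing h (mode (- k) (\<lambda>y. g y * \<eta> n y)) = pairing (\<lambda>(x, y). B y * \<omega> (x, y)) (partial_x (mode (- k) (\<lambda>y. g y * \<eta> n y)))"
      using h(2) g_test unfolding weak_partial_x_def by simp
    also have "\<dots> = pairing \<omega> (\<lambda>z. ?c * mode (- k) (\<lambda>y. B y * (g y * \<eta> n y)) z)"
      unfolding pairing_def partial_x_mode
      by (intro Bochner_Integration.integral_cong refl) (auto simp: mode_apply)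
    also have "\<dots> = ?c * pairing \<omega> (mode (- k) (\<lambda>y. B y * (g y * \<eta> n y)))" by (rule pairing_cmult)
    finally show ?thesis by (simp add: minus_equation_iff)
  qed
  have d0: "0 \<le> d y" for y using le(1)[of y] norm_ge_zero order_trans by blast
  \<comment> \<open>111 = 1 + 2 * 10 + 90 accounts for the three terms of \<open>q\<close>.\<close>
  have d111: "continuous_on UNIV (\<lambda>y. 111 * d y)" "integrable lborel (\<lambda>y. (111 * d y)\<^sup>2)"
    using d by (auto intro!: continuous_intros simp: power_mult_distrib)
  have mult_\<eta>: "cmod (a * \<eta> n y) \<le> d y" if "cmod a \<le> d y" for a n y
    unfolding norm_mult using mult_mono[OF that \<eta>0[of n y] d0 norm_ge_zero] by simp
  have q_le: "cmod (q n y) \<le> 111 * d y" for n y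
  proof -
    have "cmod (q n y) \<le> cmod (B2 y * g y * \<eta> n y) + cmod (2 * \<phi>' y * \<eta>1 n y) + cmod (\<phi> y * \<eta>2 n y)"
      unfolding q_def by (intro order_trans[OF norm_triangle_ineq] add_mono order_refl norm_triangle_ineq)
    also have "\<dots> \<le> d y + 2 * d y * 10 + d y * 90"
    proof (intro add_mono)
      show "cmod (B2 y * g y * \<eta> n y) \<le> d y" by (rule mult_\<eta>) (use le(5) in \<open>simp add: B2_def\<close>)
      show "cmod (2 * \<phi>' y * \<eta>1 n y) \<le> 2 * d y * 10"
        unfolding norm_mult using le(2) d0 \<eta>1_le by (intro mult_mono) auto
      show "cmod (\<phi> y * \<eta>2 n y) \<le> d y * 90"
        unfolding norm_mult using le(1) d0 \<eta>2_le by (intro mult_mono) auto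
    qed
    finally show ?thesis by simp
  qed
  have v_lim: "pairing v (mode (- k) (\<lambda>y. B2 y * g y)) = \<i> * of_int k * pairing \<omega> (mode (- k) \<phi>)"
  proof (rule LIMSEQ_unique)
    show "(\<lambda>n. pairing v (mode (- k) (q n))) \<longlonglongrightarrow> pairing v (mode (- k) (\<lambda>y. B2 y * g y))"
    proof (rule pairing_mode_tendsto[OF vL2 d111 _ _ q_le])
      show "(\<lambda>n. q n y) \<longlonglongrightarrow> B2 y * g y" for y
        unfolding q_def by (rule tendsto_eq_intros lims refl | simp)+
    qed (auto simp: q_def intro!: continuous_intros Bc gc \<phi>c \<eta>c)
    show "(\<lambda>n. pairing v (mode (- k) (q n))) \<longlonglongrightarrow> \<i> * of_int k * pairing \<omega> (mode (- k) \<phi>)"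
      unfolding v_n
    proof (rule tendsto_mult[OF tendsto_const pairing_mode_tendsto[OF \<omega> d]])
      show "(\<lambda>n. \<phi> y * \<eta> n y) \<longlonglongrightarrow> \<phi> y" for y
        using tendsto_mult[OF tendsto_const lims(1)] by simp
    qed (auto intro!: continuous_intros \<phi>c \<eta>c mult_\<eta> le)
  qed
  have h_lim: "pairing h (mode (- k) g) = \<i> * of_int k * pairing \<omega> (mode (- k) (\<lambda>y. B y * g y))"
  proof (rule LIMSEQ_unique)
    show "(\<lambda>n. pairing h (mode (- k) (\<lambda>y. g y * \<eta> n y))) \<longlonglongrightarrow> pairing h (mode (- k) g)"
    proof (intro pairing_mode_tendsto[OF h(1) d])
      show "(\<lambda>n. g y * \<eta> n y) \<longlonglongrightarrow> g y" for y
        using tendsto_mult[OF tendsto_const lims(1)] by simp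
    qed (auto intro!: continuous_intros gc \<eta>c mult_\<eta> le)
    show "(\<lambda>n. pairing h (mode (- k) (\<lambda>y. g y * \<eta> n y))) \<longlonglongrightarrow> \<i> * of_int k * pairing \<omega> (mode (- k) (\<lambda>y. B y * g y))"
      unfolding h_n
    proof (rule tendsto_mult[OF tendsto_const pairing_mode_tendsto[OF \<omega> d]])
      show "(\<lambda>n. B y * (g y * \<eta> n y)) \<longlonglongrightarrow> B y * g y" for y
        using tendsto_mult[OF tendsto_const[of "B y * g y"] lims(1)] by (simp add: mult.assoc)
      show "cmod (B y * (g y * \<eta> n y)) \<le> d y" for n y
        using mult_\<eta>[of "B y * g y" y n] le(4)[of y] by (simp add: B_def mult.assoc)
    qed (auto intro!: continuous_intros gc \<eta>c Bc)
  qed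
  have gL2: "mode (- k) g \<in> L2" "mode (- k) \<phi> \<in> L2" "mode (- k) (\<lambda>y. B y * g y) \<in> L2" "mode (- k) (\<lambda>y. B2 y * g y) \<in> L2"
    by (rule mode_L2_dominated(2)[OF _ d]; (intro continuous_intros gc Bc \<phi>c | use le in \<open>simp add: B_def B2_def\<close>))+
  have "pairing g0 (mode (- k) g) = (\<integral>z. h z * mode (- k) g z - v z * mode (- k) (\<lambda>y. B2 y * g y) z \<partial>cylinder)"
    unfolding pairing_def
  proof (rule integral_cong_AE)
    show "AE z in cylinder. g0 z * mode (- k) g z = h z * mode (- k) g z - v z * mode (- k) (\<lambda>y. B2 y * g y) z"
      using g0 by eventually_elim (auto simp: mode_apply left_diff_distrib right_diff_distrib mult_ac)
  qed (intro borel_measurable_diff borel_measurable_times g0L2[THEN L2_measurable] h(1)[THEN L2_measurable]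
      vL2[THEN L2_measurable] gL2[THEN L2_measurable])+
  also have "\<dots> = pairing h (mode (- k) g) - pairing v (mode (- k) (\<lambda>y. B2 y * g y))"
    unfolding pairing_def using integrable_pairing[OF h(1) gL2(1)] integrable_pairing[OF vL2 gL2(4)] by simp
  also have "\<dots> = \<i> * of_int k * (pairing \<omega> (mode (- k) (\<lambda>y. B y * g y)) - pairing \<omega> (mode (- k) \<phi>))"
    unfolding h_lim v_lim by (simp add: algebra_simps)
  also have "pairing \<omega> (mode (- k) (\<lambda>y. B y * g y)) - pairing \<omega> (mode (- k) \<phi>) = pairing \<omega> (\<lambda>z. c * mode (- k) g z)"
    unfolding pairing_diff_right[OF gL2(3,2) \<omega>, symmetric]
  proof (intro arg_cong[where f = "pairing \<omega>"] ext)
    fix z :: "real \<times> real"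
    obtain x y where z: "z = (x, y)" by (cases z)
    have "B y * g y - \<phi> y = c * g y" using g[of y] by (simp add: B_def algebra_simps)
    then show "mode (- k) (\<lambda>y. B y * g y) z - mode (- k) \<phi> z = c * mode (- k) g z"
      unfolding z mode_apply by (metis mult.left_commute right_diff_distrib)
  qed
  finally show ?thesis by (simp add: pairing_cmult)
qed

section \<open>Eigenfunctions and the flow\<close>

text \<open>\<open>\<phi>\<close> is the stream function and \<open>w\<close> its vorticity. The
  second assumption on \<open>w\<close> is the Rayleigh equation multiplied by b0 - c, and i k times
  it is the eigenvalue equation.\<close>

lemma rayleigh_mode:
  fixes \<phi> w :: "real \<Rightarrow> complex" and c :: complex
  assumes B: "continuous_on UNIV (b0 M \<gamma>)"
    and \<phi>: "\<And>y. (\<phi> has_vector_derivative \<phi>' y) (at y)"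
      "\<And>y. (\<phi>' has_vector_derivative of_int k ^ 2 * \<phi> y + w y) (at y)"
    and w: "continuous_on UNIV w" "\<And>y. (of_real (b0 M \<gamma> y) - c) * w y = of_real (deriv (deriv (b0 M \<gamma>)) y) * \<phi> y"
    and int: "integrable lborel (\<lambda>y. (cmod (\<phi> y))\<^sup>2)" "integrable lborel (\<lambda>y. (cmod (w y))\<^sup>2)"
      "integrable lborel (\<lambda>y. (cmod (of_real (b0 M \<gamma> y) * w y))\<^sup>2)"
  shows "rayleigh M \<gamma> (mode k w) (\<lambda>z. \<i> * of_int k * c * mode k w z)"
  unfolding rayleigh_def
proof (intro conjI exI)
  let ?ik = "\<i> * of_int k"
  have \<phi>c: "continuous_on UNIV \<phi>" by (rule has_vector_derivative_continuous_on[OF \<phi>(1)])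
  show wL2: "mode k w \<in> L2" by (rule mode_L2[OF w(1) int(2)])
  then show "(\<lambda>z. ?ik * c * mode k w z) \<in> L2" by (rule L2_cmult)
  have Bw: "continuous_on UNIV (\<lambda>y. of_real (b0 M \<gamma> y) * w y)" by (intro continuous_intros B w)
  have L2_ik: "mode k (\<lambda>y. ?ik * a y) \<in> L2" if "continuous_on UNIV a" "integrable lborel (\<lambda>y. (cmod (a y))\<^sup>2)" for a
    using L2_cmult[OF mode_L2[OF that], of ?ik k] by (simp add: mode_cmult[abs_def])
  show "mode k (\<lambda>y. ?ik * (of_real (b0 M \<gamma> y) * w y)) \<in> L2" by (rule L2_ik[OF Bw int(3)])
  have "(\<lambda>(x, y). of_real (b0 M \<gamma> y) * mode k w (x, y)) = mode k (\<lambda>y. of_real (b0 M \<gamma> y) * w y)"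
    by (auto simp: mode_apply)
  then show "weak_partial_x (\<lambda>(x, y). of_real (b0 M \<gamma> y) * mode k w (x, y)) (mode k (\<lambda>y. ?ik * (of_real (b0 M \<gamma> y) * w y)))"
    using weak_partial_x_mode[OF Bw, of k] by simp
  have "weak_laplacian (mode k \<phi>) (mode k (\<lambda>y. (of_int k ^ 2 * \<phi> y + w y) - of_int k ^ 2 * \<phi> y))"
    by (rule weak_laplacian_mode[OF \<phi>]) (intro continuous_intros \<phi>c w)
  then show "partial_x_inv_laplacian (mode k w) (mode k (\<lambda>y. ?ik * \<phi> y))"
    unfolding partial_x_inv_laplacian_def using L2_ik[OF \<phi>c int(1)] weak_partial_x_mode[OF \<phi>c, of k] by auto
  show "AE (x, y) in cylinder. ?ik * c * mode k w (x, y) =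
      mode k (\<lambda>y. ?ik * (of_real (b0 M \<gamma> y) * w y)) (x, y) - of_real (deriv (deriv (b0 M \<gamma>)) y) * mode k (\<lambda>y. ?ik * \<phi> y) (x, y)"
  proof (rule AE_I2, clarify)
    fix x y
    have eq: "of_real (deriv (deriv (b0 M \<gamma>)) y) * \<phi> y = of_real (b0 M \<gamma> y) * w y - c * w y"
      using w(2)[of y] by (simp add: left_diff_distrib)
    have "of_real (deriv (deriv (b0 M \<gamma>)) y) * mode k (\<lambda>y. ?ik * \<phi> y) (x, y) =
        cis (of_int k * x) * ?ik * (of_real (deriv (deriv (b0 M \<gamma>)) y) * \<phi> y)"
      by (simp add: mode_apply mult_ac)
    then show "?ik * c * mode k w (x, y) =
      mode k (\<lambda>y. ?ik * (of_real (b0 M \<gamma> y) * w y)) (x, y) - of_real (deriv (deriv (b0 M \<gamma>)) y) * mode k (\<lambda>y. ?ik * \<phi> y) (x, y)"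
      unfolding eq by (simp add: mode_apply algebra_simps)
  qed
qed

lemma has_vector_derivative_exp_of_real:
  fixes c :: complex
  shows "((\<lambda>s. exp (c * of_real s)) has_vector_derivative c * exp (c * of_real s)) (at s within S)"
  by (rule has_vector_derivative_real_field[of "\<lambda>x. exp (c * x)"]) (auto intro!: derivative_eq_intros)

text \<open>An explicit solution guarantees that the choice in \<open>rayleigh_flow\<close> picks a
  solution at all. \<open>A\<close> is an arbitrary relation, not known to be linear, so all
  multiples of the eigenfunction appear in the assumption.\<close>

lemma mild_solution_eigenfunction:
  assumes \<omega>: "\<omega> \<in> L2" and l: "l \<noteq> 0" and A: "\<And>a. A (\<lambda>z. a * \<omega> z) (\<lambda>z. a * l * \<omega> z)"
  shows "mild_solution A \<omega> (\<lambda>t z. exp (- l * of_real t) * \<omega> z)"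
  unfolding mild_solution_def
proof (intro conjI allI impI)
  fix t :: real assume t: "0 \<le> t"
  let ?e = "\<lambda>s::real. exp (- l * of_real s)"
  show "(\<lambda>z. ?e t * \<omega> z) \<in> L2" by (rule L2_cmult[OF \<omega>])
  have "((\<lambda>s. cmod (?e s - ?e t) * L2_norm \<omega>) \<longlongrightarrow> cmod (?e t - ?e t) * L2_norm \<omega>) (at t within {0..})"
    by (intro tendsto_intros)
  then show "((\<lambda>s. L2_norm (\<lambda>z. ?e s * \<omega> z - ?e t * \<omega> z)) \<longlongrightarrow> 0) (at t within {0..})"
    by (simp add: L2_norm_cmult flip: left_diff_distrib)
  \<comment> \<open>The integral of exp(-l s) over [0, t]; the time integral of the solution is this
    multiple of \<open>\<omega>\<close>.\<close>
  define a where "a = (1 - ?e t) / l"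
  show "\<exists>U\<in>L2. (\<forall>f\<in>L2. pairing U f = (LBINT s=0..t. pairing (\<lambda>z. ?e s * \<omega> z) f)) \<and>
     A U (\<lambda>z. \<omega> z - ?e t * \<omega> z)"
  proof (intro bexI conjI ballI)
    show "(\<lambda>z. a * \<omega> z) \<in> L2" by (rule L2_cmult[OF \<omega>])
    have "a * l = 1 - ?e t" using l by (simp add: a_def)
    then show "A (\<lambda>z. a * \<omega> z) (\<lambda>z. \<omega> z - ?e t * \<omega> z)" using A[of a] by (simp add: left_diff_distrib)
    fix f
    have "(LBINT s=0..t. pairing (\<lambda>z. ?e s * \<omega> z) f) = (LBINT s=ereal 0..ereal t. ?e s * pairing \<omega> f)"
      by (simp add: pairing_cmult zero_ereal_def)
    also have "\<dots> = - (?e t * pairing \<omega> f) / l - - (?e 0 * pairing \<omega> f) / l"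
    proof (rule interval_integral_FTC_finite)
      show "continuous_on {min 0 t..max 0 t} (\<lambda>s. ?e s * pairing \<omega> f)" by (intro continuous_intros)
      fix s
      have "((\<lambda>s. ?e s) has_vector_derivative - l * ?e s) (at s)"
        by (rule has_vector_derivative_exp_of_real)
      then have "((\<lambda>s. - (?e s * pairing \<omega> f) / l) has_vector_derivative - (- l * ?e s * pairing \<omega> f) / l) (at s within {min 0 t..max 0 t})"
        by (rule has_vector_derivative_at_within[OF has_vector_derivative_divide[OF
                has_vector_derivative_minus[OF has_vector_derivative_mult_left]]])
      then show "((\<lambda>s. - (?e s * pairing \<omega> f) / l) has_vector_derivative ?e s * pairing \<omega> f) (at s within {min 0 t..max 0 t})"
        using l by simp
    qed
    also have "\<dots> = a * pairing \<omega> f"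
      using l unfolding a_def by (simp add: field_simps)
    finally have eq: "(LBINT s=0..t. pairing (\<lambda>z. ?e s * \<omega> z) f) = a * pairing \<omega> f" .
    show "pairing (\<lambda>z. a * \<omega> z) f = (LBINT s=0..t. pairing (\<lambda>z. ?e s * \<omega> z) f)"
      unfolding eq by (rule pairing_cmult(2))
  qed
qed

text \<open>Pairing with an adjoint eigenvector reduces the evolution equation to the scalar equation
  \<open>p' = - l p\<close>, so no uniqueness theorem for mild solutions is needed.\<close>

lemma mild_solution_pairing:
  assumes u: "mild_solution A \<omega> u" and f: "f \<in> L2" and \<omega>: "\<omega> \<in> L2"
    and adj: "\<And>U g. A U g \<Longrightarrow> pairing g f = l * pairing U f" and t: "0 \<le> t"
  shows "pairing (u t) f = exp (- l * of_real t) * pairing \<omega> f"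
proof -
  have uL2: "u s \<in> L2" if "0 \<le> s" for s using u that by (simp add: mild_solution_def)
  define p where "p = (\<lambda>s. pairing (u s) f)"
  have p_eq: "p s = p0 - l * (LBINT r=0..s. p r)" if "0 \<le> s" and p0: "p0 = pairing \<omega> f" for s p0
  proof -
    from u have "\<forall>t\<ge>0. \<exists>U\<in>L2. (\<forall>f\<in>L2. pairing U f = (LBINT s=0..t. pairing (u s) f)) \<and> A U (\<lambda>z. \<omega> z - u t z)"
      unfolding mild_solution_def by (elim conjE)
    from mp[OF spec[OF this] that(1)] obtain U where
      "(\<forall>f\<in>L2. pairing U f = (LBINT r=0..s. pairing (u r) f)) \<and> A U (\<lambda>z. \<omega> z - u s z)"
      by (rule bexE)
    note U = conjunct1[OF this] conjunct2[OF this]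
    have "pairing \<omega> f - p s = pairing (\<lambda>z. \<omega> z - u s z) f"
      unfolding p_def by (rule pairing_diff[OF \<omega> uL2[OF that(1)] f, symmetric])
    also have "\<dots> = l * pairing U f" by (rule adj[OF U(2)])
    also have "pairing U f = (LBINT r=0..s. p r)" using U(1) f unfolding p_def by blast
    finally have "pairing \<omega> f - p s = l * (LBINT r=0..s. p r)" .
    then show ?thesis using p0 by (simp add: algebra_simps)
  qed
  show ?thesis
  proof (cases "t = 0")
    case True
    then show ?thesis using p_eq[of 0] by (simp add: p_def flip: zero_ereal_def)
  next
    case False
    then have t: "0 < t" using t by simp
    \<comment> \<open>Strong continuity and Cauchy-Schwarz make p continuous; only then can the
      integral equation be differentiated.\<close>
    have cont: "continuous_on {0..t} p"
      unfolding continuous_on_def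
    proof
      fix s assume s: "s \<in> {0..t}"
      have lim: "((\<lambda>r. L2_norm (\<lambda>z. u r z - u s z) * L2_norm f) \<longlongrightarrow> 0 * L2_norm f) (at s within {0..t})"
        using u s unfolding mild_solution_def
        by (intro tendsto_mult tendsto_const) (auto intro: tendsto_within_subset)
      have "\<forall>\<^sub>F r in at s within {0..t}. norm (p r - p s) \<le> L2_norm (\<lambda>z. u r z - u s z) * L2_norm f"
        unfolding eventually_at_filter
      proof (rule always_eventually, intro allI impI)
        fix r assume "r \<noteq> s" and r: "r \<in> {0..t}"
        have "p r - p s = pairing (\<lambda>z. u r z - u s z) f"
          unfolding p_def using r s by (subst pairing_diff) (auto intro: uL2 f)
        also have "norm \<dots> \<le> L2_norm (\<lambda>z. u r z - u s z) * L2_norm f"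
          using r s by (intro pairing_Cauchy_Schwarz L2_diff uL2 f) auto
        finally show "norm (p r - p s) \<le> L2_norm (\<lambda>z. u r z - u s z) * L2_norm f" .
      qed
      then have "((\<lambda>r. p r - p s) \<longlongrightarrow> 0) (at s within {0..t})"
        by (rule Lim_null_comparison) (use lim in simp)
      then show "(p \<longlongrightarrow> p s) (at s within {0..t})" by (rule LIM_zero_cancel)
    qed
    have p_int: "p s = pairing \<omega> f - l * integral {0..s} p" if "s \<in> {0..t}" for s
    proof -
      have "(LBINT r=ereal 0..ereal s. p r) = integral {0..s} p"
        using that by (intro interval_integral_eq_integral borel_integrable_atLeastAtMost' continuous_on_subset[OF cont]) auto
      then show ?thesis using p_eq[of s] that by (simp add: zero_ereal_def)
    qed
    define e where "e = (\<lambda>s::real. exp (l * of_real s))"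
    have e': "(e has_vector_derivative l * e s) (at s within {0..t})" for s
      unfolding e_def by (rule has_vector_derivative_exp_of_real)
    \<comment> \<open>exp(l s) is the integrating factor of p' = - l p; derivatives at the ends of
      the interval are one-sided.\<close>
    have D0: "((\<lambda>s. e s * p s) has_vector_derivative 0) (at s within {0..t})" if s: "s \<in> {0..t}" for s
    proof -
      have "((\<lambda>s. pairing \<omega> f - l * integral {0..s} p) has_vector_derivative 0 - l * p s) (at s within {0..t})"
        by (intro has_vector_derivative_diff has_vector_derivative_const has_vector_derivative_mult_right integral_has_vector_derivative cont s)
      then have D: "((\<lambda>s. pairing \<omega> f - l * integral {0..s} p) has_vector_derivative - l * p s) (at s within {0..t})"
        by simp
      have "(p has_vector_derivative - l * p s) (at s within {0..t})"
      proof (rule has_vector_derivative_transform[OF s _ D])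
        fix r assume "r \<in> {0..t}"
        then show "p r = pairing \<omega> f - l * integral {0..r} p" by (rule p_int)
      qed
      from has_vector_derivative_mult[OF e' this] show ?thesis by (simp add: algebra_simps)
    qed
    obtain c where c: "\<And>s. s \<in> {0..t} \<Longrightarrow> e s * p s = c"
      using has_vector_derivative_zero_constant[of "{0..t}" "\<lambda>s. e s * p s", OF convex_real_interval(5) D0] by metis
    have "e t * p t = e 0 * p 0" using c[of t] c[of 0] t by simp
    moreover have "p 0 = pairing \<omega> f" using p_eq[of 0] by (simp flip: zero_ereal_def)
    moreover have "exp (- l * of_real t) * e t = 1" unfolding e_def by (simp flip: exp_add)
    moreover have "e 0 = 1" by (simp add: e_def)
    ultimately have "p t = exp (- l * of_real t) * pairing \<omega> f"
      by (metis mult.assoc mult_1)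
    then show ?thesis by (simp add: p_def)
  qed
qed

text \<open>The chosen curve is known only to be a mild solution. Its pairing with the adjoint
  eigenfunction is nevertheless explicit, and Cauchy-Schwarz bounds that pairing by the norm of the
  curve.\<close>

lemma rayleigh_flow_lower_bound:
  assumes \<omega>: "\<omega> \<in> L2" and f: "f \<in> L2" and l: "l \<noteq> 0"
    and eigen: "\<And>a. rayleigh M \<gamma> (\<lambda>z. a * \<omega> z) (\<lambda>z. a * l * \<omega> z)"
    and adj: "\<And>U g. rayleigh M \<gamma> U g \<Longrightarrow> pairing g f = l * pairing U f" and t: "0 \<le> t"
  shows "exp (- Re l * t) * cmod (pairing \<omega> f) \<le> L2_norm (rayleigh_flow M \<gamma> t \<omega>) * L2_norm f"
proof -
  define u where "u = (SOME u. mild_solution (rayleigh M \<gamma>) \<omega> u)"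
  have u: "mild_solution (rayleigh M \<gamma>) \<omega> u"
    unfolding u_def
    by (rule someI[of "mild_solution (rayleigh M \<gamma>) \<omega>",
          OF mild_solution_eigenfunction[where A = "rayleigh M \<gamma>" and \<omega> = \<omega> and l = l, OF \<omega> l eigen]])
  have "pairing (u t) f = exp (- l * of_real t) * pairing \<omega> f"
    by (rule mild_solution_pairing[where A = "rayleigh M \<gamma>" and \<omega> = \<omega> and l = l, OF u f \<omega> adj t])
  then have "exp (- Re l * t) * cmod (pairing \<omega> f) = cmod (pairing (u t) f)"
    by (simp add: norm_mult)
  also have "\<dots> \<le> L2_norm (u t) * L2_norm f"
    using u t f by (intro pairing_Cauchy_Schwarz) (auto simp: mild_solution_def)
  finally show ?thesis by (simp add: rayleigh_flow_def u_def)
qed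

section \<open>The Gaussian shear flow\<close>

text \<open>Completing the square, |z| - z^2 <= 1 - |z| leaves an exponentially decaying bound. The
  factor 2 accommodates the weight z^2.\<close>

lemma integrable_gaussian_weight:
  fixes p :: "real \<Rightarrow> real"
  assumes "p \<in> borel_measurable borel" "\<And>z. \<bar>p z\<bar> \<le> 2 * exp \<bar>z\<bar>"
  shows "integrable lborel (\<lambda>z. p z * exp (- z\<^sup>2))"
proof (rule Bochner_Integration.integrable_bound)
  show "integrable lborel (\<lambda>z::real. 2 * exp 1 * exp (- (1 * \<bar>z\<bar>)))"
    by (intro integrable_mult_right integrable_exp_minus_abs) simp
  have "\<bar>p z * exp (- z\<^sup>2)\<bar> \<le> 2 * exp 1 * exp (- (1 * \<bar>z\<bar>))" for z
  proof -
    have "0 \<le> (\<bar>z\<bar> - 1)\<^sup>2" by simp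
    then have "\<bar>z\<bar> + - z\<^sup>2 \<le> 1 + - \<bar>z\<bar>" by (simp add: power2_diff)
    then have "exp \<bar>z\<bar> * exp (- z\<^sup>2) \<le> exp 1 * exp (- \<bar>z\<bar>)"
      unfolding exp_add[symmetric] by simp
    moreover have "\<bar>p z * exp (- z\<^sup>2)\<bar> \<le> 2 * exp \<bar>z\<bar> * exp (- z\<^sup>2)"
      unfolding abs_mult abs_exp_cancel by (intro mult_right_mono assms(2)) simp
    ultimately show ?thesis by simp
  qed
  then show "AE z in lborel. norm (p z * exp (- z\<^sup>2)) \<le> norm (2 * exp 1 * exp (- (1 * \<bar>z\<bar>)))"
    by simp
qed (use assms(1) in measurable)

lemma weight_bounds:
  fixes z :: real
  shows "\<bar>1\<bar> \<le> 2 * exp \<bar>z\<bar>" "\<bar>\<bar>z\<bar>\<bar> \<le> 2 * exp \<bar>z\<bar>" "\<bar>z\<^sup>2\<bar> \<le> 2 * exp \<bar>z\<bar>"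
proof -
  have "1 + \<bar>z\<bar> + \<bar>z\<bar>\<^sup>2 / 2 \<le> exp \<bar>z\<bar>" by (rule exp_lower_Taylor_quadratic) simp
  then have "1 + \<bar>z\<bar> + z\<^sup>2 / 2 \<le> exp \<bar>z\<bar>" by simp
  then show "\<bar>1\<bar> \<le> 2 * exp \<bar>z\<bar>" "\<bar>\<bar>z\<bar>\<bar> \<le> 2 * exp \<bar>z\<bar>" "\<bar>z\<^sup>2\<bar> \<le> 2 * exp \<bar>z\<bar>"
    using abs_ge_zero[of z] zero_le_power2[of z]
    by (simp_all only: abs_one abs_idempotent abs_power2)
qed

text \<open>These integrals remain after the rescaling y = \<open>\<gamma>\<close> z and depend on
  neither \<open>M\<close> nor \<open>\<gamma>\<close>. \<open>gauss_mass\<close> and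
  \<open>gauss_moment\<close> measure the majorant of the potential, \<open>dispersion\<close> is
  the matching integral, \<open>overlap\<close> bounds the pairing with the adjoint from below, and
  \<open>lorentz_mass\<close> bounds the norm of the adjoint from above.\<close>

definition gauss_mass :: real where "gauss_mass = (LBINT z. exp (- z\<^sup>2))"
definition gauss_moment :: real where "gauss_moment = (LBINT z. \<bar>z\<bar> * exp (- z\<^sup>2))"
definition lorentz_mass :: real where "lorentz_mass = (LBINT z. 1 / (1 + z\<^sup>2))"
definition overlap :: real where "overlap = (LBINT z. z\<^sup>2 / (1 + z\<^sup>2)\<^sup>2 * exp (- z\<^sup>2))"
definition dispersion :: "real \<Rightarrow> real" where "dispersion m = (LBINT z. z\<^sup>2 / (z\<^sup>2 + m\<^sup>2) * exp (- z\<^sup>2))"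

lemma gauss_integrable:
  "integrable lborel (\<lambda>z::real. exp (- z\<^sup>2))"
  "integrable lborel (\<lambda>z::real. \<bar>z\<bar> * exp (- z\<^sup>2))"
  "integrable lborel (\<lambda>z::real. z\<^sup>2 / (1 + z\<^sup>2)\<^sup>2 * exp (- z\<^sup>2))"
  "integrable lborel (\<lambda>z::real. z\<^sup>2 / (z\<^sup>2 + m\<^sup>2) * exp (- z\<^sup>2))"
proof -
  show "integrable lborel (\<lambda>z::real. exp (- z\<^sup>2))"
    using integrable_gaussian_weight[of "\<lambda>_. 1"] weight_bounds(1) by simp
  show "integrable lborel (\<lambda>z::real. \<bar>z\<bar> * exp (- z\<^sup>2))"
    by (rule integrable_gaussian_weight[OF _ weight_bounds(2)]) simp
  show "integrable lborel (\<lambda>z::real. z\<^sup>2 / (1 + z\<^sup>2)\<^sup>2 * exp (- z\<^sup>2))"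
  proof (rule integrable_gaussian_weight)
    fix z :: real
    have "1 \<le> (1 + z\<^sup>2)\<^sup>2" by (intro one_le_power) simp
    moreover from this have "0 < (1 + z\<^sup>2)\<^sup>2 * 1" by linarith
    ultimately have "z\<^sup>2 / (1 + z\<^sup>2)\<^sup>2 \<le> z\<^sup>2 / 1" by (intro divide_left_mono zero_le_power2)
    then show "\<bar>z\<^sup>2 / (1 + z\<^sup>2)\<^sup>2\<bar> \<le> 2 * exp \<bar>z\<bar>" using weight_bounds(3)[of z] by simp
  qed simp
  show "integrable lborel (\<lambda>z::real. z\<^sup>2 / (z\<^sup>2 + m\<^sup>2) * exp (- z\<^sup>2))"
  proof (rule integrable_gaussian_weight)
    fix z :: real
    have "z\<^sup>2 / (z\<^sup>2 + m\<^sup>2) \<le> 1" by (simp add: divide_le_eq_1 sum_power2_gt_zero_iff)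
    then show "\<bar>z\<^sup>2 / (z\<^sup>2 + m\<^sup>2)\<bar> \<le> 2 * exp \<bar>z\<bar>" using weight_bounds(1)[of z] by simp
  qed simp
qed

text \<open>A nonnegative function with zero integral vanishes almost everywhere. The origin is
  exempted because integrands with a factor z^2 vanish there.\<close>

lemma integral_pos_lborel:
  fixes f :: "real \<Rightarrow> real"
  assumes "integrable lborel f" "\<And>z. 0 \<le> f z" "\<And>z. z \<noteq> 0 \<Longrightarrow> 0 < f z"
  shows "0 < (LBINT z. f z)"
proof -
  have "(LBINT z. f z) \<noteq> 0"
  proof
    assume "(LBINT z. f z) = 0"
    then have "AE z in lborel. f z = 0"
      using integral_nonneg_eq_0_iff_AE[OF assms(1)] assms(2) by simp
    moreover have "AE z in lborel. z \<noteq> (0::real)" by (rule AE_lborel_singleton)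
    ultimately have "AE z in (lborel :: real measure). False"
      by eventually_elim (use assms(3) in force)
    then show False by (simp add: eventually_False ae_filter_eq_bot_iff)
  qed
  moreover have "0 \<le> (LBINT z. f z)" using assms(2) by simp
  ultimately show ?thesis by simp
qed

lemma constants_pos: "0 < gauss_mass" "0 < lorentz_mass" "0 < overlap"
proof -
  have pos: "0 < 1 + z\<^sup>2" for z :: real by (intro add_pos_nonneg) auto
  show "0 < gauss_mass" unfolding gauss_mass_def by (rule integral_pos_lborel[OF gauss_integrable(1)]) auto
  show "0 < lorentz_mass" unfolding lorentz_mass_def
    by (rule integral_pos_lborel[OF integrable_inverse_quadratic]) (use pos in \<open>auto intro: less_imp_le\<close>)
  show "0 < overlap" unfolding overlap_def
    by (rule integral_pos_lborel[OF gauss_integrable(3)]) (use zero_less_power[OF pos, of _ 2] in \<open>auto intro!: mult_pos_pos divide_pos_pos\<close>)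
qed

text \<open>Off the origin the integrand decreases strictly in m. The gap times \<open>A\<close> is
  the width of the window for 2 k, so a large \<open>M\<close> leaves room for an integer.\<close>

lemma dispersion_less: "dispersion 2 < dispersion 1"
proof -
  have "0 < (LBINT z. (z::real)\<^sup>2 / (z\<^sup>2 + 1\<^sup>2) * exp (- z\<^sup>2) - z\<^sup>2 / (z\<^sup>2 + 2\<^sup>2) * exp (- z\<^sup>2))"
  proof (rule integral_pos_lborel)
    have less: "z\<^sup>2 / (z\<^sup>2 + 2\<^sup>2) < z\<^sup>2 / (z\<^sup>2 + 1\<^sup>2)" if "z \<noteq> 0" for z :: real
      using that by (intro divide_strict_left_mono) (auto intro!: mult_pos_pos add_nonneg_pos)
    show pos: "0 < z\<^sup>2 / (z\<^sup>2 + 1\<^sup>2) * exp (- z\<^sup>2) - z\<^sup>2 / (z\<^sup>2 + 2\<^sup>2) * exp (- z\<^sup>2)" if "z \<noteq> 0" for z :: real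
      unfolding left_diff_distrib[symmetric] using less[OF that] by (intro mult_pos_pos) auto
    show "0 \<le> z\<^sup>2 / (z\<^sup>2 + 1\<^sup>2) * exp (- z\<^sup>2) - z\<^sup>2 / (z\<^sup>2 + 2\<^sup>2) * exp (- z\<^sup>2)" for z :: real
      using pos[of z] by (cases "z = 0") auto
  qed (intro Bochner_Integration.integrable_diff gauss_integrable)
  also have "\<dots> = dispersion 1 - dispersion 2"
    unfolding dispersion_def by (intro Bochner_Integration.integral_diff gauss_integrable)
  finally show ?thesis by simp
qed

lemma
  fixes f :: "real \<Rightarrow> real"
  assumes "0 < g" "integrable lborel f"
  shows integrable_rescale: "integrable lborel (\<lambda>y. f (y / g))"
    and integral_rescale: "(LBINT y. f (y / g)) = g * (LBINT z. f z)"
proof -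
  show "integrable lborel (\<lambda>y. f (y / g))"
    using lborel_integrable_real_affine[OF assms(2), of "1 / g" 0] assms(1) by simp
  have "(LBINT z. f z) = \<bar>1 / g\<bar> *\<^sub>R (LBINT y. f (0 + 1 / g * y))"
    by (rule lborel_integral_real_affine) (use assms(1) in simp)
  then show "(LBINT y. f (y / g)) = g * (LBINT z. f z)"
    using assms(1) by simp
qed

locale gaussian_shear =
  fixes M \<gamma> :: real
  assumes M_pos: "0 < M" and \<gamma>_pos: "0 < \<gamma>"
begin

text \<open>\<open>A\<close> is the amplitude of b0'', and \<open>S\<close> is b0'(0), the largest
  slope, which tends to 1 with \<open>\<gamma>\<close>. \<open>den m\<close> is b0 - c for c = i
  \<open>\<gamma>\<close> m.\<close>

definition A :: real where "A = 4 * sqrt pi * M"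
definition S :: real where "S = 1 + 2 * sqrt pi * M * \<gamma>"
definition B2 :: "real \<Rightarrow> real" where "B2 y = - (A * (y / \<gamma>) * exp (- (y / \<gamma>)\<^sup>2))"
definition den :: "real \<Rightarrow> real \<Rightarrow> complex" where "den m y = of_real (b0 M \<gamma> y) - \<i> * of_real (\<gamma> * m)"
definition Q :: "real \<Rightarrow> real \<Rightarrow> complex" where "Q m y = of_real (B2 y) / den m y"
definition q :: "real \<Rightarrow> real" where "q y = A / \<gamma> * exp (- (y / \<gamma>)\<^sup>2)"

lemma A_pos: "0 < A" using M_pos by (simp add: A_def)

lemma S_ge: "1 \<le> S" using M_pos \<gamma>_pos by (simp add: S_def)

section \<open>The velocity profile and its derivatives\<close>

lemma b0_derivative:
  "(b0 M \<gamma> has_real_derivative 1 + 2 * sqrt pi * M * \<gamma> * exp (- (y\<^sup>2 / \<gamma>\<^sup>2))) (at y)"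
proof -
  let ?f = "\<lambda>s. 1 + 2 * sqrt pi * M * \<gamma> * exp (- (s\<^sup>2 / \<gamma>\<^sup>2))"
  define c where "c = min 0 y - 1"
  define d where "d = max 0 y + 1"
  have "((\<lambda>u. LBINT s=ereal 0..ereal u. ?f s) has_vector_derivative ?f y) (at y within {c..d})"
    by (rule interval_integral_FTC2) (use \<gamma>_pos in \<open>auto simp: c_def d_def intro!: continuous_intros\<close>)
  moreover have "at y within {c..d} = at y"
    by (rule at_within_Icc_at) (auto simp: c_def d_def)
  ultimately show ?thesis
    by (simp add: b0_def[abs_def] has_real_derivative_iff_has_vector_derivative zero_ereal_def)
qed

lemma deriv_b0: "deriv (b0 M \<gamma>) = (\<lambda>y. 1 + 2 * sqrt pi * M * \<gamma> * exp (- (y\<^sup>2 / \<gamma>\<^sup>2)))"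
  by (intro ext DERIV_imp_deriv b0_derivative)

lemma deriv2_b0: "deriv (deriv (b0 M \<gamma>)) = B2"
proof
  fix y
  have "((\<lambda>y. 1 + 2 * sqrt pi * M * \<gamma> * exp (- (y\<^sup>2 / \<gamma>\<^sup>2))) has_real_derivative
     2 * sqrt pi * M * \<gamma> * (exp (- (y\<^sup>2 / \<gamma>\<^sup>2)) * - (2 * y / \<gamma>\<^sup>2))) (at y)"
  proof -
    have "((\<lambda>y. y\<^sup>2) has_real_derivative 2 * y) (at y)" by (auto intro!: derivative_eq_intros)
    from DERIV_fun_exp[OF DERIV_minus[OF DERIV_cdivide[OF this]]] show ?thesis
      by (rule DERIV_cong[OF DERIV_add[OF DERIV_const DERIV_cmult]]) simp
  qed
  then have "deriv (deriv (b0 M \<gamma>)) y = 2 * sqrt pi * M * \<gamma> * (exp (- (y\<^sup>2 / \<gamma>\<^sup>2)) * - (2 * y / \<gamma>\<^sup>2))"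
    unfolding deriv_b0 by (rule DERIV_imp_deriv)
  also have "\<dots> = B2 y"
    using \<gamma>_pos by (simp add: B2_def A_def power_divide power2_eq_square)
  finally show "deriv (deriv (b0 M \<gamma>)) y = B2 y" .
qed

lemma b0_0: "b0 M \<gamma> 0 = 0"
  by (simp add: b0_def flip: zero_ereal_def)

text \<open>The mean value theorem from the zero at the origin, with slopes between 1 and
  \<open>S\<close>. In the rescaled integrals the profile then enters through a factor
  \<open>t\<close> that tends to 1.\<close>

lemma b0_factor: "\<exists>t. 1 \<le> t \<and> t \<le> S \<and> b0 M \<gamma> y = t * y"
proof -
  have t: "1 \<le> 1 + 2 * sqrt pi * M * \<gamma> * exp (- (s\<^sup>2 / \<gamma>\<^sup>2))"
    "1 + 2 * sqrt pi * M * \<gamma> * exp (- (s\<^sup>2 / \<gamma>\<^sup>2)) \<le> S" for s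
  proof -
    show "1 \<le> 1 + 2 * sqrt pi * M * \<gamma> * exp (- (s\<^sup>2 / \<gamma>\<^sup>2))" using M_pos \<gamma>_pos by simp
    have "2 * sqrt pi * M * \<gamma> * exp (- (s\<^sup>2 / \<gamma>\<^sup>2)) \<le> 2 * sqrt pi * M * \<gamma> * 1"
      using M_pos \<gamma>_pos by (intro mult_left_mono) auto
    then show "1 + 2 * sqrt pi * M * \<gamma> * exp (- (s\<^sup>2 / \<gamma>\<^sup>2)) \<le> S" by (simp add: S_def)
  qed
  consider "y = 0" | "0 < y" | "y < 0" by linarith
  then show ?thesis
  proof cases
    case 1
    then show ?thesis using S_ge b0_0 by (intro exI[of _ 1]) simp
  next
    case 2
    obtain s where "b0 M \<gamma> y - b0 M \<gamma> 0 = (y - 0) * (1 + 2 * sqrt pi * M * \<gamma> * exp (- (s\<^sup>2 / \<gamma>\<^sup>2)))"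
      using MVT2[OF 2 b0_derivative] by blast
    then show ?thesis using t[of s] b0_0
      by (intro exI[of _ "1 + 2 * sqrt pi * M * \<gamma> * exp (- (s\<^sup>2 / \<gamma>\<^sup>2))"]) (simp add: mult.commute)
  next
    case 3
    obtain s where "b0 M \<gamma> 0 - b0 M \<gamma> y = (0 - y) * (1 + 2 * sqrt pi * M * \<gamma> * exp (- (s\<^sup>2 / \<gamma>\<^sup>2)))"
      using MVT2[OF 3 b0_derivative] by blast
    then show ?thesis using t[of s] b0_0
      by (intro exI[of _ "1 + 2 * sqrt pi * M * \<gamma> * exp (- (s\<^sup>2 / \<gamma>\<^sup>2))"]) (simp add: mult.commute)
  qed
qed

lemma b0_odd: "b0 M \<gamma> (- y) = - b0 M \<gamma> y"
proof -
  have "((\<lambda>y. b0 M \<gamma> (- y) + b0 M \<gamma> y) has_real_derivative 0) (at y)" for y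
  proof -
    have "((\<lambda>y. - y) has_real_derivative - 1) (at y)" by (auto intro!: derivative_eq_intros)
    from DERIV_add[OF DERIV_chain2[OF b0_derivative this] b0_derivative[of y]]
    show ?thesis by simp
  qed
  then have "b0 M \<gamma> (- y) + b0 M \<gamma> y = b0 M \<gamma> (- 0) + b0 M \<gamma> 0"
    by (intro DERIV_isconst_all[rule_format, of "\<lambda>y. b0 M \<gamma> (- y) + b0 M \<gamma> y"]) 
  then show ?thesis by (simp add: b0_0)
qed

lemma b0_continuous: "continuous_on X (b0 M \<gamma>)"
  using b0_derivative by (meson DERIV_isCont continuous_at_imp_continuous_on)

lemma abs_b0_ge: "\<bar>y\<bar> \<le> \<bar>b0 M \<gamma> y\<bar>"
proof -
  obtain t where "1 \<le> t" "b0 M \<gamma> y = t * y" using b0_factor by blast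
  then show ?thesis by (simp add: abs_mult mult_le_cancel_right1)
qed

lemma den_bounds: "\<bar>y\<bar> \<le> cmod (den m y)" "\<gamma> * \<bar>m\<bar> \<le> cmod (den m y)" "cmod (den m y) ^ 2 = (b0 M \<gamma> y)\<^sup>2 + (\<gamma> * m)\<^sup>2"
proof -
  have "\<bar>Re (den m y)\<bar> \<le> cmod (den m y)" "\<bar>Im (den m y)\<bar> \<le> cmod (den m y)"
    by (rule abs_Re_le_cmod, rule abs_Im_le_cmod)
  then show "\<bar>y\<bar> \<le> cmod (den m y)" "\<gamma> * \<bar>m\<bar> \<le> cmod (den m y)"
    using abs_b0_ge[of y] \<gamma>_pos by (simp_all add: den_def abs_mult)
  show "cmod (den m y) ^ 2 = (b0 M \<gamma> y)\<^sup>2 + (\<gamma> * m)\<^sup>2"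
    by (simp add: cmod_power2 den_def)
qed

lemma den_nonzero:
  assumes "m \<noteq> 0"
  shows "den m y \<noteq> 0"
proof -
  have "0 < \<gamma> * \<bar>m\<bar>" using assms \<gamma>_pos by (intro mult_pos_pos) auto
  then have "0 < cmod (den m y)" using den_bounds(2)[of m y] by linarith
  then show ?thesis by auto
qed

section \<open>The potential, its majorant and its dependence on m\<close>

lemma q_nonneg: "0 \<le> q y" using A_pos \<gamma>_pos by (simp add: q_def)

lemma abs_B2: "\<bar>B2 y\<bar> = \<bar>y\<bar> * q y"
  using A_pos \<gamma>_pos by (simp add: B2_def q_def abs_mult)

text \<open>The zero of b0'' at the origin compensates the smallness of b0 - c there: |den| >= |y|
  cancels the factor |y| in |b0''|. So one majorant serves all m.\<close>

lemma Q_bound: "cmod (Q m y) \<le> q y"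
proof (cases "y = 0")
  case True
  then show ?thesis using q_nonneg by (simp add: Q_def B2_def)
next
  case False
  then have "0 < cmod (den m y)" using den_bounds(1)[of y m] by linarith
  then have "cmod (Q m y) \<le> \<bar>y\<bar> * q y / \<bar>y\<bar>"
    unfolding Q_def norm_divide norm_of_real abs_B2
    using False q_nonneg by (intro divide_left_mono mult_nonneg_nonneg mult_pos_pos den_bounds(1)) auto
  then show ?thesis using False by simp
qed

lemma continuous_den: "continuous_on X (den m)"
  unfolding den_def[abs_def] by (intro continuous_intros b0_continuous)

lemma continuous_B2: "continuous_on X B2"
  unfolding B2_def[abs_def] using \<gamma>_pos by (intro continuous_intros) auto

lemma continuous_Q: "m \<noteq> 0 \<Longrightarrow> continuous_on X (Q m)"
  unfolding Q_def[abs_def] by (intro continuous_intros continuous_den continuous_B2 ballI den_nonzero)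

text \<open>The resolvent identity gives the factor \<open>\<gamma>\<close> |m - n| / |den|, and
  |den| >= \<open>\<gamma>\<close> for n >= 1, so \<open>\<gamma>\<close> cancels.\<close>

lemma Q_lipschitz:
  assumes "1 \<le> m" "1 \<le> n"
  shows "cmod (Q m y - Q n y) \<le> \<bar>m - n\<bar> * q y"
proof -
  have nz: "den m y \<noteq> 0" "den n y \<noteq> 0" using assms by (auto intro!: den_nonzero)
  have "Q m y - Q n y = Q m y * ((den n y - den m y) / den n y)"
    unfolding Q_def using nz by (simp add: field_simps)
  also have "den n y - den m y = \<i> * of_real (\<gamma> * (m - n))" by (simp add: den_def algebra_simps)
  also have "cmod (Q m y * (\<i> * of_real (\<gamma> * (m - n)) / den n y)) = cmod (Q m y) * (\<gamma> * \<bar>m - n\<bar> / cmod (den n y))"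
    using \<gamma>_pos by (simp add: norm_mult norm_divide abs_mult del: of_real_mult of_real_diff)
  also have "\<dots> \<le> q y * (\<gamma> * \<bar>m - n\<bar> / \<gamma>)"
  proof (intro mult_mono Q_bound divide_left_mono)
    have "\<gamma> * 1 \<le> \<gamma> * \<bar>n\<bar>" using assms \<gamma>_pos by (intro mult_left_mono) auto
    then show "\<gamma> \<le> cmod (den n y)" using den_bounds(2)[of n y] by simp
  qed (use \<gamma>_pos nz q_nonneg in auto)
  finally show ?thesis using \<gamma>_pos by (simp add: mult.commute)
qed

text \<open>b0 and b0'' are odd and c is purely imaginary, so reflection maps b0 - c to minus its
  conjugate.\<close>

lemma Q_symmetric: "Q m (- y) = cnj (Q m y)"
proof -
  have "den m (- y) = - cnj (den m y)" by (simp add: den_def b0_odd)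
  moreover have "B2 (- y) = - B2 y" by (simp add: B2_def)
  ultimately show ?thesis by (simp add: Q_def)
qed

text \<open>Substituting y = \<open>\<gamma>\<close> z shows the scaling of an approximate Dirac
  mass: the mass stays of order \<open>M\<close>, while the first moment gains a factor
  \<open>\<gamma>\<close>.\<close>

lemma q_integrals:
  "integrable lborel q" "(LBINT y. q y) = A * gauss_mass"
  "integrable lborel (\<lambda>y. \<bar>y\<bar> * q y)" "(LBINT y. \<bar>y\<bar> * q y) = A * \<gamma> * gauss_moment"
proof -
  show "integrable lborel q"
    unfolding q_def[abs_def] by (intro integrable_mult_right integrable_rescale[OF \<gamma>_pos gauss_integrable(1)])
  show "(LBINT y. q y) = A * gauss_mass"
    unfolding q_def integral_mult_right_zero integral_rescale[OF \<gamma>_pos gauss_integrable(1)]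
    using \<gamma>_pos by (simp add: gauss_mass_def)
  have eq: "\<bar>y\<bar> * q y = A * (\<bar>y / \<gamma>\<bar> * exp (- (y / \<gamma>)\<^sup>2))" for y
    using \<gamma>_pos by (simp add: q_def)
  show "integrable lborel (\<lambda>y. \<bar>y\<bar> * q y)"
    unfolding eq by (intro integrable_mult_right integrable_rescale[OF \<gamma>_pos gauss_integrable(2)])
  show "(LBINT y. \<bar>y\<bar> * q y) = A * \<gamma> * gauss_moment"
    unfolding eq integral_mult_right_zero integral_rescale[OF \<gamma>_pos gauss_integrable(2)]
    using \<gamma>_pos by (simp add: gauss_moment_def)
qed

lemma integrable_exp_q:
  assumes "0 < k"
  shows "integrable lborel (\<lambda>y. exp (k * \<bar>y\<bar>) * q y)"
proof (rule Bochner_Integration.integrable_bound)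
  let ?c = "A / \<gamma> * exp (((k + 1) * \<gamma> / 2)\<^sup>2)"
  show "integrable lborel (\<lambda>y. ?c * exp (- (1 * \<bar>y\<bar>)))"
    by (intro integrable_mult_right integrable_exp_minus_abs) simp
  show "(\<lambda>y. exp (k * \<bar>y\<bar>) * q y) \<in> borel_measurable lborel"
    unfolding q_def by measurable
  have le: "exp (k * \<bar>y\<bar>) * q y \<le> ?c * exp (- (1 * \<bar>y\<bar>))" for y
  proof -
    \<comment> \<open>The square is completed for the rate k + 1; the extra 1 leaves the integrable
      factor exp(-|y|).\<close>
    have "0 \<le> (\<bar>y\<bar> / \<gamma> - (k + 1) * \<gamma> / 2)\<^sup>2" by simp
    then have "(k + 1) * \<bar>y\<bar> \<le> (y / \<gamma>)\<^sup>2 + ((k + 1) * \<gamma> / 2)\<^sup>2"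
      using \<gamma>_pos by (simp add: power2_diff power_divide mult.commute)
    then have "k * \<bar>y\<bar> + - (y / \<gamma>)\<^sup>2 \<le> ((k + 1) * \<gamma> / 2)\<^sup>2 + - \<bar>y\<bar>"
      by (simp add: distrib_right)
    then have "exp (k * \<bar>y\<bar>) * exp (- (y / \<gamma>)\<^sup>2) \<le> exp (((k + 1) * \<gamma> / 2)\<^sup>2) * exp (- \<bar>y\<bar>)"
      unfolding exp_add[symmetric] exp_le_cancel_iff .
    then have "A / \<gamma> * (exp (k * \<bar>y\<bar>) * exp (- (y / \<gamma>)\<^sup>2)) \<le> A / \<gamma> * (exp (((k + 1) * \<gamma> / 2)\<^sup>2) * exp (- \<bar>y\<bar>))"
      using A_pos \<gamma>_pos by (intro mult_left_mono) auto
    then show ?thesis by (simp add: q_def mult_ac)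
  qed
  show "AE y in lborel. norm (exp (k * \<bar>y\<bar>) * q y) \<le> norm (?c * exp (- (1 * \<bar>y\<bar>)))"
  proof (rule AE_I2)
    fix y
    have nn: "0 \<le> exp (k * \<bar>y\<bar>) * q y" by (simp add: q_nonneg)
    show "norm (exp (k * \<bar>y\<bar>) * q y) \<le> norm (?c * exp (- (1 * \<bar>y\<bar>)))"
      unfolding real_norm_def abs_of_nonneg[OF nn] by (rule order_trans[OF le abs_ge_self])
  qed
qed

lemma Re_Q: "- Re (Q m y) = A / \<gamma> * (((b0 M \<gamma> y / \<gamma>) * (y / \<gamma>)) / ((b0 M \<gamma> y / \<gamma>)\<^sup>2 + m\<^sup>2) * exp (- (y / \<gamma>)\<^sup>2))"
proof -
  have "Re (Q m y) = B2 y * b0 M \<gamma> y / ((b0 M \<gamma> y)\<^sup>2 + (\<gamma> * m)\<^sup>2)"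
    unfolding Q_def den_def by (simp add: Re_divide power2_eq_square)
  also have "(b0 M \<gamma> y)\<^sup>2 + (\<gamma> * m)\<^sup>2 = \<gamma>\<^sup>2 * ((b0 M \<gamma> y / \<gamma>)\<^sup>2 + m\<^sup>2)"
    using \<gamma>_pos by (simp add: power_divide power_mult_distrib distrib_left)
  finally show ?thesis
    using \<gamma>_pos by (simp add: B2_def power2_eq_square)
qed

text \<open>With b0 = t y, replacing t by its extremes 1 and \<open>S\<close> in numerator and
  denominator squeezes the integrand between two multiples of its limit, and these meet as
  \<open>S\<close> tends to 1.\<close>

lemma integral_Re_Q:
  assumes m: "1 \<le> m"
  shows "A / S\<^sup>2 * dispersion m \<le> - Re (LBINT y. Q m y)" "- Re (LBINT y. Q m y) \<le> A * S * dispersion m"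
proof -
  let ?j = "\<lambda>z::real. z\<^sup>2 / (z\<^sup>2 + m\<^sup>2) * exp (- z\<^sup>2)"
  have Qi: "integrable lborel (Q m)"
    by (rule Bochner_Integration.integrable_bound[OF q_integrals(1)])
      (use m Q_bound q_nonneg in \<open>auto intro!: borel_measurable_continuous_onI continuous_Q AE_I2\<close>)
  have eq: "- Re (LBINT y. Q m y) = (LBINT y. - Re (Q m y))"
    using Qi by simp
  have i: "integrable lborel (\<lambda>y. - Re (Q m y))" using Qi by auto
  have j: "integrable lborel (\<lambda>y. c / \<gamma> * ?j (y / \<gamma>))" "(LBINT y. c / \<gamma> * ?j (y / \<gamma>)) = c * dispersion m" for c
  proof -
    show "integrable lborel (\<lambda>y. c / \<gamma> * ?j (y / \<gamma>))"
      by (rule integrable_mult_right[OF integrable_rescale[OF \<gamma>_pos gauss_integrable(4)]])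
    show "(LBINT y. c / \<gamma> * ?j (y / \<gamma>)) = c * dispersion m"
      unfolding integral_mult_right_zero integral_rescale[OF \<gamma>_pos gauss_integrable(4)] dispersion_def
      using \<gamma>_pos by simp
  qed
  have pt: "1 / S\<^sup>2 * (z\<^sup>2 / (z\<^sup>2 + m\<^sup>2)) \<le> (t * z * z) / ((t * z)\<^sup>2 + m\<^sup>2)"
    "(t * z * z) / ((t * z)\<^sup>2 + m\<^sup>2) \<le> S * (z\<^sup>2 / (z\<^sup>2 + m\<^sup>2))" if t: "1 \<le> t" "t \<le> S" for t z
  proof -
    have t2: "1 \<le> t\<^sup>2" "t\<^sup>2 \<le> S\<^sup>2" using t by (auto intro: one_le_power power_mono)
    have S2: "1 \<le> S\<^sup>2" using S_ge by (rule one_le_power)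
    have pos: "0 < z\<^sup>2 + m\<^sup>2" "0 < (t * z)\<^sup>2 + m\<^sup>2" using m by (auto intro!: add_nonneg_pos)
    have "z\<^sup>2 / (S\<^sup>2 * (z\<^sup>2 + m\<^sup>2)) \<le> (t * z\<^sup>2) / ((t * z)\<^sup>2 + m\<^sup>2)"
    proof (rule frac_le)
      show "z\<^sup>2 \<le> t * z\<^sup>2" using t by (simp add: mult_le_cancel_right1)
      have "t\<^sup>2 * z\<^sup>2 \<le> S\<^sup>2 * z\<^sup>2" using t2 by (intro mult_right_mono) auto
      moreover have "1 * m\<^sup>2 \<le> S\<^sup>2 * m\<^sup>2" using S2 by (intro mult_right_mono) auto
      ultimately show "(t * z)\<^sup>2 + m\<^sup>2 \<le> S\<^sup>2 * (z\<^sup>2 + m\<^sup>2)" by (simp add: power_mult_distrib distrib_left)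
    qed (use pos t in auto)
    then show "1 / S\<^sup>2 * (z\<^sup>2 / (z\<^sup>2 + m\<^sup>2)) \<le> (t * z * z) / ((t * z)\<^sup>2 + m\<^sup>2)"
      by (simp add: power2_eq_square mult.assoc)
    have "(t * z\<^sup>2) / ((t * z)\<^sup>2 + m\<^sup>2) \<le> (S * z\<^sup>2) / (z\<^sup>2 + m\<^sup>2)"
    proof (rule frac_le)
      show "t * z\<^sup>2 \<le> S * z\<^sup>2" using t by (intro mult_right_mono) auto
      have "1 * z\<^sup>2 \<le> t\<^sup>2 * z\<^sup>2" using t2 by (intro mult_right_mono) auto
      then show "z\<^sup>2 + m\<^sup>2 \<le> (t * z)\<^sup>2 + m\<^sup>2" by (simp add: power_mult_distrib)
    qed (use pos t S_ge in auto)
    then show "(t * z * z) / ((t * z)\<^sup>2 + m\<^sup>2) \<le> S * (z\<^sup>2 / (z\<^sup>2 + m\<^sup>2))"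
      by (simp add: power2_eq_square mult.assoc)
  qed
  have bounds: "A / S\<^sup>2 / \<gamma> * ?j (y / \<gamma>) \<le> - Re (Q m y)" "- Re (Q m y) \<le> A * S / \<gamma> * ?j (y / \<gamma>)" for y
  proof -
    obtain t where t: "1 \<le> t" "t \<le> S" "b0 M \<gamma> y = t * y" using b0_factor by blast
    have R: "- Re (Q m y) = A / \<gamma> * ((t * (y / \<gamma>) * (y / \<gamma>)) / ((t * (y / \<gamma>))\<^sup>2 + m\<^sup>2) * exp (- (y / \<gamma>)\<^sup>2))"
      unfolding Re_Q t(3) by simp
    have "A / \<gamma> * (1 / S\<^sup>2 * ((y / \<gamma>)\<^sup>2 / ((y / \<gamma>)\<^sup>2 + m\<^sup>2)) * exp (- (y / \<gamma>)\<^sup>2)) \<le> - Re (Q m y)"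
      unfolding R using A_pos \<gamma>_pos by (intro mult_left_mono mult_right_mono pt t) auto
    then show "A / S\<^sup>2 / \<gamma> * ?j (y / \<gamma>) \<le> - Re (Q m y)" by (simp add: mult_ac)
    have "- Re (Q m y) \<le> A / \<gamma> * (S * ((y / \<gamma>)\<^sup>2 / ((y / \<gamma>)\<^sup>2 + m\<^sup>2)) * exp (- (y / \<gamma>)\<^sup>2))"
      unfolding R using A_pos \<gamma>_pos by (intro mult_left_mono mult_right_mono pt t) auto
    then show "- Re (Q m y) \<le> A * S / \<gamma> * ?j (y / \<gamma>)" by (simp add: mult_ac)
  qed
  show "A / S\<^sup>2 * dispersion m \<le> - Re (LBINT y. Q m y)"
    unfolding eq j(2)[symmetric] by (rule integral_mono[OF j(1) i bounds(1)])
  show "- Re (LBINT y. Q m y) \<le> A * S * dispersion m"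
    unfolding eq j(2)[symmetric] by (rule integral_mono[OF i j(1) bounds(2)])
qed

lemma abs_B2_le: "\<bar>B2 y\<bar> \<le> A"
proof -
  have "1 + (y / \<gamma>)\<^sup>2 \<le> exp ((y / \<gamma>)\<^sup>2)" by (rule exp_ge_add_one_self)
  moreover have "2 * \<bar>y / \<gamma>\<bar> \<le> 1 + (y / \<gamma>)\<^sup>2"
    using sum_squares_bound[of 1 "\<bar>y / \<gamma>\<bar>"] by (simp only: power2_abs one_power2 mult_1_right)
  ultimately have "\<bar>y / \<gamma>\<bar> \<le> exp ((y / \<gamma>)\<^sup>2)" using abs_ge_zero[of "y / \<gamma>"] by linarith
  then have "\<bar>y / \<gamma>\<bar> * exp (- (y / \<gamma>)\<^sup>2) \<le> exp ((y / \<gamma>)\<^sup>2) * exp (- (y / \<gamma>)\<^sup>2)"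
    by (rule mult_right_mono) simp
  also have "\<dots> = 1" by (simp flip: exp_add)
  finally have "A * (\<bar>y / \<gamma>\<bar> * exp (- (y / \<gamma>)\<^sup>2)) \<le> A * 1"
    using A_pos by (intro mult_left_mono) auto
  then show ?thesis using A_pos \<gamma>_pos by (simp add: B2_def abs_mult)
qed

section \<open>Smoothness of the profile and of the potential\<close>

lemma cdiff_b0: "cdiff n (\<lambda>y. complex_of_real (b0 M \<gamma> y))"
proof (cases n)
  case 0
  then show ?thesis by (auto intro!: continuous_intros b0_continuous)
next
  case (Suc m)
  have "((\<lambda>y. complex_of_real (b0 M \<gamma> y)) has_vector_derivative
      complex_of_real 1 + complex_of_real (2 * sqrt pi * M * \<gamma>) * complex_of_real (exp (- 1 / \<gamma>\<^sup>2 * y\<^sup>2))) (at y)" for y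
    using has_vector_derivative_of_real[OF b0_derivative[of y], where 'a = complex] by simp
  then show ?thesis
    unfolding Suc by (rule cdiff_SucI) (intro cdiff_add cdiff_mult cdiff_const cdiff_gaussian)
qed

lemma cdiff_B2: "cdiff n (\<lambda>y. complex_of_real (B2 y))"
proof -
  have "(\<lambda>y. complex_of_real (B2 y)) = (\<lambda>y. complex_of_real (- A / \<gamma>) * complex_of_real y * complex_of_real (exp (- 1 / \<gamma>\<^sup>2 * y\<^sup>2)))"
    by (simp add: B2_def power_divide fun_eq_iff)
  then show ?thesis by (simp only:) (intro cdiff_mult cdiff_const cdiff_of_real cdiff_gaussian)
qed

lemma cdiff_inverse_den: "m \<noteq> 0 \<Longrightarrow> cdiff n (\<lambda>y. inverse (den m y))"
  unfolding den_def[abs_def] diff_conv_add_uminus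
  by (intro cdiff_inverse cdiff_add cdiff_b0 cdiff_const) (use den_nonzero in \<open>simp add: den_def\<close>)

lemma cdiff_Q: "m \<noteq> 0 \<Longrightarrow> cdiff n (Q m)"
  unfolding Q_def[abs_def] divide_inverse by (intro cdiff_mult cdiff_B2 cdiff_inverse_den)

text \<open>b0'' and the imaginary part of the squared conjugate of \<open>den\<close> are odd with
  opposite signs, so their product has one sign and the integral suffers no cancellation. The
  constant 1/8 is 2 t m / 16 at t = m = 1, where 16 comes from squaring the bound 4 (1 + z^2) for
  \<open>N\<close>.\<close>

lemma Im_Q_den:
  assumes m: "1 \<le> m" "m \<le> 2" and S: "S \<le> 2"
  shows "A / 8 / \<gamma>\<^sup>2 * ((y / \<gamma>)\<^sup>2 / (1 + (y / \<gamma>)\<^sup>2)\<^sup>2 * exp (- (y / \<gamma>)\<^sup>2)) \<le> - Im (Q m y / den m y)"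
proof -
  obtain t where t: "1 \<le> t" "t \<le> S" "b0 M \<gamma> y = t * y" using b0_factor by blast
  define z where "z = y / \<gamma>"
  have y: "y = \<gamma> * z" using \<gamma>_pos by (simp add: z_def)
  define N where "N = (t * z)\<^sup>2 + m\<^sup>2"
  have N_pos: "0 < N" using m unfolding N_def by (intro add_nonneg_pos) auto
  have norm: "(cmod (den m y))\<^sup>2 = \<gamma>\<^sup>2 * N"
    unfolding den_bounds(3) t(3) N_def unfolding y by (simp add: power_mult_distrib algebra_simps)
  have nz: "den m y \<noteq> 0" using m by (intro den_nonzero) simp
  have prod: "den m y * cnj (den m y) = of_real (\<gamma>\<^sup>2 * N)"
    unfolding norm[symmetric] complex_norm_square ..
  have "b / D / D = b * E\<^sup>2 / (D * E)\<^sup>2" if "D \<noteq> 0" "E \<noteq> 0" for b D E :: complex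
    using that by (simp add: power2_eq_square)
  from this[OF nz, of "cnj (den m y)"] nz
  have "Q m y / den m y = of_real (B2 y) * (cnj (den m y))\<^sup>2 / (of_real (\<gamma>\<^sup>2 * N))\<^sup>2"
    unfolding Q_def prod by simp
  also have "\<dots> = of_real (B2 y / (\<gamma>\<^sup>2 * N)\<^sup>2) * (cnj (den m y))\<^sup>2" by simp
  finally have "Im (Q m y / den m y) = B2 y / (\<gamma>\<^sup>2 * N)\<^sup>2 * Im ((cnj (den m y))\<^sup>2)"
    by (simp only: Im_complex_of_real Re_complex_of_real times_complex.simps mult_zero_left add_0_right)
  also have "Im ((cnj (den m y))\<^sup>2) = 2 * (t * \<gamma> * z) * (\<gamma> * m)"
    unfolding den_def t(3) unfolding y by (simp add: power2_eq_square)
  finally have Im: "- Im (Q m y / den m y) = A / \<gamma>\<^sup>2 * (2 * t * m * (z\<^sup>2 / N\<^sup>2)) * exp (- z\<^sup>2)"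
    using \<gamma>_pos N_pos unfolding B2_def z_def[symmetric] by (simp add: power2_eq_square mult_ac)
  have "1 / 8 * (z\<^sup>2 / (1 + z\<^sup>2)\<^sup>2) \<le> 2 * t * m * (z\<^sup>2 / N\<^sup>2)"
  proof -
    have "t\<^sup>2 \<le> 2\<^sup>2" using t S by (intro power_mono) auto
    then have "t\<^sup>2 * z\<^sup>2 \<le> 4 * z\<^sup>2" by (intro mult_right_mono) auto
    moreover have "m\<^sup>2 \<le> 2\<^sup>2" using m by (intro power_mono) auto
    ultimately have "N \<le> 4 * (1 + z\<^sup>2)" unfolding N_def by (simp add: power_mult_distrib)
    then have "N\<^sup>2 \<le> (4 * (1 + z\<^sup>2))\<^sup>2" using N_pos by (intro power_mono) auto
    then have "z\<^sup>2 / (4 * (1 + z\<^sup>2))\<^sup>2 \<le> z\<^sup>2 / N\<^sup>2"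
      using N_pos by (intro frac_le) auto
    moreover have "1 * 1 \<le> t * m" using t m by (intro mult_mono) auto
    ultimately have "2 * 1 * (z\<^sup>2 / (4 * (1 + z\<^sup>2))\<^sup>2) \<le> 2 * (t * m) * (z\<^sup>2 / N\<^sup>2)"
      by (intro mult_mono) auto
    moreover have "2 * 1 * (a / (4 * b)\<^sup>2) = 1 / 8 * (a / b\<^sup>2)" for a b :: real
      by (simp add: power_mult_distrib)
    ultimately show ?thesis by (simp only: mult.assoc)
  qed
  then have "A / \<gamma>\<^sup>2 * (1 / 8 * (z\<^sup>2 / (1 + z\<^sup>2)\<^sup>2)) * exp (- z\<^sup>2) \<le> - Im (Q m y / den m y)"
    unfolding Im using A_pos by (intro mult_right_mono mult_left_mono) auto
  then show ?thesis unfolding z_def[symmetric] by (simp add: mult_ac)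
qed

text \<open>\<open>lo\<close> and \<open>hi\<close> place the root m in [1, 2]; \<open>ang\<close>
  makes the error of replacing \<open>\<phi>\<close> by 1 in the pairing at most half of the main
  term. In the last bound 64 = 16 * 4: the pairing is at least 2 pi \<open>A * overlap\<close> / (16
  \<open>\<gamma>\<close>), the product of the norms at most 2 pi times 4
  \<open>A * sqrt (gauss_mass * lorentz_mass)\<close> / \<open>\<gamma>\<close>, and the factor
  \<open>A / \<gamma>\<close> cancels.\<close>

lemma instability:
  fixes k :: int
  assumes k: "0 < k" and small: "A * \<gamma> * gauss_moment \<le> 1 / 2" and S2: "S \<le> 2"
    and lo: "2 * real_of_int k + A * \<gamma> * gauss_moment * (3 * real_of_int k + 2 * (A * gauss_mass)) \<le> A / S\<^sup>2 * dispersion 1"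
    and hi: "A * S * dispersion 2 \<le> 2 * real_of_int k - A * \<gamma> * gauss_moment * (3 * real_of_int k + 2 * (A * gauss_mass))"
    and ang: "3 * (A * \<gamma> * gauss_moment) * (real_of_int k + 2 * (A * gauss_mass)) \<le> A * overlap / 16"
  obtains m \<omega> f where "1 \<le> m" "m \<le> 2" "\<omega> \<in> L2" "f \<in> L2"
    "\<And>a. rayleigh M \<gamma> (\<lambda>z. a * \<omega> z) (\<lambda>z. a * of_real (- (real_of_int k * \<gamma> * m)) * \<omega> z)"
    "\<And>U h. rayleigh M \<gamma> U h \<Longrightarrow> pairing h f = of_real (- (real_of_int k * \<gamma> * m)) * pairing U f"
    "0 < cmod (pairing \<omega> f)"
    "overlap / (64 * sqrt (gauss_mass * lorentz_mass)) * (L2_norm \<omega> * L2_norm f) \<le> cmod (pairing \<omega> f)"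
proof -
  let ?k = "real_of_int k"
  let ?e = "\<lambda>y. exp (- (?k * \<bar>y\<bar>))"
  define \<delta> where "\<delta> = A * \<gamma> * gauss_moment"
  have kr: "0 < ?k" using k by simp
  interpret short_range "?k" \<delta> q
    by unfold_locales (use kr q_integrals small q_nonneg in \<open>auto simp: \<delta>_def\<close>)
  have pot: "potential (Q m)" if "m \<in> {1..2}" for m
    unfolding potential_def using that continuous_Q[of m UNIV] Q_bound by auto
  have bs: "\<exists>m\<in>{1..2}. \<exists>\<phi>. continuous_on UNIV \<phi> \<and> (\<forall>y. cmod (\<phi> y) \<le> 2) \<and>
    (\<forall>y. cmod (\<phi> y - 1) \<le> ?k * \<bar>y\<bar> + 2 * \<delta>) \<and>
    (\<forall>y. \<phi> y = - (LBINT s. complex_of_real (exp (- (?k * \<bar>y - s\<bar>))) * Q m s * \<phi> s) / complex_of_real (2 * ?k))"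
  proof (rule bound_state[OF pot])
    show "2 * ?k + \<delta> * (3 * ?k + 2 * (LBINT s. q s)) \<le> - Re (LBINT s. Q 1 s)"
      using integral_Re_Q(1)[of 1] lo unfolding q_integrals(2) \<delta>_def by linarith
    show "- Re (LBINT s. Q 2 s) \<le> 2 * ?k - \<delta> * (3 * ?k + 2 * (LBINT s. q s))"
      using integral_Re_Q(2)[of 2] hi unfolding q_integrals(2) \<delta>_def by linarith
  qed (auto intro: Q_lipschitz Q_symmetric)
  then obtain m \<phi> where mem: "m \<in> {1..2}" and \<phi>c: "continuous_on UNIV \<phi>"
    and \<phi>2: "\<forall>y. cmod (\<phi> y) \<le> 2" and \<phi>1: "\<forall>y. cmod (\<phi> y - 1) \<le> ?k * \<bar>y\<bar> + 2 * \<delta>"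
    and \<phi>_eq: "\<forall>y. \<phi> y = - (LBINT s. complex_of_real (exp (- (?k * \<bar>y - s\<bar>))) * Q m s * \<phi> s) / complex_of_real (2 * ?k)"
    by (elim bexE exE conjE)
  have m: "1 \<le> m" "m \<le> 2" using mem by simp_all
  note \<phi>2 = spec[OF \<phi>2] and \<phi>1 = spec[OF \<phi>1] and \<phi>_eq = spec[OF \<phi>_eq, unfolded mult.assoc]
  have m0: "m \<noteq> 0" using m by simp
  define w where "w = (\<lambda>y. Q m y * \<phi> y)"
  define g where "g = (\<lambda>y. \<phi> y * inverse (den m y))"
  define c where "c = \<i> * complex_of_real (\<gamma> * m)"
  have Qc: "continuous_on UNIV (Q m)" by (rule continuous_Q[OF m0])
  have wc: "continuous_on UNIV w" unfolding w_def by (intro continuous_intros Qc \<phi>c)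
  have w_le: "cmod (w y) \<le> q y * 2" for y
    unfolding w_def norm_mult using Q_bound \<phi>2 q_nonneg by (intro mult_mono) auto
  have w_int: "integrable lborel (\<lambda>s. exp (?k * \<bar>s\<bar>) * cmod (w s))"
  proof (rule Bochner_Integration.integrable_bound)
    show "integrable lborel (\<lambda>s. 2 * (exp (?k * \<bar>s\<bar>) * q s))" by (intro integrable_mult_right integrable_exp_q kr)
    show "(\<lambda>s. exp (?k * \<bar>s\<bar>) * cmod (w s)) \<in> borel_measurable lborel"
      using borel_measurable_continuous_onI[OF wc] by measurable
    have "exp (?k * \<bar>s\<bar>) * cmod (w s) \<le> exp (?k * \<bar>s\<bar>) * (q s * 2)" for s
      by (intro mult_left_mono w_le) simp
    then show "AE s in lborel. norm (exp (?k * \<bar>s\<bar>) * cmod (w s)) \<le> norm (2 * (exp (?k * \<bar>s\<bar>) * q s))"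
      using q_nonneg by (auto intro!: AE_I2 simp: abs_mult mult_ac)
  qed
  have \<phi>_w: "\<phi> y = - (LBINT s. complex_of_real (exp (- (?k * \<bar>y - s\<bar>))) * w s) / complex_of_real (2 * ?k)" for y
    unfolding w_def by (rule \<phi>_eq)
  obtain \<phi>' C where \<phi>d: "\<And>y. (\<phi> has_vector_derivative \<phi>' y) (at y)"
      "\<And>y. (\<phi>' has_vector_derivative of_real ((?k)\<^sup>2) * \<phi> y + w y) (at y)"
    and dec: "\<And>y. cmod (\<phi> y) \<le> C * ?e y" "\<And>y. cmod (\<phi>' y) \<le> C * ?e y"
    using screened_poisson[OF kr wc w_int \<phi>_w] by metis
  have C: "0 \<le> C" using order_trans[OF norm_ge_zero dec(1)[of 0]] by simp
  have \<phi>dd: "(\<phi>' has_vector_derivative of_int k ^ 2 * \<phi> y + w y) (at y)" for y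
    using \<phi>d(2)[of y] by simp
  \<comment> \<open>The equation for the second derivative of \<open>\<phi>\<close> has smooth
    coefficients and gains two derivatives, so two rounds lead from continuity to C^4.\<close>
  have up: "cdiff (Suc (Suc n)) \<phi>" if "cdiff n \<phi>" for n
    by (rule cdiff_SucI[OF \<phi>d(1)], rule cdiff_SucI[OF \<phi>dd])
      (unfold w_def, intro cdiff_add cdiff_mult cdiff_const cdiff_Q m0 that)
  have \<phi>_cdiff: "cdiff 2 \<phi>" "cdiff 4 \<phi>"
    using up[of 0] up[OF up[of 0]] \<phi>c by (simp_all add: numeral_eq_Suc del: cdiff.simps(2))
  have g2: "cdiff 2 g" unfolding g_def by (intro cdiff_mult \<phi>_cdiff cdiff_inverse_den m0)
  have gc: "continuous_on UNIV g" by (rule cdiff_continuous[OF g2])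
  have nz: "den m y \<noteq> 0" for y by (rule den_nonzero[OF m0])
  have w_g: "of_real (B2 y) * g y = w y" for y by (simp add: w_def g_def Q_def divide_inverse mult_ac)
  have den_g: "(of_real (b0 M \<gamma> y) - c) * g y = \<phi> y" for y
    using nz[of y] unfolding g_def den_def c_def[symmetric] by simp
  \<comment> \<open>b0 is unbounded; the relation (b0 - c) g = \<open>\<phi>\<close> trades b0 g for
    decaying terms.\<close>
  have b0_g: "of_real (b0 M \<gamma> y) * g y = \<phi> y + c * g y" for y
    using den_g[of y] by (simp add: algebra_simps)
  have cden: "\<gamma> \<le> cmod (den m y)" for y
  proof -
    have "\<gamma> * 1 \<le> \<gamma> * \<bar>m\<bar>" using m \<gamma>_pos by (intro mult_left_mono) auto
    then show ?thesis using den_bounds(2)[of m y] by simp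
  qed
  \<comment> \<open>One majorant for all five functions: 3 covers \<open>\<phi>\<close>, its
    derivative and b0 g (by |c| <= 2 \<open>\<gamma>\<close>), 1 / \<open>\<gamma>\<close> covers g,
    and \<open>A / \<gamma>\<close> covers w because it bounds \<open>q\<close>.\<close>
  define d where "d = (\<lambda>y. C * (3 + 1 / \<gamma> + A / \<gamma>) * ?e y)"
  have dc: "continuous_on UNIV d" unfolding d_def by (intro continuous_intros)
  have d2: "integrable lborel (\<lambda>y. (d y)\<^sup>2)"
  proof -
    have "(d y)\<^sup>2 = (C * (3 + 1 / \<gamma> + A / \<gamma>))\<^sup>2 * exp (- (2 * ?k * \<bar>y\<bar>))" for y
      unfolding d_def power_mult_distrib by (simp add: power2_eq_square flip: exp_add)
    then show ?thesis using kr by (auto intro!: integrable_mult_right integrable_exp_minus_abs)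
  qed
  have sub: "r * (C * ?e y) \<le> d y" if "r \<le> 3 + 1 / \<gamma> + A / \<gamma>" for r y
    unfolding d_def using mult_right_mono[OF that, of "C * ?e y"] C by (simp add: mult_ac)
  have pos: "0 \<le> 1 / \<gamma>" "0 \<le> A / \<gamma>" using \<gamma>_pos A_pos by auto
  have g_le: "cmod (g y) \<le> 1 / \<gamma> * (C * ?e y)" for y
  proof -
    have "cmod (g y) = cmod (\<phi> y) / cmod (den m y)" by (simp add: g_def norm_mult norm_inverse divide_inverse)
    also have "\<dots> \<le> (C * ?e y) / \<gamma>" using cden \<gamma>_pos dec C by (intro frac_le) auto
    finally show ?thesis by simp
  qed
  have le: "cmod (\<phi> y) \<le> d y" "cmod (\<phi>' y) \<le> d y" "cmod (g y) \<le> d y"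
    "cmod (of_real (b0 M \<gamma> y) * g y) \<le> d y" "cmod (w y) \<le> d y" for y
  proof -
    show "cmod (\<phi> y) \<le> d y" "cmod (\<phi>' y) \<le> d y"
      using dec(1)[of y] dec(2)[of y] sub[of 1 y] pos by linarith+
    show "cmod (g y) \<le> d y" by (rule order_trans[OF g_le sub]) (use pos in simp)
    have "cmod c * cmod (g y) \<le> (\<gamma> * 2) * (1 / \<gamma> * (C * ?e y))"
      using m \<gamma>_pos by (intro mult_mono g_le) (auto simp: c_def norm_mult)
    then have "cmod (\<phi> y) + cmod (c * g y) \<le> 3 * (C * ?e y)"
      using dec(1)[of y] \<gamma>_pos by (simp add: norm_mult)
    then show "cmod (of_real (b0 M \<gamma> y) * g y) \<le> d y"
      unfolding b0_g using norm_triangle_ineq[of "\<phi> y" "c * g y"] sub[of 3 y] pos by linarith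
    have "q y \<le> A / \<gamma>" using A_pos \<gamma>_pos by (simp add: q_def mult_le_cancel_left1 divide_right_mono)
    then have "cmod (Q m y) \<le> A / \<gamma>" using Q_bound order_trans by blast
    then have "cmod (w y) \<le> A / \<gamma> * (C * ?e y)"
      unfolding w_def norm_mult using dec(1) pos by (intro mult_mono) auto
    then show "cmod (w y) \<le> d y" using sub[of "A / \<gamma>" y] pos by linarith
  qed
  have b0_w: "cmod (of_real (b0 M \<gamma> y) * w y) \<le> A * d y" for y
  proof -
    have "of_real (b0 M \<gamma> y) * w y = of_real (B2 y) * (of_real (b0 M \<gamma> y) * g y)"
      unfolding w_g[symmetric] by (simp only: mult.left_commute)
    moreover have "cmod (of_real (B2 y)) \<le> A" using abs_B2_le by simp
    ultimately show ?thesis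
      using le(4)[of y] A_pos by (simp only: norm_mult[of "of_real (B2 y)"]) (intro mult_mono; simp)
  qed
  have dL2: "integrable lborel (\<lambda>y. (cmod (a y))\<^sup>2)" if "continuous_on UNIV a" "\<And>y. cmod (a y) \<le> r * d y" for a r
    by (rule mode_L2_dominated(1)[OF that(1) _ _ that(2)])
      (use d2 in \<open>auto intro!: continuous_intros dc simp: power_mult_distrib\<close>)
  have b0wc: "continuous_on UNIV (\<lambda>y. of_real (b0 M \<gamma> y) * w y)" by (intro continuous_intros b0_continuous wc)
  have ints: "integrable lborel (\<lambda>y. (cmod (\<phi> y))\<^sup>2)" "integrable lborel (\<lambda>y. (cmod (w y))\<^sup>2)"
    "integrable lborel (\<lambda>y. (cmod (g y))\<^sup>2)" "integrable lborel (\<lambda>y. (cmod (of_real (b0 M \<gamma> y) * w y))\<^sup>2)"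
    using dL2[OF \<phi>c, of 1] dL2[OF wc, of 1] dL2[OF gc, of 1] dL2[OF b0wc b0_w] le by simp_all
  define \<omega> where "\<omega> = mode k w"
  define f where "f = mode (- k) g"
  have L2: "\<omega> \<in> L2" "f \<in> L2" unfolding \<omega>_def f_def by (rule mode_L2; fact wc gc ints)+
  have l: "\<i> * of_int k * c = of_real (- (?k * \<gamma> * m))"
    by (simp add: c_def mult_ac)
  have eigen: "rayleigh M \<gamma> (\<lambda>z. a * \<omega> z) (\<lambda>z. a * of_real (- (?k * \<gamma> * m)) * \<omega> z)" for a
  proof -
    have "rayleigh M \<gamma> (mode k (\<lambda>y. a * w y)) (\<lambda>z. \<i> * of_int k * c * mode k (\<lambda>y. a * w y) z)"
    proof (rule rayleigh_mode[where \<phi> = "\<lambda>y. a * \<phi> y" and \<phi>' = "\<lambda>y. a * \<phi>' y"])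
      show "((\<lambda>y. a * \<phi> y) has_vector_derivative a * \<phi>' y) (at y)" for y
        by (rule has_vector_derivative_mult_right[OF \<phi>d(1)])
      show "((\<lambda>y. a * \<phi>' y) has_vector_derivative of_int k ^ 2 * (a * \<phi> y) + a * w y) (at y)" for y
        by (rule has_vector_derivative_eq_rhs[OF has_vector_derivative_mult_right[OF \<phi>dd]]) (simp add: distrib_left mult_ac)
      show "(of_real (b0 M \<gamma> y) - c) * (a * w y) = of_real (deriv (deriv (b0 M \<gamma>)) y) * (a * \<phi> y)" for y
        unfolding deriv2_b0 w_g[symmetric] den_g[symmetric] by (simp only: mult_ac)
      show "integrable lborel (\<lambda>y. (cmod (of_real (b0 M \<gamma> y) * (a * w y)))\<^sup>2)"
        using integrable_mult_right[OF ints(4), of "(cmod a)\<^sup>2"] by (simp add: norm_mult power_mult_distrib mult_ac)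
    qed (use ints in \<open>auto intro!: continuous_intros wc b0_continuous simp: norm_mult power_mult_distrib\<close>)
    then show ?thesis
      unfolding mode_cmult[symmetric, abs_def] \<omega>_def[symmetric] l by (simp only: mult.left_commute mult.assoc)
  qed
  have adj: "pairing h f = of_real (- (?k * \<gamma> * m)) * pairing U f" if "rayleigh M \<gamma> U h" for U h
    unfolding l[symmetric] f_def
  proof (rule adjoint_eigenfunction[OF that _ _ \<phi>_cdiff(2) g2 \<phi>d(1) _ den_g dc d2 le(1-4)])
    show "(\<phi>' has_vector_derivative of_int k ^ 2 * \<phi> y + of_real (deriv (deriv (b0 M \<gamma>)) y) * g y) (at y)" for y
      unfolding deriv2_b0 w_g by (rule \<phi>dd)
    show "cmod (of_real (deriv (deriv (b0 M \<gamma>)) y) * g y) \<le> d y" for y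
      unfolding deriv2_b0 w_g by (rule le(5))
  qed (simp_all add: deriv2_b0 b0_continuous continuous_B2)
  have wg_int: "integrable lborel (\<lambda>y. w y * g y)"
  proof (rule Bochner_Integration.integrable_bound[OF d2])
    show "(\<lambda>y. w y * g y) \<in> borel_measurable lborel"
      using borel_measurable_continuous_onI[OF continuous_on_mult[OF wc gc]] by simp
    have "cmod (w y * g y) \<le> d y * d y" for y
      unfolding norm_mult using le(3,5) order_trans[OF norm_ge_zero le(1)] by (intro mult_mono) auto
    then show "AE y in lborel. cmod (w y * g y) \<le> norm ((d y)\<^sup>2)"
      by (auto simp: power2_eq_square)
  qed
  have pair: "pairing \<omega> f = 2 * pi * (LBINT y. w y * g y)"
    unfolding \<omega>_def f_def by (rule pairing_mode[OF wg_int])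
  \<comment> \<open>The density w g of the pairing is \<open>P\<close> times the square of
    \<open>\<phi>\<close>. Setting \<open>\<phi>\<close> = 1 gives the leading term, since
    \<open>P\<close> concentrates on the scale \<open>\<gamma>\<close>, where \<open>\<phi>\<close>
    is close to 1.\<close>
  define P where "P = (\<lambda>y. Q m y / den m y)"
  have P_le: "cmod (P y) \<le> q y / \<gamma>" for y
    unfolding P_def norm_divide using Q_bound cden \<gamma>_pos q_nonneg by (intro frac_le) auto
  have Pc: "continuous_on UNIV P"
    unfolding P_def by (intro continuous_intros Qc continuous_den ballI nz)
  have P_int: "integrable lborel P"
    by (rule Bochner_Integration.integrable_bound[where f = "\<lambda>y. q y / \<gamma>"])
      (use q_integrals(1) P_le borel_measurable_continuous_onI[OF Pc] q_nonneg \<gamma>_pos in \<open>auto intro!: AE_I2\<close>)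
  have wg_P: "w y * g y = P y + P y * ((\<phi> y)\<^sup>2 - 1)" for y
    by (simp add: w_def g_def P_def divide_inverse power2_eq_square algebra_simps)
  have main: "A * overlap / (8 * \<gamma>) \<le> cmod (LBINT y. P y)"
  proof -
    let ?j = "\<lambda>z::real. z\<^sup>2 / (1 + z\<^sup>2)\<^sup>2 * exp (- z\<^sup>2)"
    have "A * overlap / (8 * \<gamma>) = (LBINT y. A / 8 / \<gamma>\<^sup>2 * ?j (y / \<gamma>))"
      unfolding integral_mult_right_zero integral_rescale[OF \<gamma>_pos gauss_integrable(3)] overlap_def
      using \<gamma>_pos by (simp add: power2_eq_square)
    also have "\<dots> \<le> (LBINT y. - Im (P y))"
    proof (rule integral_mono)
      show "integrable lborel (\<lambda>y. A / 8 / \<gamma>\<^sup>2 * ?j (y / \<gamma>))"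
        by (rule integrable_mult_right[OF integrable_rescale[OF \<gamma>_pos gauss_integrable(3)]])
      show "integrable lborel (\<lambda>y. - Im (P y))" using P_int by auto
      show "A / 8 / \<gamma>\<^sup>2 * ?j (y / \<gamma>) \<le> - Im (P y)" for y
        unfolding P_def by (rule Im_Q_den[OF m S2])
    qed
    also have "\<dots> = - Im (LBINT y. P y)" using P_int by simp
    also have "\<dots> \<le> cmod (LBINT y. P y)"
      using abs_Im_le_cmod[of "LBINT y. P y"] by linarith
    finally show ?thesis .
  qed
  have err_int: "integrable lborel (\<lambda>y. P y * ((\<phi> y)\<^sup>2 - 1))"
    using Bochner_Integration.integrable_diff[OF wg_int P_int] unfolding wg_P by simp
  have err: "cmod (LBINT y. P y * ((\<phi> y)\<^sup>2 - 1)) \<le> A * overlap / (16 * \<gamma>)"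
  proof -
    have "cmod (LBINT y. P y * ((\<phi> y)\<^sup>2 - 1)) \<le> (LBINT y. 3 / \<gamma> * (?k * (\<bar>y\<bar> * q y) + 2 * \<delta> * q y))"
    proof (rule order_trans[OF integral_norm_bound integral_mono])
      show "integrable lborel (\<lambda>y. 3 / \<gamma> * (?k * (\<bar>y\<bar> * q y) + 2 * \<delta> * q y))"
        using q_integrals(1,3) by (intro integrable_mult_right Bochner_Integration.integrable_add) auto
      show "norm (P y * ((\<phi> y)\<^sup>2 - 1)) \<le> 3 / \<gamma> * (?k * (\<bar>y\<bar> * q y) + 2 * \<delta> * q y)" for y
      proof -
        \<comment> \<open>The square of \<open>\<phi>\<close> minus 1 splits into the small factor
          \<open>\<phi>\<close> - 1 and this bounded one.\<close>
        have "cmod (\<phi> y + 1) \<le> 3" using norm_triangle_ineq[of "\<phi> y" 1] \<phi>2[of y] by simp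
        then have le: "cmod (P y) * (cmod (\<phi> y - 1) * cmod (\<phi> y + 1)) \<le> q y / \<gamma> * ((?k * \<bar>y\<bar> + 2 * \<delta>) * 3)"
          using P_le \<phi>1 order_trans[OF norm_ge_zero \<phi>1[of y]] q_nonneg \<gamma>_pos by (intro mult_mono) auto
        have "(\<phi> y)\<^sup>2 - 1 = (\<phi> y - 1) * (\<phi> y + 1)"
          by (simp add: power2_eq_square algebra_simps)
        then have "norm (P y * ((\<phi> y)\<^sup>2 - 1)) = cmod (P y) * (cmod (\<phi> y - 1) * cmod (\<phi> y + 1))"
          by (simp only: norm_mult)
        also note le
        also have "q y / \<gamma> * ((?k * \<bar>y\<bar> + 2 * \<delta>) * 3) = 3 / \<gamma> * (?k * (\<bar>y\<bar> * q y) + 2 * \<delta> * q y)"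
          by (simp add: algebra_simps add_divide_distrib)
        finally show ?thesis .
      qed
    qed (use err_int in auto)
    also have "\<dots> = 3 / \<gamma> * (?k * \<delta> + 2 * \<delta> * (A * gauss_mass))"
      using q_integrals by (simp add: \<delta>_def)
    also have "\<dots> = 3 * \<delta> * (?k + 2 * (A * gauss_mass)) / \<gamma>" by (simp add: algebra_simps add_divide_distrib)
    also have "\<dots> \<le> A * overlap / 16 / \<gamma>" using ang \<gamma>_pos unfolding \<delta>_def by (intro divide_right_mono) auto
    finally show ?thesis by simp
  qed
  have wg_ge: "A * overlap / (16 * \<gamma>) \<le> cmod (LBINT y. w y * g y)"
  proof -
    have "(LBINT y. w y * g y) = (LBINT y. P y) + (LBINT y. P y * ((\<phi> y)\<^sup>2 - 1))"
      unfolding wg_P by (rule Bochner_Integration.integral_add[OF P_int err_int])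
    moreover have "A * overlap / (8 * \<gamma>) = A * overlap / (16 * \<gamma>) + A * overlap / (16 * \<gamma>)" by simp
    ultimately show ?thesis
      using main err norm_triangle_sub[of "LBINT y. P y" "- (LBINT y. P y * ((\<phi> y)\<^sup>2 - 1))"] by simp
  qed
  \<comment> \<open>One factor \<open>q\<close> is bounded by its maximum
    \<open>A / \<gamma>\<close> and the other is integrated, so the squared norm is of order A^2 /
    \<open>\<gamma>\<close>.\<close>
  have W: "(LBINT y. (cmod (w y))\<^sup>2) \<le> 4 * A\<^sup>2 * gauss_mass / \<gamma>"
  proof -
    have "(LBINT y. (cmod (w y))\<^sup>2) \<le> (LBINT y. 4 * (A / \<gamma>) * q y)"
    proof (rule integral_mono[OF ints(2)])
      show "integrable lborel (\<lambda>y. 4 * (A / \<gamma>) * q y)" using q_integrals(1) by simp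
      show "(cmod (w y))\<^sup>2 \<le> 4 * (A / \<gamma>) * q y" for y
      proof -
        have "(cmod (w y))\<^sup>2 \<le> (q y * 2)\<^sup>2" by (intro power_mono w_le) simp
        also have "\<dots> = 4 * q y * q y" by (simp add: power2_eq_square)
        also have "\<dots> \<le> 4 * (A / \<gamma>) * q y"
          using A_pos \<gamma>_pos q_nonneg by (intro mult_right_mono mult_left_mono) (auto simp: q_def mult_le_cancel_left1 divide_right_mono)
        finally show ?thesis .
      qed
    qed
    then show ?thesis using q_integrals by (simp add: power2_eq_square mult_ac)
  qed
  \<comment> \<open>As m >= 1, |den|^2 is at least y^2 plus the square of \<open>\<gamma>\<close>.
    The adjoint is thus dominated by a Lorentzian of width \<open>\<gamma>\<close>, and its squared
    norm is of order 1 / \<open>\<gamma>\<close>.\<close>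
  have G: "(LBINT y. (cmod (g y))\<^sup>2) \<le> 4 * lorentz_mass / \<gamma>"
  proof -
    have "(LBINT y. (cmod (g y))\<^sup>2) \<le> (LBINT y. 4 / \<gamma>\<^sup>2 * (1 / (1 + (y / \<gamma>)\<^sup>2)))"
    proof (rule integral_mono[OF ints(3)])
      show "integrable lborel (\<lambda>y. 4 / \<gamma>\<^sup>2 * (1 / (1 + (y / \<gamma>)\<^sup>2)))"
        by (rule integrable_mult_right[OF integrable_rescale[OF \<gamma>_pos integrable_inverse_quadratic]])
      show "(cmod (g y))\<^sup>2 \<le> 4 / \<gamma>\<^sup>2 * (1 / (1 + (y / \<gamma>)\<^sup>2))" for y
      proof -
        have "\<gamma>\<^sup>2 * (1 + (y / \<gamma>)\<^sup>2) = y\<^sup>2 + \<gamma>\<^sup>2" using \<gamma>_pos by (simp add: power_divide distrib_left)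
        also have "\<dots> \<le> (b0 M \<gamma> y)\<^sup>2 + (\<gamma> * m)\<^sup>2"
          using abs_b0_ge[of y] m \<gamma>_pos by (intro add_mono) (auto simp: abs_le_square_iff power_mono)
        finally have D: "\<gamma>\<^sup>2 * (1 + (y / \<gamma>)\<^sup>2) \<le> (cmod (den m y))\<^sup>2" unfolding den_bounds(3) .
        have "(cmod (g y))\<^sup>2 = (cmod (\<phi> y))\<^sup>2 / (cmod (den m y))\<^sup>2"
          by (simp add: g_def norm_mult norm_inverse power_mult_distrib power_inverse divide_inverse)
        also have "\<dots> \<le> 2\<^sup>2 / (\<gamma>\<^sup>2 * (1 + (y / \<gamma>)\<^sup>2))"
          using D \<phi>2 \<gamma>_pos by (intro frac_le power_mono) (auto intro!: mult_pos_pos add_pos_nonneg)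
        finally show ?thesis by simp
      qed
    qed
    also have "\<dots> = 4 / \<gamma>\<^sup>2 * (\<gamma> * lorentz_mass)"
      unfolding integral_mult_right_zero integral_rescale[OF \<gamma>_pos integrable_inverse_quadratic] lorentz_mass_def ..
    finally show ?thesis using \<gamma>_pos by (simp add: power2_eq_square)
  qed
  have norms: "L2_norm \<omega> * L2_norm f \<le> 2 * pi * (4 * A * sqrt (gauss_mass * lorentz_mass) / \<gamma>)"
  proof -
    have "L2_norm \<omega> * L2_norm f = 2 * pi * sqrt ((LBINT y. (cmod (w y))\<^sup>2) * (LBINT y. (cmod (g y))\<^sup>2))"
    proof -
      have "sqrt (p * a) * sqrt (p * b) = p * sqrt (a * b)" if "0 \<le> p" for a b p :: real
      proof -
        have "(p * a) * (p * b) = p\<^sup>2 * (a * b)" by (simp add: power2_eq_square)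
        then show ?thesis using that by (metis real_sqrt_mult real_sqrt_unique)
      qed
      then show ?thesis
        unfolding \<omega>_def f_def L2_norm_mode[OF wc ints(2)] L2_norm_mode[OF gc ints(3)] by simp
    qed
    also have "\<dots> \<le> 2 * pi * sqrt ((4 * A\<^sup>2 * gauss_mass / \<gamma>) * (4 * lorentz_mass / \<gamma>))"
      using W G constants_pos A_pos \<gamma>_pos by (intro mult_left_mono real_sqrt_le_mono mult_mono) auto
    also have "(4 * A\<^sup>2 * gauss_mass / \<gamma>) * (4 * lorentz_mass / \<gamma>) = (4 * A / \<gamma>)\<^sup>2 * (gauss_mass * lorentz_mass)"
      by (simp add: power2_eq_square)
    also have "sqrt ((4 * A / \<gamma>)\<^sup>2 * (gauss_mass * lorentz_mass)) = 4 * A * sqrt (gauss_mass * lorentz_mass) / \<gamma>"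
      using A_pos \<gamma>_pos by (simp add: real_sqrt_mult)
    finally show ?thesis .
  qed
  have pair_ge: "2 * pi * (A * overlap / (16 * \<gamma>)) \<le> cmod (pairing \<omega> f)"
    using mult_left_mono[OF wg_ge, of "2 * pi"] unfolding pair by (simp add: norm_mult)
  show thesis
  proof (rule that[OF m L2 eigen adj])
    have "0 < 2 * pi * (A * overlap / (16 * \<gamma>))" using A_pos constants_pos \<gamma>_pos by simp
    then show "0 < cmod (pairing \<omega> f)" using pair_ge by linarith
    have "overlap / (64 * sqrt (gauss_mass * lorentz_mass)) * (L2_norm \<omega> * L2_norm f) \<le>
        overlap / (64 * sqrt (gauss_mass * lorentz_mass)) * (2 * pi * (4 * A * sqrt (gauss_mass * lorentz_mass) / \<gamma>))"
      using constants_pos by (intro mult_left_mono norms) auto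
    also have "\<dots> = 2 * pi * (A * overlap / (16 * \<gamma>))"
      using constants_pos by simp
    finally show "overlap / (64 * sqrt (gauss_mass * lorentz_mass)) * (L2_norm \<omega> * L2_norm f) \<le> cmod (pairing \<omega> f)"
      using pair_ge by linarith
  qed
qed

end

section \<open>Choice of the constants and conclusion\<close>

theorem theorem1p6:
  "\<exists>C>0::real. \<exists>M\<^sub>0>0::real. \<forall>M\<ge>M\<^sub>0. \<exists>\<gamma>\<^sub>0>0::real. \<forall>\<gamma>. 0 < \<gamma> \<and> \<gamma> \<le> \<gamma>\<^sub>0 \<longrightarrow>
     (\<exists>l. unstable_eigenvalue (rayleigh M \<gamma>) l \<and>
        - C * M * \<gamma> \<le> Re l \<and> Re l < - \<gamma> \<and>
        \<bar>Im l\<bar> \<le> 4 * \<gamma> * sqrt (ln (ln (inverse \<gamma>)))) \<and>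
     (\<exists>\<omega>\<^sub>i\<^sub>n\<in>L2. \<not> (AE z in cylinder. \<omega>\<^sub>i\<^sub>n z = 0) \<and>
        (\<forall>t>0. L2_norm (rayleigh_flow M \<gamma> t \<omega>\<^sub>i\<^sub>n) \<ge> inverse C * exp (\<gamma> * t) * L2_norm \<omega>\<^sub>i\<^sub>n))"
  (is "\<exists>C>0. \<exists>M\<^sub>0>0. \<forall>M\<ge>M\<^sub>0. \<exists>\<gamma>\<^sub>0>0. \<forall>\<gamma>. 0 < \<gamma> \<and> \<gamma> \<le> \<gamma>\<^sub>0 \<longrightarrow> ?P C M \<gamma>")
proof -
  define K where "K = 64 * sqrt (gauss_mass * lorentz_mass) / overlap"
  have K: "0 < K" using constants_pos by (simp add: K_def)
  have dispersion_nonneg: "0 \<le> dispersion m" for m unfolding dispersion_def by simp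
  \<comment> \<open>\<open>K\<close> is the inverse of the angle bound and serves the growth
    estimate; the other summand bounds Re l, because k m <= 2 k <
    \<open>A * dispersion 1\<close>.\<close>
  define C where "C = K + 4 * sqrt pi * dispersion 1"
  have C: "0 < C" "K \<le> C" "4 * sqrt pi * dispersion 1 \<le> C"
    using K dispersion_nonneg[of 1] unfolding C_def by (auto intro: add_pos_nonneg)
  \<comment> \<open>Chosen so that \<open>A * (dispersion 1 - dispersion 2)\<close> is at least 8
    for all M >= M0.\<close>
  define M0 where "M0 = 2 / (sqrt pi * (dispersion 1 - dispersion 2))"
  have M0: "0 < M0" using dispersion_less by (simp add: M0_def)
  show ?thesis
  proof (rule exI[of _ C], intro conjI C(1), rule exI[of _ M0], intro conjI M0 allI impI)
    fix M assume M: "M0 \<le> M"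
    have M_pos: "0 < M" using M M0 by simp
    define A where "A = 4 * sqrt pi * M"
    have A_pos: "0 < A" using M_pos by (simp add: A_def)
    have gap: "8 \<le> A * (dispersion 1 - dispersion 2)"
    proof -
      have "4 * sqrt pi * (2 / (sqrt pi * d)) * d = 8" if "d \<noteq> 0" for d :: real
        using that by simp
      from this[of "dispersion 1 - dispersion 2"] dispersion_less have "8 = 4 * sqrt pi * M0 * (dispersion 1 - dispersion 2)"
        unfolding M0_def by linarith
      also have "\<dots> \<le> A * (dispersion 1 - dispersion 2)"
        unfolding A_def using M dispersion_less by (intro mult_right_mono mult_left_mono) auto
      finally show ?thesis .
    qed
    text \<open>The wave number is chosen proportional to \<open>M\<close>, in the middle of the window in which the
      matching condition has a root with \<open>m\<close> of order one. This keeps the angle between the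
      eigenfunction and its adjoint bounded below uniformly in \<open>M\<close>.\<close>
    define k where "k = \<lfloor>A * (dispersion 1 + dispersion 2) / 4\<rfloor>"
    \<comment> \<open>With m >= 1, k >= 2 makes the growth rate k \<open>\<gamma>\<close> m at least
      2 \<open>\<gamma>\<close>, hence strictly larger than \<open>\<gamma>\<close>.\<close>
    have "2 \<le> A * (dispersion 1 + dispersion 2) / 4"
    proof -
      have "A * (dispersion 1 - dispersion 2) \<le> A * (dispersion 1 + dispersion 2)"
        using A_pos dispersion_nonneg[of 2] by (intro mult_left_mono) auto
      then show ?thesis using gap by linarith
    qed
    then have k2: "2 \<le> k" unfolding k_def by (simp add: le_floor_iff)
    have k_up: "real_of_int k \<le> A * (dispersion 1 + dispersion 2) / 4" and k_lo: "A * (dispersion 1 + dispersion 2) / 4 < real_of_int k + 1"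
      unfolding k_def by linarith+
    \<comment> \<open>Because of the floor, 2 k lies below the midpoint of the window by less than
      2, while each end of the window is at least 4 away from the midpoint.\<close>
    have win: "2 * real_of_int k < A * dispersion 1" "A * dispersion 2 < 2 * real_of_int k"
      using k_up k_lo gap by (auto simp: algebra_simps)
    define \<delta> where "\<delta> = (\<lambda>\<gamma>. A * \<gamma> * gauss_moment)"
    define S where "S = (\<lambda>\<gamma>. 1 + 2 * sqrt pi * M * \<gamma>)"
    define E where "E = 3 * real_of_int k + 2 * (A * gauss_mass)"
    \<comment> \<open>\<open>M\<close> and k are fixed from here on. As \<open>\<gamma>\<close>
      tends to 0 the hypotheses of \<open>instability\<close> tend to strict inequalities, those for
      \<open>lo\<close> and \<open>hi\<close> being \<open>win\<close>, so they hold for all small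
      \<open>\<gamma>\<close>.\<close>
    have lim\<delta>: "(\<delta> \<longlongrightarrow> 0) (at_right 0)" and limS: "(S \<longlongrightarrow> 1) (at_right 0)"
      unfolding \<delta>_def S_def by (auto intro!: tendsto_eq_intros)
    have "((\<lambda>\<gamma>. A / (S \<gamma>)\<^sup>2 * dispersion 1 - (2 * real_of_int k + \<delta> \<gamma> * E)) \<longlongrightarrow> A / 1\<^sup>2 * dispersion 1 - (2 * real_of_int k + 0 * E)) (at_right 0)"
      by (intro tendsto_intros lim\<delta> limS) simp
    then have e1: "\<forall>\<^sub>F \<gamma> in at_right 0. 0 < A / (S \<gamma>)\<^sup>2 * dispersion 1 - (2 * real_of_int k + \<delta> \<gamma> * E)"
      by (rule order_tendstoD) (use win in simp)
    have "((\<lambda>\<gamma>. 2 * real_of_int k - \<delta> \<gamma> * E - A * S \<gamma> * dispersion 2) \<longlongrightarrow> 2 * real_of_int k - 0 * E - A * 1 * dispersion 2) (at_right 0)"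
      by (intro tendsto_intros lim\<delta> limS)
    then have e2: "\<forall>\<^sub>F \<gamma> in at_right 0. 0 < 2 * real_of_int k - \<delta> \<gamma> * E - A * S \<gamma> * dispersion 2"
      by (rule order_tendstoD) (use win in simp)
    have "((\<lambda>\<gamma>. A * overlap / 16 - 3 * \<delta> \<gamma> * (real_of_int k + 2 * (A * gauss_mass))) \<longlongrightarrow> A * overlap / 16 - 3 * 0 * (real_of_int k + 2 * (A * gauss_mass))) (at_right 0)"
      by (intro tendsto_intros lim\<delta>)
    then have e3: "\<forall>\<^sub>F \<gamma> in at_right 0. 0 < A * overlap / 16 - 3 * \<delta> \<gamma> * (real_of_int k + 2 * (A * gauss_mass))"
      by (rule order_tendstoD) (use A_pos constants_pos in simp)
    have e4: "\<forall>\<^sub>F \<gamma> in at_right 0. \<delta> \<gamma> < 1 / 2"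
      by (rule order_tendstoD(2)[OF lim\<delta>]) simp
    have e5: "\<forall>\<^sub>F \<gamma> in at_right 0. S \<gamma> < 2"
      by (rule order_tendstoD(2)[OF limS]) simp
    \<comment> \<open>Below 1/e the iterated logarithm is nonnegative. \<open>sqrt\<close> is odd,
      so even with Im l = 0 the claimed bound would fail at a negative argument.\<close>
    have e6: "\<forall>\<^sub>F \<gamma>::real in at_right 0. \<gamma> < exp (- 1)"
      by (rule order_tendstoD(2)[OF tendsto_ident_at]) simp
    have "\<forall>\<^sub>F \<gamma> in at_right 0. 0 < A / (S \<gamma>)\<^sup>2 * dispersion 1 - (2 * real_of_int k + \<delta> \<gamma> * E) \<and>
        0 < 2 * real_of_int k - \<delta> \<gamma> * E - A * S \<gamma> * dispersion 2 \<and>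
        0 < A * overlap / 16 - 3 * \<delta> \<gamma> * (real_of_int k + 2 * (A * gauss_mass)) \<and> \<delta> \<gamma> < 1 / 2 \<and> S \<gamma> < 2 \<and> \<gamma> < exp (- 1)" (is "\<forall>\<^sub>F \<gamma> in at_right 0. ?good \<gamma>")
      using e1 e2 e3 e4 e5 e6 by eventually_elim simp
    then obtain b where b: "0 < b" and small: "\<And>\<gamma>. 0 < \<gamma> \<Longrightarrow> \<gamma> < b \<Longrightarrow> ?good \<gamma>"
      unfolding eventually_at_right_field by blast
    show "\<exists>\<gamma>\<^sub>0>0. \<forall>\<gamma>. 0 < \<gamma> \<and> \<gamma> \<le> \<gamma>\<^sub>0 \<longrightarrow> ?P C M \<gamma>"
    proof (rule exI[of _ "b / 2"], intro conjI allI impI)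
      show "0 < b / 2" using b by simp
      fix \<gamma> assume "0 < \<gamma> \<and> \<gamma> \<le> b / 2"
      then have \<gamma>: "0 < \<gamma>" "\<gamma> < b" using b by auto
      note s = small[OF \<gamma>]
      interpret g: gaussian_shear M \<gamma> by unfold_locales (fact M_pos, fact \<gamma>(1))
      have gA: "g.A = A" and gS: "g.S = S \<gamma>" by (simp_all add: g.A_def g.S_def A_def S_def)
      obtain m \<omega> f where m: "1 \<le> m" "m \<le> 2" and L2: "\<omega> \<in> L2" "f \<in> L2"
        and eigen: "\<And>a. rayleigh M \<gamma> (\<lambda>z. a * \<omega> z) (\<lambda>z. a * of_real (- (real_of_int k * \<gamma> * m)) * \<omega> z)"
        and adj: "\<And>U h. rayleigh M \<gamma> U h \<Longrightarrow> pairing h f = of_real (- (real_of_int k * \<gamma> * m)) * pairing U f"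
        and p: "0 < cmod (pairing \<omega> f)"
          "overlap / (64 * sqrt (gauss_mass * lorentz_mass)) * (L2_norm \<omega> * L2_norm f) \<le> cmod (pairing \<omega> f)"
      proof (rule g.instability[of k])
        show "0 < k" using k2 by simp
        show "g.A * \<gamma> * gauss_moment \<le> 1 / 2" "g.S \<le> 2"
          "2 * real_of_int k + g.A * \<gamma> * gauss_moment * (3 * real_of_int k + 2 * (g.A * gauss_mass)) \<le> g.A / g.S\<^sup>2 * dispersion 1"
          "g.A * g.S * dispersion 2 \<le> 2 * real_of_int k - g.A * \<gamma> * gauss_moment * (3 * real_of_int k + 2 * (g.A * gauss_mass))"
          "3 * (g.A * \<gamma> * gauss_moment) * (real_of_int k + 2 * (g.A * gauss_mass)) \<le> g.A * overlap / 16"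
          unfolding gA gS using s unfolding \<delta>_def E_def by linarith+
      qed blast
      define r where "r = real_of_int k * \<gamma> * m"
      define l where "l = complex_of_real (- r)"
      have r_gt: "\<gamma> < r"
      proof -
        have "\<gamma> * 2 \<le> \<gamma> * (real_of_int k * m)"
          using k2 m mult_mono[of 2 "real_of_int k" 1 m] \<gamma> by (intro mult_left_mono) auto
        then show ?thesis using \<gamma> by (simp add: r_def mult_ac)
      qed
      have r_le: "r \<le> C * M * \<gamma>"
      proof -
        have "real_of_int k * m \<le> 2 * real_of_int k" using m k2 by simp
        also have "\<dots> \<le> 4 * sqrt pi * dispersion 1 * M" using win(1) unfolding A_def by (simp add: mult_ac)
        also have "\<dots> \<le> C * M" using C(3) M_pos by (intro mult_right_mono) auto
        finally have "\<gamma> * (real_of_int k * m) \<le> \<gamma> * (C * M)" using \<gamma> by (intro mult_left_mono) auto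
        then show ?thesis by (simp add: r_def mult_ac)
      qed
      have nonzero: "\<not> (AE z in cylinder. \<omega> z = 0)"
      proof
        assume "AE z in cylinder. \<omega> z = 0"
        then have "pairing \<omega> f = 0"
          unfolding pairing_def by (intro integral_eq_zero_AE) (auto elim: eventually_mono)
        then show False using p(1) by simp
      qed
      have "rayleigh M \<gamma> \<omega> (\<lambda>z. l * \<omega> z)" using eigen[of 1] by (simp add: l_def r_def)
      then have "unstable_eigenvalue (rayleigh M \<gamma>) l"
        unfolding unstable_eigenvalue_def eigenvalue_def using L2 nonzero r_gt \<gamma> by (auto simp: l_def)
      moreover have "0 \<le> 4 * \<gamma> * sqrt (ln (ln (inverse \<gamma>)))"
      proof -
        have "ln \<gamma> < - 1" using s \<gamma> ln_less_cancel_iff[of \<gamma> "exp (- 1)"] by simp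
        then have "1 \<le> ln (inverse \<gamma>)" using \<gamma> by (simp add: ln_inverse)
        then show ?thesis using \<gamma> by simp
      qed
      ultimately show "\<exists>l. unstable_eigenvalue (rayleigh M \<gamma>) l \<and>
        - C * M * \<gamma> \<le> Re l \<and> Re l < - \<gamma> \<and> \<bar>Im l\<bar> \<le> 4 * \<gamma> * sqrt (ln (ln (inverse \<gamma>)))"
        using r_gt r_le by (intro exI[of _ l]) (simp add: l_def)
      show "\<exists>\<omega>\<^sub>i\<^sub>n\<in>L2. \<not> (AE z in cylinder. \<omega>\<^sub>i\<^sub>n z = 0) \<and>
        (\<forall>t>0. L2_norm (rayleigh_flow M \<gamma> t \<omega>\<^sub>i\<^sub>n) \<ge> inverse C * exp (\<gamma> * t) * L2_norm \<omega>\<^sub>i\<^sub>n)"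
      proof (intro bexI[OF _ L2(1)] conjI allI impI nonzero)
        fix t :: real assume t: "0 < t"
        \<comment> \<open>Positive because the pairing is nonzero; this allows the norm of f to be
          cancelled at the end.\<close>
        have f_pos: "0 < L2_norm f"
          using less_le_trans[OF p(1) pairing_Cauchy_Schwarz[OF L2]] L2_norm_nonneg[of f]
          by (cases "L2_norm f = 0") auto
        have Cinv: "inverse C \<le> overlap / (64 * sqrt (gauss_mass * lorentz_mass))"
          using le_imp_inverse_le[OF C(2) K] by (simp add: K_def)
        have "l \<noteq> 0" using r_gt \<gamma> by (simp add: l_def)
        then have "exp (- Re l * t) * cmod (pairing \<omega> f) \<le> L2_norm (rayleigh_flow M \<gamma> t \<omega>) * L2_norm f"
          using t by (intro rayleigh_flow_lower_bound[where l = l] L2 eigen[folded r_def, folded l_def] adj[folded r_def, folded l_def]) auto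
        moreover have "exp (\<gamma> * t) * (inverse C * (L2_norm \<omega> * L2_norm f)) \<le> exp (- Re l * t) * cmod (pairing \<omega> f)"
        proof (rule mult_mono)
          show "exp (\<gamma> * t) \<le> exp (- Re l * t)" using r_gt t by (simp add: l_def)
          show "inverse C * (L2_norm \<omega> * L2_norm f) \<le> cmod (pairing \<omega> f)"
            using mult_right_mono[OF Cinv, of "L2_norm \<omega> * L2_norm f"] p(2) L2_norm_nonneg by simp
        qed (use C L2_norm_nonneg in auto)
        ultimately have "(inverse C * exp (\<gamma> * t) * L2_norm \<omega>) * L2_norm f \<le> L2_norm (rayleigh_flow M \<gamma> t \<omega>) * L2_norm f"
          by (simp add: mult_ac)
        then show "inverse C * exp (\<gamma> * t) * L2_norm \<omega> \<le> L2_norm (rayleigh_flow M \<gamma> t \<omega>)"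
          using f_pos by (rule mult_right_le_imp_le)
      qed
    qed
  qed
qed

end
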